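(* Let $F$ be a field and $(A,\sigma)$ an $F$-algebra with involution. Let $L$ be an étale $F$-subalgebra of $A$ with $L\subseteq\mathrm{Sym}(\sigma)$ and such that $[L:F]=\mathrm{cap}(A,\sigma)$. Then $L$ is neat in $(A,\sigma)$.
   Context: $F$ is an arbitrary field (any characteristic). Algebras are associative and unital, and subalgebras contain the unity. An étale $F$-algebra is one isomorphic to a finite product of finite separable field extensions of $F$; $[L:F]=\dim_F L$ for a commutative $F$-algebra $L$. An $F$-algebra with involution is a pair $(A,\sigma)$ where $A$ is a finite-dimensional $F$-algebra and $\sigma:A\to A$ is an $F$-linear anti-automorphism with $\sigma\circ\sigma=\mathrm{id}_A$, such that $F=Z(A)\cap\mathrm{Sym}(\sigma)$ and $A$ has no nontrivial two-sided ideal $I$ with $\sigma(I)=I$. Here $\mathrm{Sym}(\sigma)=\{x\in A\mid\sigma(x)=x\}$, $\mathrm{Skew}(\sigma)=\{x\in A\mid\sigma(x)=-x\}$, $\mathrm{Symd}(\sigma)=\{x+\sigma(x)\mid x\in A\}$. Either $Z(A)=F$ (first kind) or $Z(A)$ is a quadratic étale $F$-algebra (second kind). Type: if $\sigma$ is of the first kind, it is symplectic if $\dim_F\mathrm{Symd}(\sigma)<\dim_F\mathrm{Skew}(\sigma)$ and $1\in\mathrm{Symd}(\sigma)$, and orthogonal otherwise; if $\sigma$ is of the second kind it is unitary. The degree $\deg A$ is the degree of $A$ as a central simple $Z(A)$-algebra if $Z(A)$ is a field, and the degree of either of the two simple components of $A$ if $Z(A)\simeq F\times F$. The capacity is $\mathrm{cap}(A,\sigma)=\deg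 A$ if $\sigma$ is orthogonal or unitary, and $\frac12\deg A$ if $\sigma$ is symplectic. An $F$-subalgebra $L$ of $A$ is neat in $(A,\sigma)$ if $L$ is étale, $L\subseteq\mathrm{Sym}(\sigma)$, $A$ is free as a left $L$-module, and for each nonzero idempotent $e$ of $L$ the $F$-algebra with involution $(eAe,\sigma|_{eAe})$ (with unity $e$ and $F$ identified with $Fe$) has the same type (orthogonal, symplectic or unitary) as $(A,\sigma)$. *)

theory Defs
  imports Complex_Main "HOL-Library.FuncSet" "HOL-Computational_Algebra.Polynomial"
begin

text \<open>
  The base field is the type \<open>'f\<close> and the ambient algebra is the type \<open>'a\<close>; as
  \<open>'a :: ring_1\<close>, it is nonzero.
\<close>

locale assoc_algebra = vector_space scale
  for scale :: "'f::field \<Rightarrow> 'a::ring_1 \<Rightarrow> 'a" (infixr \<open>*s\<close> 75) +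
  assumes scale_mult_left: "c *s (x * y) = (c *s x) * y"
    and scale_mult_right: "c *s (x * y) = x * (c *s y)"
begin

text \<open>
  Subalgebras, centres, ideals and corners \<open>eAe\<close> are all given by a carrier \<open>S\<close> inside \<open>'a\<close>
  together with a unity \<open>u\<close>, which need not be \<open>1\<close>: \<open>(S, u)\<close> is an algebra in its own right.
  A unital subalgebra of \<open>(S, u)\<close> is a \<open>T \<subseteq> S\<close> such that \<open>(T, u)\<close> is an algebra.
\<close>

definition algebra_on :: "'a set \<Rightarrow> 'a \<Rightarrow> bool" where
  "algebra_on S u \<longleftrightarrow> subspace S \<and> (\<forall>x\<in>S. \<forall>y\<in>S. x * y \<in> S)
     \<and> u \<in> S \<and> (\<forall>x\<in>S. u * x = x \<and> x * u = x)"

definition finite_dim :: "'a set \<Rightarrow> bool" where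
  "finite_dim S \<longleftrightarrow> (\<exists>B. finite B \<and> B \<subseteq> S \<and> span B = S)"

definition centre :: "'a set \<Rightarrow> 'a set" where
  "centre S = {z \<in> S. \<forall>x\<in>S. z * x = x * z}"

definition scalars :: "'a \<Rightarrow> 'a set" where
  "scalars u = {c *s u | c. True}"

definition ideal_on :: "'a set \<Rightarrow> 'a set \<Rightarrow> bool" where
  "ideal_on S I \<longleftrightarrow> I \<subseteq> S \<and> 0 \<in> I \<and> (\<forall>x\<in>I. \<forall>y\<in>I. x - y \<in> I)
     \<and> (\<forall>a\<in>S. \<forall>x\<in>I. a * x \<in> I \<and> x * a \<in> I)"

definition field_on :: "'a set \<Rightarrow> 'a \<Rightarrow> bool" where
  "field_on K u \<longleftrightarrow> algebra_on K u \<and> u \<noteq> 0 \<and> (\<forall>x\<in>K. \<forall>y\<in>K. x * y = y * x)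
     \<and> (\<forall>x\<in>K. x \<noteq> 0 \<longrightarrow> (\<exists>y\<in>K. x * y = u))"


subsection \<open>Etale algebras\<close>

text \<open>
  Evaluation in \<open>(K, u)\<close>, for \<open>x \<in> K\<close>: the factor \<open>u\<close> turns the constant term, where the
  ambient \<open>x ^ 0 = 1\<close> is used, into a multiple of \<open>u\<close> and leaves the other terms unchanged.
\<close>

definition eval_on :: "'a \<Rightarrow> 'f poly \<Rightarrow> 'a \<Rightarrow> 'a" where
  "eval_on u p x = u * (\<Sum>i\<le>degree p. coeff p i *s x ^ i)"

definition is_min_poly :: "'a \<Rightarrow> 'a \<Rightarrow> 'f poly \<Rightarrow> bool" where
  "is_min_poly u x p \<longleftrightarrow> lead_coeff p = 1 \<and> eval_on u p x = 0
     \<and> (\<forall>q. q \<noteq> 0 \<and> eval_on u q x = 0 \<longrightarrow> degree p \<le> degree q)"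

definition finite_separable_extension :: "'a set \<Rightarrow> 'a \<Rightarrow> bool" where
  "finite_separable_extension K u \<longleftrightarrow> field_on K u \<and> finite_dim K
     \<and> (\<forall>x\<in>K. \<exists>p. is_min_poly u x p \<and> coprime p (pderiv p))"

text \<open>
  The factors may be sought inside \<open>'a\<close>: a factor of a product isomorphic to \<open>L\<close> is isomorphic
  to some \<open>eL \<subseteq> L\<close>, with \<open>e\<close> the corresponding idempotent of \<open>L\<close> as its unity.
\<close>

definition etale :: "'a set \<Rightarrow> 'a \<Rightarrow> bool" where
  "etale L u \<longleftrightarrow> algebra_on L u \<and>
     (\<exists>(n::nat) K v \<phi>.
        (\<forall>i<n. finite_separable_extension (K i) (v i))
      \<and> bij_betw \<phi> L (\<Pi>\<^sub>E i\<in>{..<n}. K i)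
      \<and> (\<forall>i<n. \<phi> u i = v i
           \<and> (\<forall>x\<in>L. \<forall>y\<in>L. \<phi> (x + y) i = \<phi> x i + \<phi> y i)
           \<and> (\<forall>x\<in>L. \<forall>y\<in>L. \<phi> (x * y) i = \<phi> x i * \<phi> y i)
           \<and> (\<forall>c. \<forall>x\<in>L. \<phi> (c *s x) i = c *s \<phi> x i)))"


subsection \<open>Free modules and degrees\<close>

definition left_basis :: "'a set \<Rightarrow> 'a set \<Rightarrow> 'a set \<Rightarrow> bool" where
  "left_basis L S B \<longleftrightarrow> finite B \<and> B \<subseteq> S
     \<and> (\<forall>x\<in>S. \<exists>!f. f \<in> (\<Pi>\<^sub>E b\<in>B. L) \<and> x = (\<Sum>b\<in>B. f b * b))"

text \<open>No generality is lost by asking for a finite basis, all modules below being finitely generated.\<close>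

definition free_left_module :: "'a set \<Rightarrow> 'a set \<Rightarrow> bool" where
  "free_left_module L S \<longleftrightarrow> (\<exists>B. left_basis L S B)"

definition dim_over :: "'a set \<Rightarrow> 'a set \<Rightarrow> nat" where
  "dim_over K S = (THE n. \<exists>B. left_basis K S B \<and> card B = n)"

text \<open>
  The degree of a central simple algebra is the square root of its dimension over its centre.
  It is an integer, but it is kept as a real number so that no rounding is involved.
\<close>

definition csa_degree :: "'a set \<Rightarrow> real" where
  "csa_degree S = sqrt (real (dim_over (centre S) S))"

definition simple_component :: "'a set \<Rightarrow> 'a set \<Rightarrow> bool" where
  "simple_component S B \<longleftrightarrow> ideal_on S B \<and> B \<noteq> {0}
     \<and> (\<forall>I. ideal_on S I \<and> I \<subseteq> B \<longrightarrow> I = {0} \<or> I = B)"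

text \<open>
  For an algebra with involution, the centre is a field or a product of two copies of the base
  field; in the latter case both simple components have the same degree.
\<close>

definition deg :: "'a set \<Rightarrow> 'a \<Rightarrow> real" where
  "deg S u = (if field_on (centre S) u then csa_degree S
              else csa_degree (SOME B. simple_component S B))"


subsection \<open>Algebras with involution\<close>

definition Sym :: "'a set \<Rightarrow> ('a \<Rightarrow> 'a) \<Rightarrow> 'a set" where
  "Sym S \<sigma> = {x \<in> S. \<sigma> x = x}"

definition Skew :: "'a set \<Rightarrow> ('a \<Rightarrow> 'a) \<Rightarrow> 'a set" where
  "Skew S \<sigma> = {x \<in> S. \<sigma> x = - x}"

definition Symd :: "'a set \<Rightarrow> ('a \<Rightarrow> 'a) \<Rightarrow> 'a set" where
  "Symd S \<sigma> = {x + \<sigma> x | x. x \<in> S}"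

text \<open>
  The map \<open>\<sigma>\<close> only matters on \<open>S\<close>, so that restrictions are implicit. The condition \<open>u \<noteq> 0\<close> is
  what allows identifying the base field with the multiples of \<open>u\<close>.
\<close>

definition algebra_with_involution :: "'a set \<Rightarrow> 'a \<Rightarrow> ('a \<Rightarrow> 'a) \<Rightarrow> bool" where
  "algebra_with_involution S u \<sigma> \<longleftrightarrow>
     algebra_on S u \<and> u \<noteq> 0 \<and> finite_dim S
   \<and> (\<forall>x\<in>S. \<sigma> x \<in> S \<and> \<sigma> (\<sigma> x) = x)
   \<and> (\<forall>x\<in>S. \<forall>y\<in>S. \<sigma> (x + y) = \<sigma> x + \<sigma> y \<and> \<sigma> (x * y) = \<sigma> y * \<sigma> x)
   \<and> (\<forall>c. \<forall>x\<in>S. \<sigma> (c *s x) = c *s \<sigma> x)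
   \<and> scalars u = centre S \<inter> Sym S \<sigma>
   \<and> (\<forall>I. ideal_on S I \<and> \<sigma> ` I = I \<longrightarrow> I = {0} \<or> I = S)"

definition first_kind :: "'a set \<Rightarrow> 'a \<Rightarrow> bool" where
  "first_kind S u \<longleftrightarrow> centre S = scalars u"

definition second_kind :: "'a set \<Rightarrow> 'a \<Rightarrow> bool" where
  "second_kind S u \<longleftrightarrow> etale (centre S) u \<and> dim (centre S) = 2"

definition symplectic :: "'a set \<Rightarrow> 'a \<Rightarrow> ('a \<Rightarrow> 'a) \<Rightarrow> bool" where
  "symplectic S u \<sigma> \<longleftrightarrow> first_kind S u \<and> dim (Symd S \<sigma>) < dim (Skew S \<sigma>) \<and> u \<in> Symd S \<sigma>"

definition orthogonal :: "'a set \<Rightarrow> 'a \<Rightarrow> ('a \<Rightarrow> 'a) \<Rightarrow> bool" where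
  "orthogonal S u \<sigma> \<longleftrightarrow> first_kind S u \<and> \<not> symplectic S u \<sigma>"

definition unitary :: "'a set \<Rightarrow> 'a \<Rightarrow> bool" where
  "unitary S u \<longleftrightarrow> second_kind S u"

definition same_type :: "'a set \<Rightarrow> 'a \<Rightarrow> 'a set \<Rightarrow> 'a \<Rightarrow> ('a \<Rightarrow> 'a) \<Rightarrow> bool" where
  "same_type S u T v \<sigma> \<longleftrightarrow>
     orthogonal S u \<sigma> \<and> orthogonal T v \<sigma>
   \<or> symplectic S u \<sigma> \<and> symplectic T v \<sigma>
   \<or> unitary S u \<and> unitary T v"

definition cap :: "'a set \<Rightarrow> 'a \<Rightarrow> ('a \<Rightarrow> 'a) \<Rightarrow> real" where
  "cap S u \<sigma> = (if symplectic S u \<sigma> then deg S u / 2 else deg S u)"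

definition corner :: "'a set \<Rightarrow> 'a \<Rightarrow> 'a set" where
  "corner S e = {e * x * e | x. x \<in> S}"

definition neat :: "'a set \<Rightarrow> 'a \<Rightarrow> ('a \<Rightarrow> 'a) \<Rightarrow> 'a set \<Rightarrow> bool" where
  "neat S u \<sigma> L \<longleftrightarrow> L \<subseteq> S \<and> etale L u \<and> L \<subseteq> Sym S \<sigma> \<and> free_left_module L S
   \<and> (\<forall>e\<in>L. e \<noteq> 0 \<and> e * e = e \<longrightarrow>
        algebra_with_involution (corner S e) e \<sigma> \<and> same_type S u (corner S e) e \<sigma>)"

end

end

theory Submission
  imports Defs "HOL-Library.Function_Algebras"
begin

text \<open>
  Write \<open>A\<close> for the algebra, \<open>F\<close> for the base field, \<open>e\<^sub>1, \<dots>, e\<^sub>n\<close> for the primitive idempotents of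
  \<open>L\<close>, and \<open>K\<^sub>i = e\<^sub>iL\<close> for the fields whose product is \<open>L\<close>. The proof counts dimensions in the
  corners \<open>e\<^sub>iAe\<^sub>i\<close>, over \<open>F\<close> itself and without splitting \<open>A\<close> by an extension of scalars.

  In a simple algebra every idempotent is an orthogonal sum of copies of one idempotent \<open>E\<close>
  for which \<open>EAE\<close> is a division algebra. A function of idempotents that is additive and invariant
  under equivalence is therefore a multiple of one and the same rank function
  (\<open>trace_like_multiple\<close>). It follows that \<open>sqrt (dim eAe)\<close> is additive over orthogonal
  idempotents, and that \<open>dim eA\<close> is the geometric mean of \<open>dim eAe\<close> and \<open>dim A\<close>.

  If the centre \<open>Z\<close> is a field and \<open>K\<close> is a subfield of \<open>eAe\<close> containing \<open>eZ\<close>, then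
  \<open>dim Z * dim eAe = m * (dim K)\<^sup>2\<close>, where \<open>m \<ge> 1\<close> is the dimension over \<open>K\<close> of the centraliser of
  \<open>K\<close> (\<open>double_centraliser_dim\<close>). So \<open>dim K\<close> bounds \<open>sqrt (dim Z * dim eAe)\<close> from below, and if the
  dimensions of several such fields add up to \<open>sqrt (dim Z * dim A)\<close>, all these bounds are attained
  (\<open>bounds_attained\<close>): each field is its own centraliser, and \<open>dim e\<^sub>iA\<close> is proportional to
  \<open>dim K\<^sub>i\<close>. The latter makes \<open>A\<close> free over \<open>L\<close> (\<open>free_if_equal_ranks\<close>). In the orthogonal case
  this applies to the \<open>K\<^sub>i\<close> themselves. In the unitary case it applies to the algebras \<open>K\<^sub>iZ\<close>, of
  dimension \<open>2 dim K\<^sub>i\<close>, if \<open>Z\<close> is a field, and otherwise to the images of the \<open>K\<^sub>i\<close> in one of the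
  two simple components of \<open>A\<close>.

  In the symplectic case the numbers \<open>2 dim K\<^sub>i\<close> are the ones that add up to \<open>sqrt (dim A)\<close>, and what
  is needed is \<open>m \<ge> 4\<close>. Comparing ranks shows that \<open>m\<close> is the square of an integer. The value
  \<open>m = 1\<close> is excluded by \<open>symmetric_maximal_subfield\<close>: for a symmetric separable element \<open>\<theta>\<close>, the
  map \<open>[\<theta>, -]\<close> exchanges symmetric and skew elements and is semisimple at \<open>0\<close>, so the difference
  between the numbers of symmetric and skew dimensions does not change on passing to the centraliser
  of \<open>\<theta>\<close>, and hence not on passing to the centraliser of \<open>K\<^sub>i\<close>. If the latter is \<open>K\<^sub>i\<close>, all of it
  symmetric, this is incompatible with a symplectic type. This is where separability is used.

  The kind of \<open>\<sigma>\<close> passes to corners because the centre of \<open>eAe\<close> is \<open>eZ\<close>. For the dimension condition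
  in the definition of symplectic involutions, the difference \<open>dim Skew - dim Symd\<close> on \<open>eA\<sigma>(e)\<close> is
  additive and invariant under equivalence of idempotents, also at idempotents that are not
  symmetric, so its sign is the same for all nonzero \<open>e\<close> (\<open>Skew_Symd_dims_corner\<close>). The condition
  that the unity lies in \<open>Symd\<close> passes from \<open>A\<close> to its corners. It passes back from the corner of a
  nonzero idempotent of \<open>L\<close> in the orthogonal case: it then holds in some \<open>e\<^sub>iAe\<^sub>i\<close>, where \<open>K\<^sub>i\<close> is
  its own centraliser, and this forces \<open>2 \<noteq> 0\<close>.
\<close>

section \<open>Linear algebra\<close>

locale fd_algebra = assoc_algebra scale + finite_dimensional_vector_space scale Basis
  for scale :: "'f::field \<Rightarrow> 'a::ring_1 \<Rightarrow> 'a" (infixr \<open>*s\<close> 75) and Basis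
begin

lemma dim_direct_sum:
  assumes "subspace V" "subspace W" "V \<inter> W = {0}"
  shows "dim {x + y | x y. x \<in> V \<and> y \<in> W} = dim V + dim W"
  using dim_sums_Int[OF assms(1,2)] assms(3) by simp

lemma subspace_complement:
  assumes "subspace U" "subspace V" "U \<subseteq> V"
  obtains W where "subspace W" "W \<subseteq> V" "U \<inter> W = {0}" "V = {x + y | x y. x \<in> U \<and> y \<in> W}"
proof -
  obtain B0 where B0: "B0 \<subseteq> U" "independent B0" "U \<subseteq> span B0" "card B0 = dim U"
    by (rule basis_exists)
  obtain B where B: "B0 \<subseteq> B" "B \<subseteq> V" "independent B" "V \<subseteq> span B"
    using maximal_independent_subset_extend[OF subset_trans[OF B0(1) assms(3)] B0(2)] .
  have U: "span B0 = U" using span_subspace[OF B0(1,3) assms(1)] .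
  have V: "span B = V" using span_subspace[OF B(2,4) assms(2)] .
  define W where "W = span (B - B0)"
  have sW: "subspace W" by (simp add: W_def)
  have "B = B0 \<union> (B - B0)" using B(1) by blast
  hence sum: "V = {x + y | x y. x \<in> U \<and> y \<in> W}"
    using span_Un[of B0 "B - B0"] unfolding U V W_def by (simp add: V)
  have fin: "finite B" using B(3) finiteI_independent by blast
  have ind: "independent (B - B0)" using B(3) independent_mono by blast
  have "dim U = card B0" "dim V = card B" "dim W = card (B - B0)"
    using dim_span_eq_card_independent[OF B0(2)] dim_span_eq_card_independent[OF B(3)]
      dim_span_eq_card_independent[OF ind] U V W_def by simp_all
  moreover have "card B = card B0 + card (B - B0)"
    using card_Diff_subset[of B0 B] card_mono[OF fin B(1)] finite_subset[OF B(1) fin] B(1) by simp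
  ultimately have "dim (U \<inter> W) = 0"
    using dim_sums_Int[OF assms(1) sW] sum by simp
  hence "U \<inter> W \<subseteq> {0}" by simp
  moreover have "0 \<in> U \<inter> W" using assms(1) sW subspace_0 by blast
  ultimately have "U \<inter> W = {0}" by blast
  moreover have "W \<subseteq> V" unfolding V[symmetric] W_def by (simp add: span_mono)
  ultimately show ?thesis using that[OF sW _ _ sum] by simp
qed

abbreviation lin :: "('a \<Rightarrow> 'a) \<Rightarrow> bool" where
  "lin T \<equiv> Vector_Spaces.linear scale scale T"

lemma linI:
  assumes "\<And>x y. T (x + y) = T x + T y" "\<And>c x. T (c *s x) = c *s T x"
  shows "lin T"
  by (simp add: Vector_Spaces.linear_iff vector_space_axioms assms)

lemma lin_add: "lin T \<Longrightarrow> T (x + y) = T x + T y"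
  and lin_scale: "lin T \<Longrightarrow> T (c *s x) = c *s T x"
  by (simp_all add: Vector_Spaces.linear_iff)

lemma lin_0: "lin T \<Longrightarrow> T 0 = 0"
proof -
  assume T: "lin T"
  have "T 0 + T 0 = T 0" using lin_add[OF T, of 0 0] by simp
  thus ?thesis by simp
qed

lemma lin_minus: "lin T \<Longrightarrow> T (- x) = - T x"
proof -
  assume T: "lin T"
  have "T (- x) + T x = 0" using lin_add[OF T, of "- x" x] lin_0[OF T] by simp
  thus ?thesis by (simp add: eq_neg_iff_add_eq_0)
qed

lemma lin_diff: "lin T \<Longrightarrow> T (x - y) = T x - T y"
  using lin_add[of T x "- y"] lin_minus[of T y] by simp

lemma lin_mult_left: "lin (\<lambda>x. a * x)"
  and lin_mult_right: "lin (\<lambda>x. x * a)"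
  and lin_mult_both: "lin (\<lambda>x. a * x * b)"
  by (intro linI; simp add: distrib_left distrib_right scale_mult_left[symmetric] scale_mult_right[symmetric])+

lemma subspaceI2:
  assumes "0 \<in> S" "\<And>x y. x \<in> S \<Longrightarrow> y \<in> S \<Longrightarrow> x + y \<in> S" "\<And>c x. x \<in> S \<Longrightarrow> c *s x \<in> S"
  shows "subspace S"
  using assms by (auto simp: subspace_def)

lemma subspace_image_lin: "lin T \<Longrightarrow> subspace V \<Longrightarrow> subspace (T ` V)"
proof -
  assume T: "lin T" and V: "subspace V"
  show "subspace (T ` V)"
  proof (rule subspaceI2)
    show "0 \<in> T ` V" using lin_0[OF T] subspace_0[OF V] by (metis imageI)
    fix x y assume "x \<in> T ` V" "y \<in> T ` V"
    then obtain a b where "a \<in> V" "b \<in> V" "x = T a" "y = T b" by blast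
    thus "x + y \<in> T ` V" using lin_add[OF T, of a b] subspace_add[OF V, of a b] by (metis imageI)
  next
    fix c x assume "x \<in> T ` V"
    then obtain a where "a \<in> V" "x = T a" by blast
    thus "c *s x \<in> T ` V" using lin_scale[OF T, of c a] subspace_scale[OF V, of a c] by (metis imageI)
  qed
qed

lemma subspace_kernel_lin: "lin T \<Longrightarrow> subspace V \<Longrightarrow> subspace {x \<in> V. T x = 0}"
  unfolding subspace_def by (simp add: lin_0 lin_add lin_scale)

lemma dim_image_inj:
  assumes "lin T" "subspace V" "inj_on T V"
  shows "dim (T ` V) = dim V"
proof -
  interpret endo: finite_dimensional_vector_space_pair scale Basis scale Basis
    by unfold_locales
  show ?thesis using endo.dim_image_eq[of T V] assms by (metis span_eq_iff)
qed

lemma inj_onI_lin: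
  assumes "lin T" "subspace V" "\<And>x. x \<in> V \<Longrightarrow> T x = 0 \<Longrightarrow> x = 0"
  shows "inj_on T V"
proof (rule inj_onI)
  fix x y assume "x \<in> V" "y \<in> V" "T x = T y"
  hence "x - y \<in> V" "T (x - y) = 0"
    using assms(1,2) by (auto simp: subspace_diff lin_diff)
  hence "x - y = 0" using assms(3) by blast
  thus "x = y" by simp
qed

lemma rank_nullity:
  assumes T: "lin T" and V: "subspace V"
  shows "dim V = dim (T ` V) + dim {x \<in> V. T x = 0}"
proof -
  let ?U = "{x \<in> V. T x = 0}"
  have U: "subspace ?U" using subspace_kernel_lin T V by blast
  obtain W where W: "subspace W" "W \<subseteq> V" "?U \<inter> W = {0}" "V = {x + y | x y. x \<in> ?U \<and> y \<in> W}"
    using subspace_complement[OF U V] by blast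
  have img: "T ` V = T ` W"
  proof
    show "T ` V \<subseteq> T ` W"
    proof
      fix z assume "z \<in> T ` V"
      then obtain v where v: "v \<in> V" "z = T v" by blast
      then obtain x y where "v = x + y" "x \<in> ?U" "y \<in> W" using W(4) by blast
      thus "z \<in> T ` W" using v lin_add[OF T, of x y] by simp
    qed
  qed (use W(2) in blast)
  have "inj_on T W" using inj_onI_lin[OF T W(1)] W(2,3) by blast
  hence "dim (T ` W) = dim W" by (rule dim_image_inj[OF T W(1)])
  moreover have "dim V = dim ?U + dim W"
    using dim_direct_sum[OF U W(1) W(3)] W(4) by simp
  ultimately show ?thesis using img by simp
qed

lemma dim_bij_eq:
  assumes "lin T" "subspace V" "bij_betw T V W"
  shows "dim W = dim V"
  using dim_image_inj[OF assms(1,2)] assms(3) by (auto simp: bij_betw_def)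

lemma eq_of_dim_eq:
  assumes "subspace V" "subspace W" "V \<subseteq> W" "dim V = dim W"
  shows "V = W"
  using subspace_dim_equal assms by simp

lemma dim_zero_iff: "subspace V \<Longrightarrow> dim V = 0 \<longleftrightarrow> V = {0}"
  using subspace_0 by auto

lemma surj_of_inj_endo:
  assumes "lin T" "subspace V" "\<And>x. x \<in> V \<Longrightarrow> T x = 0 \<Longrightarrow> x = 0" "T ` V \<subseteq> V"
  shows "T ` V = V"
proof -
  have "inj_on T V" using inj_onI_lin[OF assms(1,2)] assms(3) by blast
  hence "dim (T ` V) = dim V" by (rule dim_image_inj[OF assms(1,2)])
  thus ?thesis using eq_of_dim_eq[OF subspace_image_lin[OF assms(1,2)] assms(2,4)] by simp
qed

end

lemma (in assoc_algebra) fd_algebra_if_finite_dim: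
  assumes "finite_dim UNIV"
  obtains Basis where "fd_algebra scale Basis"
proof -
  obtain B where B: "finite B" "span B = UNIV" using assms by (auto simp: finite_dim_def)
  obtain B' where B': "B' \<subseteq> B" "independent B'" "B \<subseteq> span B'"
    using maximal_independent_subset[of B] by blast
  have "span B' = UNIV" using B(2) B'(3) by (metis span_mono span_span top.extremum_uniqueI)
  moreover have "finite B'" using B' B finite_subset by blast
  ultimately have "fd_algebra scale B'"
    using B'(2) by unfold_locales (auto)
  thus ?thesis using that by blast
qed

section \<open>Corners, ideals and centres\<close>

context fd_algebra
begin

text \<open>
  The Peirce component \<open>eSf\<close>. With the unity \<open>u\<close> of \<open>S\<close>, the right ideal \<open>eS\<close> is \<open>peirce S e u\<close> and
  the left ideal \<open>Se\<close> is \<open>peirce S u e\<close>.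
\<close>

definition peirce :: "'a set \<Rightarrow> 'a \<Rightarrow> 'a \<Rightarrow> 'a set" where
  "peirce S e f = {x \<in> S. e * x = x \<and> x * f = x}"

lemma algebra_onD:
  assumes "algebra_on S u"
  shows "subspace S" "\<And>x y. x \<in> S \<Longrightarrow> y \<in> S \<Longrightarrow> x * y \<in> S" "u \<in> S"
    "\<And>x. x \<in> S \<Longrightarrow> u * x = x" "\<And>x. x \<in> S \<Longrightarrow> x * u = x"
    "0 \<in> S" "\<And>x y. x \<in> S \<Longrightarrow> y \<in> S \<Longrightarrow> x + y \<in> S" "\<And>x y. x \<in> S \<Longrightarrow> y \<in> S \<Longrightarrow> x - y \<in> S"
    "\<And>x. x \<in> S \<Longrightarrow> - x \<in> S" "\<And>c x. x \<in> S \<Longrightarrow> c *s x \<in> S"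
proof -
  have sub: "subspace S" using assms by (simp add: algebra_on_def)
  show "subspace S" "\<And>x y. x \<in> S \<Longrightarrow> y \<in> S \<Longrightarrow> x * y \<in> S" "u \<in> S"
    "\<And>x. x \<in> S \<Longrightarrow> u * x = x" "\<And>x. x \<in> S \<Longrightarrow> x * u = x"
    using assms unfolding algebra_on_def by simp_all
  show "0 \<in> S" "\<And>x y. x \<in> S \<Longrightarrow> y \<in> S \<Longrightarrow> x + y \<in> S" "\<And>x y. x \<in> S \<Longrightarrow> y \<in> S \<Longrightarrow> x - y \<in> S"
    "\<And>x. x \<in> S \<Longrightarrow> - x \<in> S" "\<And>c x. x \<in> S \<Longrightarrow> c *s x \<in> S"
    by (rule subspace_0[OF sub] subspace_add[OF sub] subspace_diff[OF sub] subspace_neg[OF sub]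
        subspace_scale[OF sub]; assumption)+
qed

lemma algebra_onI:
  assumes "subspace S" "\<And>x y. x \<in> S \<Longrightarrow> y \<in> S \<Longrightarrow> x * y \<in> S" "u \<in> S"
    "\<And>x. x \<in> S \<Longrightarrow> u * x = x" "\<And>x. x \<in> S \<Longrightarrow> x * u = x"
  shows "algebra_on S u"
  using assms unfolding algebra_on_def by blast

lemma subspace_peirce: "subspace S \<Longrightarrow> subspace (peirce S e f)"
  unfolding subspace_def peirce_def
  by (simp add: distrib_left distrib_right scale_mult_left[symmetric] scale_mult_right[symmetric])

lemma peirceI:
  assumes "algebra_on S u" "e \<in> S" "f \<in> S" "e * e = e" "f * f = f" "x \<in> S"
  shows "e * x * f \<in> peirce S e f"
proof -
  have "e * (e * x * f) = e * x * f" by (simp add: mult.assoc[symmetric] assms)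
  moreover have "e * x * f * f = e * x * f" by (simp add: mult.assoc assms)
  moreover have "e * x * f \<in> S" using assms algebra_onD(2) by blast
  ultimately show ?thesis by (simp add: peirce_def)
qed

lemma peirce_mult:
  assumes "algebra_on S u" "x \<in> peirce S e f" "y \<in> peirce S g h"
  shows "x * y \<in> peirce S e h"
proof -
  have "e * (x * y) = x * y" using assms(2) by (simp add: mult.assoc[symmetric] peirce_def)
  moreover have "x * y * h = x * y" using assms(3) by (simp add: mult.assoc peirce_def)
  moreover have "x * y \<in> S" using assms algebra_onD(2) by (auto simp: peirce_def)
  ultimately show ?thesis by (simp add: peirce_def)
qed

lemma peirceE:
  assumes "x \<in> peirce S e f"
  shows "x \<in> S" "e * x = x" "x * f = x" "e * x * f = x"
  using assms by (auto simp: peirce_def)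

lemma corner_eq_peirce:
  assumes "algebra_on S u" "e \<in> S" "e * e = e"
  shows "corner S e = peirce S e e"
proof
  show "corner S e \<subseteq> peirce S e e"
    using peirceI[OF assms(1,2,2,3,3)] unfolding corner_def by blast
  show "peirce S e e \<subseteq> corner S e"
  proof
    fix x assume x: "x \<in> peirce S e e"
    show "x \<in> corner S e" unfolding corner_def
      using peirceE(1)[OF x] peirceE(4)[OF x, symmetric] by blast
  qed
qed

lemma algebra_on_corner:
  assumes "algebra_on S u" "e \<in> S" "e * e = e"
  shows "algebra_on (corner S e) e"
  unfolding corner_eq_peirce[OF assms]
proof (rule algebra_onI)
  show "subspace (peirce S e e)" by (rule subspace_peirce[OF algebra_onD(1)[OF assms(1)]])
  show "x * y \<in> peirce S e e" if "x \<in> peirce S e e" "y \<in> peirce S e e" for x y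
    using peirce_mult[OF assms(1) that] .
qed (use assms in \<open>simp_all add: peirce_def\<close>)

lemma subspace_centre: "subspace S \<Longrightarrow> subspace (centre S)"
  unfolding subspace_def centre_def
  by (simp add: distrib_left distrib_right scale_mult_left[symmetric] scale_mult_right[symmetric])

lemma centreD:
  assumes "z \<in> centre S"
  shows "z \<in> S" "\<And>x. x \<in> S \<Longrightarrow> z * x = x * z"
  using assms unfolding centre_def by blast+

lemma centreI: "z \<in> S \<Longrightarrow> (\<And>x. x \<in> S \<Longrightarrow> z * x = x * z) \<Longrightarrow> z \<in> centre S"
  unfolding centre_def by blast

lemma algebra_on_centre:
  assumes "algebra_on S u"
  shows "algebra_on (centre S) u"
proof (rule algebra_onI)
  note A = algebra_onD[OF assms]
  show "subspace (centre S)" by (rule subspace_centre[OF A(1)])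
  show "x * y \<in> centre S" if xy: "x \<in> centre S" "y \<in> centre S" for x y
  proof (rule centreI)
    show "x * y \<in> S" using A(2) centreD(1) xy by blast
    fix w assume w: "w \<in> S"
    have "x * y * w = x * (w * y)" using centreD(2)[OF xy(2) w] by (simp only: mult.assoc)
    also have "\<dots> = x * w * y" by (simp only: mult.assoc)
    also have "\<dots> = w * x * y" using centreD(2)[OF xy(1) w] by simp
    finally show "x * y * w = w * (x * y)" by (simp only: mult.assoc)
  qed
  show "u \<in> centre S" using A by (intro centreI) simp_all
  show "u * x = x" "x * u = x" if "x \<in> centre S" for x
    using A(4,5) centreD(1)[OF that] by blast+
qed

lemma finite_dim_subspace: "subspace V \<Longrightarrow> finite_dim V"
  unfolding finite_dim_def by (metis basis_subspace_exists)

lemma subspace_scalars: "subspace (scalars u)"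
proof -
  have "scalars u = span {u}" by (auto simp: scalars_def span_singleton)
  thus ?thesis by simp
qed

lemma dim_scalars: "u \<noteq> 0 \<Longrightarrow> dim (scalars u) = 1"
proof -
  assume "u \<noteq> 0"
  have "scalars u = span {u}" by (auto simp: scalars_def span_singleton)
  thus ?thesis using \<open>u \<noteq> 0\<close> by simp
qed

lemma ideal_onI:
  assumes "I \<subseteq> S" "0 \<in> I" "\<And>x y. x \<in> I \<Longrightarrow> y \<in> I \<Longrightarrow> x - y \<in> I"
    "\<And>a x. a \<in> S \<Longrightarrow> x \<in> I \<Longrightarrow> a * x \<in> I" "\<And>a x. a \<in> S \<Longrightarrow> x \<in> I \<Longrightarrow> x * a \<in> I"
  shows "ideal_on S I"
  using assms unfolding ideal_on_def by blast

lemma ideal_onD: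
  assumes "ideal_on S I"
  shows "I \<subseteq> S" "0 \<in> I" "\<And>x y. x \<in> I \<Longrightarrow> y \<in> I \<Longrightarrow> x - y \<in> I"
    "\<And>a x. a \<in> S \<Longrightarrow> x \<in> I \<Longrightarrow> a * x \<in> I" "\<And>a x. a \<in> S \<Longrightarrow> x \<in> I \<Longrightarrow> x * a \<in> I"
    "\<And>x. x \<in> I \<Longrightarrow> - x \<in> I" "\<And>x y. x \<in> I \<Longrightarrow> y \<in> I \<Longrightarrow> x + y \<in> I"
proof -
  show *: "I \<subseteq> S" "0 \<in> I" "\<And>x y. x \<in> I \<Longrightarrow> y \<in> I \<Longrightarrow> x - y \<in> I"
    "\<And>a x. a \<in> S \<Longrightarrow> x \<in> I \<Longrightarrow> a * x \<in> I" "\<And>a x. a \<in> S \<Longrightarrow> x \<in> I \<Longrightarrow> x * a \<in> I"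
    using assms unfolding ideal_on_def by blast+
  show m: "\<And>x. x \<in> I \<Longrightarrow> - x \<in> I" using *(2,3) by (metis diff_0)
  show "\<And>x y. x \<in> I \<Longrightarrow> y \<in> I \<Longrightarrow> x + y \<in> I" using *(3) m by (metis diff_minus_eq_add)
qed

lemma ideal_eq_carrier_if_unit:
  assumes "algebra_on S u" "ideal_on S I" "u \<in> I"
  shows "I = S"
proof
  show "S \<subseteq> I"
  proof
    fix x assume "x \<in> S"
    thus "x \<in> I" using ideal_onD(4)[OF assms(2), of x u] assms by (simp add: algebra_onD(5))
  qed
qed (use assms ideal_onD(1) in blast)

text \<open>The two-sided ideal generated by \<open>e\<close> is all of \<open>S\<close>.\<close>

definition full :: "'a set \<Rightarrow> 'a \<Rightarrow> bool" where
  "full S e \<longleftrightarrow> (\<forall>I. ideal_on S I \<and> e \<in> I \<longrightarrow> I = S)"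

text \<open>
  If \<open>1\<close> were written as \<open>\<Sum> x\<^sub>i e y\<^sub>i\<close>, the central element of \<open>S\<close> over \<open>c\<close> would be
  \<open>\<Sum> x\<^sub>i c y\<^sub>i\<close>. The ideal \<open>I\<close> below consists of the \<open>s\<close> for which multiplication by this
  element, times \<open>s\<close>, is realised by some \<open>t\<close>; fullness of \<open>e\<close> brings the unity into \<open>I\<close>.
\<close>

lemma centre_corner_lift:
  assumes S: "algebra_on S u" and e: "e \<in> S" "e * e = e" and full: "full S e"
    and c: "c \<in> centre (corner S e)"
  shows "\<exists>z\<in>centre S. c = e * z"
proof -
  note A = algebra_onD[OF S]
  define I where "I = {s\<in>S. \<exists>t\<in>S. \<forall>a\<in>S. \<forall>w\<in>S. t * (a * e * w) = s * (a * c * w) \<and> (a * e * w) * t = a * c * w * s}"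
  have cS: "c \<in> S" "e * c = c" "c * e = c"
    using c unfolding centre_def corner_eq_peirce[OF S e] by (auto simp: peirce_def)
  have cc': "c * x * e = e * x * c" if "x \<in> S" for x
  proof -
    have "e * x * e \<in> corner S e" using that unfolding corner_def by blast
    hence "c * (e * x * e) = e * x * e * c" using centreD(2)[OF c] by blast
    moreover have "c * (e * x * e) = c * e * x * e" "e * x * e * c = e * x * (e * c)"
      by (simp_all only: mult.assoc)
    ultimately show ?thesis using cS by simp
  qed
  have "ideal_on S I"
  proof (rule ideal_onI)
    show "I \<subseteq> S" by (auto simp: I_def)
    show "0 \<in> I" using A(6) by (auto simp: I_def intro!: bexI[of _ 0])
    fix x y assume "x \<in> I" "y \<in> I"
    then obtain t t' where t: "x \<in> S" "y \<in> S" "t \<in> S" "t' \<in> S"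
      "\<forall>a\<in>S. \<forall>w\<in>S. t * (a * e * w) = x * (a * c * w) \<and> (a * e * w) * t = a * c * w * x"
      "\<forall>a\<in>S. \<forall>w\<in>S. t' * (a * e * w) = y * (a * c * w) \<and> (a * e * w) * t' = a * c * w * y"
      by (auto simp: I_def)
    thus "x - y \<in> I" unfolding I_def using A(8)
      by (auto intro!: bexI[of _ "t - t'"] simp: left_diff_distrib right_diff_distrib)
  next
    fix b x assume b: "b \<in> S" and "x \<in> I"
    then obtain t where t: "x \<in> S" "t \<in> S"
      "\<And>a w. a\<in>S \<Longrightarrow> w\<in>S \<Longrightarrow> t * (a * e * w) = x * (a * c * w)"
      "\<And>a w. a\<in>S \<Longrightarrow> w\<in>S \<Longrightarrow> (a * e * w) * t = a * c * w * x"
      by (auto simp: I_def)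
    have "b * t * (a * e * w) = b * x * (a * c * w) \<and> (a * e * w) * (b * t) = a * c * w * (b * x)"
      if "a \<in> S" "w \<in> S" for a w
    proof
      have "b * t * (a * e * w) = b * (t * (a * e * w))" by (simp only: mult.assoc)
      also have "\<dots> = b * (x * (a * c * w))" using t(3)[OF that] by simp
      finally show "b * t * (a * e * w) = b * x * (a * c * w)" by (simp only: mult.assoc)
      have "a * e * w * (b * t) = a * e * (w * b) * t" by (simp only: mult.assoc)
      also have "\<dots> = a * c * (w * b) * x" using t(4)[OF that(1) A(2)[OF that(2) b]] .
      finally show "a * e * w * (b * t) = a * c * w * (b * x)" by (simp only: mult.assoc)
    qed
    thus "b * x \<in> I" unfolding I_def using A(2) t b by blast
    have "t * b * (a * e * w) = x * b * (a * c * w) \<and> (a * e * w) * (t * b) = a * c * w * (x * b)"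
      if "a \<in> S" "w \<in> S" for a w
    proof
      have "t * b * (a * e * w) = t * (b * a * e * w)" by (simp only: mult.assoc)
      also have "\<dots> = x * (b * a * c * w)" using t(3)[OF A(2)[OF b that(1)] that(2)] .
      finally show "t * b * (a * e * w) = x * b * (a * c * w)" by (simp only: mult.assoc)
      have "a * e * w * (t * b) = a * e * w * t * b" by (simp only: mult.assoc)
      also have "\<dots> = a * c * w * x * b" using t(4)[OF that] by simp
      finally show "a * e * w * (t * b) = a * c * w * (x * b)" by (simp only: mult.assoc)
    qed
    thus "x * b \<in> I" unfolding I_def using A(2) t b by blast
  qed
  moreover have "e \<in> I"
  proof -
    have "c * (a * e * w) = e * (a * c * w) \<and> (a * e * w) * c = a * c * w * e" if "a \<in> S" "w \<in> S" for a w
    proof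
      have "c * (a * e * w) = c * a * e * w" by (simp only: mult.assoc)
      also have "\<dots> = e * (a * c * w)" using cc'[OF that(1)] by (simp only: mult.assoc)
      finally show "c * (a * e * w) = e * (a * c * w)" .
      have "a * e * w * c = a * (e * w * c)" by (simp only: mult.assoc)
      also have "\<dots> = a * (c * w * e)" using cc'[OF that(2)] by simp
      finally show "a * e * w * c = a * c * w * e" by (simp only: mult.assoc)
    qed
    thus ?thesis unfolding I_def using cS e by blast
  qed
  ultimately have "u \<in> I" using full A(3) unfolding full_def by blast
  then obtain t where t: "t \<in> S"
    "\<And>a w. a\<in>S \<Longrightarrow> w\<in>S \<Longrightarrow> t * (a * e * w) = u * (a * c * w)"
    "\<And>a w. a\<in>S \<Longrightarrow> w\<in>S \<Longrightarrow> (a * e * w) * t = a * c * w * u"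
    by (auto simp: I_def)
  define J where "J = {s \<in> S. \<forall>b\<in>S. \<forall>d\<in>S. t * (b * s * d) = b * s * d * t}"
  have "ideal_on S J"
  proof (rule ideal_onI)
    fix a x assume a: "a \<in> S" and x: "x \<in> J"
    have "t * (b * (a * x) * d) = b * (a * x) * d * t" if "b \<in> S" "d \<in> S" for b d
    proof -
      have "t * ((b * a) * x * d) = (b * a) * x * d * t"
        using x that(2) A(2)[OF that(1) a] unfolding J_def by blast
      thus ?thesis by (simp only: mult.assoc)
    qed
    thus "a * x \<in> J" using A(2)[OF a] x unfolding J_def by blast
    have "t * (b * (x * a) * d) = b * (x * a) * d * t" if "b \<in> S" "d \<in> S" for b d
    proof -
      have "t * (b * x * (a * d)) = b * x * (a * d) * t"
        using x that(1) A(2)[OF a that(2)] unfolding J_def by blast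
      thus ?thesis by (simp only: mult.assoc)
    qed
    thus "x * a \<in> J" using A(2)[OF _ a] x unfolding J_def by blast
  qed (use A(6,8) in \<open>auto simp: J_def left_diff_distrib right_diff_distrib\<close>)
  moreover have "e \<in> J"
  proof -
    have "t * (b * e * d) = b * e * d * t" if "b \<in> S" "d \<in> S" for b d
    proof -
      have "b * c * d \<in> S" using A(2) cS that by blast
      thus ?thesis using t(2,3)[OF that] A(4,5) by simp
    qed
    thus ?thesis unfolding J_def using e by blast
  qed
  ultimately have "u \<in> J" using full A(3) unfolding full_def by blast
  hence "t * x = x * t" if "x \<in> S" for x
  proof -
    have "t * (u * u * x) = u * u * x * t"
      using \<open>u \<in> J\<close> that A(3) unfolding J_def by blast
    thus ?thesis using A(4)[OF A(3)] A(4)[OF that] by simp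
  qed
  hence "t \<in> centre S" using t(1) by (intro centreI)
  moreover have "e * t = c"
    using t(3)[OF A(3) A(3)] cS e A(4,5) by simp
  ultimately show ?thesis by (intro bexI[of _ t]) simp_all
qed

lemma centre_corner:
  assumes S: "algebra_on S u" and e: "e \<in> S" "e * e = e" and full: "full S e"
  shows "centre (corner S e) = (\<lambda>z. e * z) ` centre S"
proof
  show "centre (corner S e) \<subseteq> (\<lambda>z. e * z) ` centre S"
    using centre_corner_lift[OF assms] by blast
  show "(\<lambda>z. e * z) ` centre S \<subseteq> centre (corner S e)"
  proof
    fix c assume "c \<in> (\<lambda>z. e * z) ` centre S"
    then obtain z where z: "z \<in> centre S" "c = e * z" by blast
    note zc = centreD[OF z(1)]
    have ez: "e * z = e * z * e"
    proof -
      have "e * z * e = e * (e * z)" using zc(2)[OF e(1)] by (simp only: mult.assoc)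
      thus ?thesis using e(2) by (simp add: mult.assoc[symmetric])
    qed
    have "c \<in> corner S e"
      unfolding corner_def z(2) using ez zc(1) by blast
    moreover have "c * x = x * c" if x: "x \<in> corner S e" for x
    proof -
      have x': "x \<in> S" "e * x = x" "x * e = x"
        using x unfolding corner_eq_peirce[OF S e] by (auto simp: peirce_def)
      have "c * x = e * (x * z)" using zc(2)[OF x'(1)] z(2) by (simp only: mult.assoc)
      also have "\<dots> = e * x * z" by (simp only: mult.assoc)
      also have "\<dots> = x * e * z" using x' by simp
      finally show ?thesis using z(2) by (simp only: mult.assoc)
    qed
    ultimately show "c \<in> centre (corner S e)" by (intro centreI)
  qed
qed

text \<open>Fullness of \<open>e\<close> also makes multiplication by \<open>e\<close> faithful on the centre.\<close>

lemma full_mult_eq_0: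
  assumes S: "algebra_on S u" and e: "e \<in> S" and full: "full S e"
    and z: "z \<in> centre S" and "e * z = 0"
  shows "z = 0"
proof -
  note A = algebra_onD[OF S]
  note zc = centreD[OF z]
  have "ideal_on S {x \<in> S. x * z = 0}"
  proof (rule ideal_onI)
    fix a x assume a: "a \<in> S" and x: "x \<in> {x \<in> S. x * z = 0}"
    show "a * x \<in> {x \<in> S. x * z = 0}"
      using A(2)[OF a] x by (simp add: mult.assoc)
    have "x * a * z = x * (z * a)" using zc(2)[OF a] by (simp only: mult.assoc)
    also have "\<dots> = x * z * a" by (simp only: mult.assoc)
    finally show "x * a \<in> {x \<in> S. x * z = 0}"
      using A(2)[OF _ a] x by simp
  qed (use A(6,8) in \<open>auto simp: left_diff_distrib\<close>)
  hence "{x \<in> S. x * z = 0} = S" using full e \<open>e * z = 0\<close> unfolding full_def by blast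
  hence "u * z = 0" using A(3) by blast
  thus ?thesis using A(4) zc by simp
qed

end

section \<open>Simple algebras and ranks of idempotents\<close>

context fd_algebra
begin

definition simple_alg :: "'a set \<Rightarrow> 'a \<Rightarrow> bool" where
  "simple_alg S u \<longleftrightarrow> algebra_on S u \<and> u \<noteq> 0 \<and> (\<forall>I. ideal_on S I \<longrightarrow> I = {0} \<or> I = S)"

lemma simple_algD:
  assumes "simple_alg S u"
  shows "algebra_on S u" "u \<noteq> 0" "\<And>I. ideal_on S I \<Longrightarrow> I = {0} \<or> I = S"
  using assms unfolding simple_alg_def by blast+

lemma simple_full:
  assumes "simple_alg S u" "e \<noteq> 0"
  shows "full S e"
  using simple_algD(3)[OF assms(1)] assms(2) unfolding full_def by blast

text \<open>The elements \<open>y\<close> with \<open>xSy = 0\<close> form an ideal, which is proper as \<open>x \<noteq> 0\<close>.\<close>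

lemma simple_prime:
  assumes S: "simple_alg S u" and x: "x \<in> S" "x \<noteq> 0" and y: "y \<in> S" "y \<noteq> 0"
  shows "\<exists>a\<in>S. x * a * y \<noteq> 0"
proof (rule ccontr)
  assume "\<not> ?thesis"
  hence 0: "\<And>a. a \<in> S \<Longrightarrow> x * a * y = 0" by blast
  note A = algebra_onD[OF simple_algD(1)[OF S]]
  let ?I = "{y \<in> S. \<forall>a\<in>S. x * a * y = 0}"
  have "ideal_on S ?I"
  proof (rule ideal_onI)
    fix a y assume a: "a \<in> S" and y: "y \<in> ?I"
    have "x * b * (a * y) = 0" if "b \<in> S" for b
    proof -
      have "x * (b * a) * y = 0" using y A(2)[OF that a] by blast
      thus ?thesis by (simp only: mult.assoc)
    qed
    thus "a * y \<in> ?I" using A(2)[OF a] y by blast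
    have "x * b * (y * a) = 0" if "b \<in> S" for b
    proof -
      have "x * b * y = 0" using y that by blast
      thus ?thesis by (simp add: mult.assoc[symmetric])
    qed
    thus "y * a \<in> ?I" using A(2)[OF _ a] y by blast
  qed (use A(6,8) in \<open>auto simp: right_diff_distrib\<close>)
  moreover have "y \<in> ?I" using y 0 by blast
  ultimately have "?I = S" using simple_algD(3)[OF S] y by blast
  hence "u \<in> ?I" using A(3) by simp
  hence "x * u * u = 0" using A(3) by blast
  thus False using x A(5) by simp
qed

lemma centre_inverse:
  assumes S: "algebra_on S u" and z: "z \<in> centre S" and y: "y \<in> S" "z * y = u"
  shows "y \<in> centre S"
proof (rule centreI)
  note A = algebra_onD[OF S]
  note zc = centreD[OF z]
  fix x assume x: "x \<in> S"
  have "y * x = y * (x * (z * y))" using y A(5)[OF x] by simp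
  also have "\<dots> = y * (z * x * y)" using zc(2)[OF x] by (simp only: mult.assoc)
  also have "\<dots> = z * y * x * y" using zc(2)[OF y(1)] by (simp only: mult.assoc[symmetric])
  also have "\<dots> = x * y" using y A(4)[OF x] by simp
  finally show "y * x = x * y" .
qed (rule y(1))

lemma ideal_central_multiples:
  assumes S: "algebra_on S u" and z: "z \<in> centre S"
  shows "ideal_on S ((\<lambda>x. z * x) ` S)"
proof (rule ideal_onI)
  note A = algebra_onD[OF S]
  note zc = centreD[OF z]
  show "0 \<in> (\<lambda>x. z * x) ` S" using A(6) by (intro image_eqI[of _ _ 0]) simp_all
  fix a x assume a: "a \<in> S" and "x \<in> (\<lambda>x. z * x) ` S"
  then obtain s where s: "s \<in> S" "x = z * s" by blast
  have "a * x = z * (a * s)" using zc(2)[OF a] s(2) by (simp only: mult.assoc[symmetric])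
  thus "a * x \<in> (\<lambda>x. z * x) ` S" using A(2)[OF a s(1)] by blast
  have "x * a = z * (s * a)" using s(2) by (simp only: mult.assoc)
  thus "x * a \<in> (\<lambda>x. z * x) ` S" using A(2)[OF s(1) a] by blast
next
  note A = algebra_onD[OF S]
  fix x y assume "x \<in> (\<lambda>x. z * x) ` S" "y \<in> (\<lambda>x. z * x) ` S"
  then obtain s t where "s \<in> S" "t \<in> S" "x = z * s" "y = z * t" by blast
  thus "x - y \<in> (\<lambda>x. z * x) ` S" using A(8)[of s t]
    by (intro image_eqI[of _ _ "s - t"]) (simp_all add: right_diff_distrib)
next
  show "(\<lambda>x. z * x) ` S \<subseteq> S" using algebra_onD(2)[OF S] centreD(1)[OF z] by blast
qed

text \<open>Ideals of a corner are traces of ideals of the whole algebra.\<close>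

lemma corner_ideal_pullback:
  fixes e :: 'a and I :: "'a set"
  assumes alg: "algebra_on S u" and e: "e \<in> S" "e * e = e" and I: "ideal_on (corner S e) I"
  defines "J \<equiv> {s \<in> S. \<forall>a\<in>S. \<forall>b\<in>S. e * a * s * b * e \<in> I}"
  shows "ideal_on S J" "I \<subseteq> J" "J = S \<Longrightarrow> I = corner S e"
proof -
  note A = algebra_onD[OF alg]
  note ce = corner_eq_peirce[OF alg e(1,2)]
  note ID = ideal_onD[OF I]
  show "ideal_on S J"
  proof (rule ideal_onI)
    fix c s assume c: "c \<in> S" and s: "s \<in> J"
    have "e * a * (c * s) * b * e \<in> I" if "a \<in> S" "b \<in> S" for a b
    proof -
      have "e * (a * c) * s * b * e \<in> I" using s A(2)[OF that(1) c] that(2) unfolding J_def by blast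
      thus ?thesis by (simp only: mult.assoc)
    qed
    thus "c * s \<in> J" using A(2)[OF c] s unfolding J_def by blast
    have "e * a * (s * c) * b * e \<in> I" if "a \<in> S" "b \<in> S" for a b
    proof -
      have "e * a * s * (c * b) * e \<in> I" using s A(2)[OF c that(2)] that(1) unfolding J_def by blast
      thus ?thesis by (simp only: mult.assoc)
    qed
    thus "s * c \<in> J" using A(2)[OF _ c] s unfolding J_def by blast
  next
    fix x y assume "x \<in> J" "y \<in> J"
    thus "x - y \<in> J" unfolding J_def using A(8) ID(3)
      by (simp add: right_diff_distrib left_diff_distrib)
  qed (use A(6) ID(2) in \<open>auto simp: J_def\<close>)
  show "I \<subseteq> J"
  proof
    fix x assume x: "x \<in> I"
    show "x \<in> J"
    proof -
      have xc: "x \<in> S" "e * x = x" "x * e = x" using ID(1) x ce by (auto simp: peirce_def)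
      have "e * a * x * b * e \<in> I" if "a \<in> S" "b \<in> S" for a b
      proof -
        have "e * a * e \<in> corner S e" "e * b * e \<in> corner S e" using that unfolding corner_def by blast+
        hence "(e * a * e) * x * (e * b * e) \<in> I" using ID(4,5) x by blast
        moreover have "(e * a * e) * x * (e * b * e) = e * a * (e * x * e) * b * e"
          by (simp only: mult.assoc)
        ultimately show ?thesis using xc by simp
      qed
      thus ?thesis using xc unfolding J_def by blast
    qed
  qed
  assume "J = S"
  hence "e * e * e * e * e \<in> I" using e(1) unfolding J_def by blast
  hence "e \<in> I" using e(2) by simp
  thus "I = corner S e" using ideal_eq_carrier_if_unit[OF algebra_on_corner[OF alg e(1,2)] I] by blast
qed

lemma simple_corner:
  assumes S: "simple_alg S u" and e: "e \<in> S" "e * e = e" "e \<noteq> 0"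
  shows "simple_alg (corner S e) e"
  unfolding simple_alg_def
proof (intro conjI allI impI)
  note alg = simple_algD(1)[OF S]
  note A = algebra_onD[OF alg]
  note ce = corner_eq_peirce[OF alg e(1,2)]
  show "algebra_on (corner S e) e" using algebra_on_corner[OF alg e(1,2)] .
  show "e \<noteq> 0" by fact
  fix I assume I: "ideal_on (corner S e) I"
  note ID = ideal_onD[OF I]
  show "I = {0} \<or> I = corner S e"
  proof (cases "I = {0}")
    case False
    then obtain x where x: "x \<in> I" "x \<noteq> 0" using ID(2) by blast
    note J = corner_ideal_pullback[OF alg e(1,2) I]
    have "{s \<in> S. \<forall>a\<in>S. \<forall>b\<in>S. e * a * s * b * e \<in> I} = S"
      using simple_algD(3)[OF S J(1)] J(2) x by blast
    thus ?thesis using J(3) by blast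
  qed blast
qed

lemma simple_centre_field:
  assumes S: "simple_alg S u"
  shows "field_on (centre S) u"
proof -
  note alg = simple_algD(1)[OF S]
  note A = algebra_onD[OF alg]
  have inv: "\<exists>y\<in>centre S. z * y = u" if z: "z \<in> centre S" and z0: "z \<noteq> 0" for z
  proof -
    note zc = centreD[OF z]
    have "z \<in> (\<lambda>x. z * x) ` S" using A(3) A(5)[OF zc(1)] by (intro image_eqI[of _ _ u]) simp_all
    hence "(\<lambda>x. z * x) ` S = S"
      using simple_algD(3)[OF S ideal_central_multiples[OF alg z]] z0 by blast
    then obtain y where y: "y \<in> S" "z * y = u" using A(3) by (metis imageE)
    thus ?thesis using centre_inverse[OF alg z y] by blast
  qed
  have "\<forall>x\<in>centre S. \<forall>y\<in>centre S. x * y = y * x" using centreD by blast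
  thus ?thesis unfolding field_on_def using inv algebra_on_centre[OF alg] simple_algD(2)[OF S] by blast
qed

text \<open>
  An element \<open>x\<close> generating a right ideal of least dimension generates a minimal one; as \<open>xS\<close> is
  not nilpotent, it contains an idempotent \<open>E\<close>, and by minimality \<open>ESE\<close> is a division algebra.
\<close>

lemma exists_division_idempotent:
  assumes S: "simple_alg S u"
  shows "\<exists>E\<in>S. E \<noteq> 0 \<and> E * E = E \<and>
    (\<forall>t\<in>corner S E. t \<noteq> 0 \<longrightarrow> (\<exists>w\<in>corner S E. w * t = E \<and> t * w = E))"
proof -
  note alg = simple_algD(1)[OF S]
  note A = algebra_onD[OF alg]
  define R where "R = (\<lambda>x. (\<lambda>y. x * y) ` S)"
  have subR: "subspace (R x)" for x
    unfolding R_def by (rule subspace_image_lin[OF lin_mult_left A(1)])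
  have selfR: "x \<in> R x" if "x \<in> S" for x
    unfolding R_def using A(3) A(5)[OF that] by (intro image_eqI[of _ _ u]) simp_all
  have RS: "R x \<subseteq> S" if "x \<in> S" for x unfolding R_def using A(2) that by blast
  have Rmono: "R y \<subseteq> R x" if y: "y \<in> R x" for x y
  proof
    fix z assume "z \<in> R y"
    then obtain s t where s: "s \<in> S" "y = x * s" "t \<in> S" "z = y * t" using y unfolding R_def by blast
    hence "z = x * (s * t)" by (simp only: mult.assoc)
    thus "z \<in> R x" unfolding R_def using A(2) s by blast
  qed
  have "\<exists>x. x \<in> S \<and> x \<noteq> 0" using A(3) simple_algD(2)[OF S] by blast
  then obtain x where x: "x \<in> S" "x \<noteq> 0" and min: "\<And>y. y \<in> S \<Longrightarrow> y \<noteq> 0 \<Longrightarrow> dim (R x) \<le> dim (R y)"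
    using ex_has_least_nat[of "\<lambda>x. x \<in> S \<and> x \<noteq> 0" _ "\<lambda>x. dim (R x)"] by blast
  have minR: "R y = R x" if "y \<in> R x" "y \<noteq> 0" for y
  proof (rule eq_of_dim_eq[OF subR subR Rmono[OF that(1)]])
    have "y \<in> S" using that(1) RS x(1) by blast
    thus "dim (R y) = dim (R x)"
      using min[OF _ that(2)] dim_subset[OF Rmono[OF that(1)]] by (simp add: le_antisym)
  qed
  obtain y where y: "y \<in> S" "x * y * x \<noteq> 0" using simple_prime[OF S x x] by blast
  let ?T = "\<lambda>a. x * y * a"
  have inj: "a = 0" if a: "a \<in> R x" "x * y * a = 0" for a
  proof (rule ccontr)
    assume "a \<noteq> 0"
    hence "x \<in> R a" using minR[OF a(1)] selfR[OF x(1)] by simp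
    then obtain s where "x = a * s" unfolding R_def by blast
    hence "x * y * x = x * y * a * s" by (simp only: mult.assoc)
    thus False using a y by simp
  qed
  have "?T ` R x \<subseteq> R x"
  proof
    fix z assume "z \<in> ?T ` R x"
    then obtain a where a: "a \<in> R x" "z = x * y * a" by blast
    hence "z = x * (y * a)" by (simp only: mult.assoc)
    thus "z \<in> R x" unfolding R_def using A(2)[OF y(1)] a(1) RS[OF x(1)] by blast
  qed
  hence "?T ` R x = R x" using surj_of_inj_endo[OF lin_mult_left subR, of x "x * y"] inj by blast
  moreover have "x * y \<in> R x" unfolding R_def using y by blast
  ultimately obtain E where E: "E \<in> R x" "x * y * E = x * y" by (metis imageE)
  have ES: "E \<in> S" using E(1) RS[OF x(1)] by blast
  have "E * E \<in> R E" using ES unfolding R_def by blast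
  hence "E * E - E \<in> R x" using Rmono[OF E(1)] E(1) subspace_diff[OF subR] by blast
  moreover have "x * y * (E * E - E) = 0"
    using E(2) by (simp add: right_diff_distrib mult.assoc[symmetric])
  ultimately have EE: "E * E = E" using inj[of "E * E - E"] by simp
  have E0: "E \<noteq> 0" using E(2) y(2) by auto
  have rinv: "\<exists>w\<in>corner S E. t * w = E" if t: "t \<in> corner S E" "t \<noteq> 0" for t
  proof -
    have t': "t \<in> S" "E * t = t" "t * E = t"
      using t corner_eq_peirce[OF alg ES EE] by (auto simp: peirce_def)
    have "t \<in> R E" unfolding R_def using t'(1,2) by (intro image_eqI[of _ _ t]) simp_all
    hence "t \<in> R x" using Rmono[OF E(1)] by blast
    hence "E \<in> R t" using minR t(2) E(1) by blast
    then obtain w where w: "w \<in> S" "t * w = E" unfolding R_def by blast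
    have "t * (E * w * E) = t * E * w * E" by (simp only: mult.assoc)
    also have "\<dots> = E" using t'(3) w(2) EE by simp
    finally show ?thesis using w(1) unfolding corner_def by blast
  qed
  have "\<exists>w\<in>corner S E. w * t = E \<and> t * w = E" if t: "t \<in> corner S E" "t \<noteq> 0" for t
  proof -
    obtain w where w: "w \<in> corner S E" "t * w = E" using rinv[OF t] by blast
    have "w \<noteq> 0" using w(2) E0 by auto
    then obtain w' where w': "w' \<in> corner S E" "w * w' = E" using rinv[OF w(1)] by blast
    have "E * w' = w'" "t * E = t"
      using w'(1) t(1) corner_eq_peirce[OF alg ES EE] by (auto simp: peirce_def)
    hence "w' = t * w * w'" using w(2) by simp
    also have "\<dots> = t * E" using w'(2) by (simp only: mult.assoc)
    finally have "w' = t" using \<open>t * E = t\<close> by simp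
    thus ?thesis using w w' by blast
  qed
  thus ?thesis using ES E0 EE by blast
qed

text \<open>
  A nonzero idempotent \<open>e\<close> contains a copy of \<open>E\<close>: for \<open>a, b\<close> as below, \<open>ab\<close> is an idempotent of
  \<open>eSe\<close> equivalent to \<open>E\<close>.
\<close>

lemma division_idempotent_embeds:
  assumes S: "simple_alg S u"
    and E: "E \<in> S" "E \<noteq> 0" "E * E = E"
    and div: "\<And>t. t \<in> corner S E \<Longrightarrow> t \<noteq> 0 \<Longrightarrow> \<exists>w\<in>corner S E. w * t = E"
    and e: "e \<in> S" "e \<noteq> 0" "e * e = e"
  shows "\<exists>a\<in>peirce S e E. \<exists>b\<in>peirce S E e. b * a = E"
proof -
  note alg = simple_algD(1)[OF S]
  note A = algebra_onD[OF alg]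
  obtain x where x: "x \<in> S" "E * x * e \<noteq> 0" using simple_prime[OF S E(1,2) e(1,2)] by blast
  have "E * x * e \<in> S" using A(2) E x e by blast
  then obtain y where y: "y \<in> S" "E * x * e * y * E \<noteq> 0" using simple_prime[OF S _ x(2) E(1,2)] by blast
  define t where "t = E * x * e * y * E"
  have "t = E * (x * e * y) * E" unfolding t_def by (simp only: mult.assoc)
  hence "t \<in> corner S E" unfolding corner_def using A(2) x(1) y(1) e(1) by blast
  then obtain w where w: "w \<in> corner S E" "w * t = E" using div y(2) unfolding t_def by blast
  have w': "w \<in> S" "E * w = w" "w * E = w"
    using w(1) corner_eq_peirce[OF alg E(1,3)] by (auto simp: peirce_def)
  have a: "e * y * E \<in> peirce S e E" by (rule peirceI[OF alg e(1) E(1) e(3) E(3) y(1)])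
  have "E * x * e \<in> peirce S E e" by (rule peirceI[OF alg E(1) e(1) E(3) e(3) x(1)])
  moreover have "w \<in> peirce S E E" using w' by (simp add: peirce_def)
  ultimately have b: "w * (E * x * e) \<in> peirce S E e" using peirce_mult[OF alg] by blast
  have "w * (E * x * e) * (e * y * E) = w * (E * x * (e * e) * y * E)" by (simp only: mult.assoc)
  also have "\<dots> = E" using w(2) e(3) unfolding t_def by simp
  finally show ?thesis using a b by blast
qed

text \<open>
  A function of idempotents that is additive over orthogonal sums and invariant under
  equivalence of idempotents is determined by its value at \<open>E\<close>, as every idempotent is an
  orthogonal sum of copies of \<open>E\<close>. This will be applied to dimensions, and to a count of
  symmetric elements.
\<close>

definition trace_like :: "'a set \<Rightarrow> ('a \<Rightarrow> real) \<Rightarrow> bool" where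
  "trace_like S g \<longleftrightarrow>
     (\<forall>e\<in>S. \<forall>f\<in>S. e * e = e \<and> f * f = f \<and> e * f = 0 \<and> f * e = 0 \<longrightarrow> g (e + f) = g e + g f)
   \<and> (\<forall>e\<in>S. \<forall>f\<in>S. \<forall>a\<in>peirce S e f. \<forall>b\<in>peirce S f e.
        e * e = e \<and> f * f = f \<and> a * b = e \<and> b * a = f \<longrightarrow> g e = g f)"

lemma trace_likeD:
  assumes "trace_like S g"
  shows "\<And>e f. e \<in> S \<Longrightarrow> f \<in> S \<Longrightarrow> e * e = e \<Longrightarrow> f * f = f \<Longrightarrow> e * f = 0 \<Longrightarrow> f * e = 0
    \<Longrightarrow> g (e + f) = g e + g f"
    "\<And>e f a b. e \<in> S \<Longrightarrow> f \<in> S \<Longrightarrow> e * e = e \<Longrightarrow> f * f = f \<Longrightarrow> a \<in> peirce S e f \<Longrightarrow> b \<in> peirce S f e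
    \<Longrightarrow> a * b = e \<Longrightarrow> b * a = f \<Longrightarrow> g e = g f"
  using assms unfolding trace_like_def by blast+

lemma trace_like_0:
  assumes "trace_like S g" "0 \<in> S"
  shows "g 0 = 0"
  using trace_likeD(1)[OF assms(1) assms(2) assms(2)] by simp

lemma trace_like_multiple:
  assumes S: "simple_alg S u"
    and E: "E \<in> S" "E \<noteq> 0" "E * E = E"
    and div: "\<And>t. t \<in> corner S E \<Longrightarrow> t \<noteq> 0 \<Longrightarrow> \<exists>w\<in>corner S E. w * t = E"
  shows "e \<in> S \<Longrightarrow> e * e = e \<Longrightarrow> \<exists>m::nat. (m = 0 \<longleftrightarrow> e = 0) \<and> (\<forall>g. trace_like S g \<longrightarrow> g e = real m * g E)"
proof (induction "dim (peirce S e u)" arbitrary: e rule: less_induct)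
  case less
  note alg = simple_algD(1)[OF S]
  note A = algebra_onD[OF alg]
  show ?case
  proof (cases "e = 0")
    case True
    thus ?thesis using trace_like_0 A(6) by (intro exI[of _ 0]) auto
  next
    case False
    obtain a b where ab: "a \<in> peirce S e E" "b \<in> peirce S E e" "b * a = E"
      using division_idempotent_embeds[OF S E div less.prems(1) False less.prems(2)] by blast
    note a = peirceE[OF ab(1)]
    note b = peirceE[OF ab(2)]
    define f where "f = a * b"
    have fS: "f \<in> S" unfolding f_def using A(2) a b by blast
    have fa: "f * a = a" unfolding f_def using ab(3) a(3) by (simp add: mult.assoc)
    have bf: "b * f = b" unfolding f_def using ab(3) b(2) by (simp add: mult.assoc[symmetric])
    have ff: "f * f = f" using fa by (simp add: f_def mult.assoc[symmetric])
    have ef: "e * f = f" unfolding f_def using a(2) by (simp add: mult.assoc[symmetric])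
    have fe: "f * e = f" unfolding f_def using b(3) by (simp add: mult.assoc)
    let ?e = "e - f"
    have e1: "?e \<in> S" using A(8) less.prems(1) fS by blast
    have e2: "?e * ?e = ?e" by (simp add: left_diff_distrib right_diff_distrib less.prems(2) ef fe ff)
    have e3: "?e * f = 0" "f * ?e = 0" by (simp_all add: left_diff_distrib right_diff_distrib ef fe ff)
    have "peirce S ?e u \<subseteq> peirce S e u"
    proof
      fix x assume x: "x \<in> peirce S ?e u"
      have "e * (?e * x) = ?e * x" by (simp add: mult.assoc[symmetric] right_diff_distrib less.prems(2) ef)
      thus "x \<in> peirce S e u" using x by (simp add: peirce_def)
    qed
    moreover have "a \<in> peirce S e u" "a \<notin> peirce S ?e u"
      using a A(5) fa ab(3) E(2) by (auto simp: peirce_def left_diff_distrib)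
    ultimately have "dim (peirce S ?e u) < dim (peirce S e u)"
      using eq_of_dim_eq[OF subspace_peirce subspace_peirce, OF A(1) A(1)] dim_subset
      by (metis order_le_imp_less_or_eq)
    then obtain m where m: "\<And>g. trace_like S g \<Longrightarrow> g ?e = real m * g E"
      using less.hyps e1 e2 by blast
    have "g e = real (Suc m) * g E" if g: "trace_like S g" for g
    proof -
      have "g (?e + f) = g ?e + g f" using trace_likeD(1)[OF g e1 fS e2 ff e3] .
      moreover have "g f = g E"
      proof (rule trace_likeD(2)[OF g fS E(1) ff E(3) _ _ f_def[symmetric] ab(3)])
        show "a \<in> peirce S f E" "b \<in> peirce S E f" using a b fa bf by (simp_all add: peirce_def)
      qed
      ultimately show ?thesis using m[OF g] by (simp add: algebra_simps)
    qed
    thus ?thesis using False by (intro exI[of _ "Suc m"]) auto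
  qed
qed

lemma rank_function:
  assumes S: "simple_alg S u"
  shows "\<exists>E\<in>S. \<exists>rk::'a \<Rightarrow> nat. E * E = E \<and> E \<noteq> 0
    \<and> (\<forall>e\<in>S. e * e = e \<longrightarrow> (rk e = 0 \<longleftrightarrow> e = 0))
    \<and> (\<forall>e\<in>S. \<forall>g. e * e = e \<longrightarrow> trace_like S g \<longrightarrow> g e = real (rk e) * g E)"
proof -
  obtain E where E: "E \<in> S" "E \<noteq> 0" "E * E = E"
    and div: "\<forall>t\<in>corner S E. t \<noteq> 0 \<longrightarrow> (\<exists>w\<in>corner S E. w * t = E \<and> t * w = E)"
    using exists_division_idempotent[OF S] by (elim bexE conjE)
  have div': "\<exists>w\<in>corner S E. w * t = E" if "t \<in> corner S E" "t \<noteq> 0" for t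
    using div that by blast
  define P where "P e m \<longleftrightarrow> (m = (0::nat) \<longleftrightarrow> e = 0) \<and> (\<forall>g. trace_like S g \<longrightarrow> g e = real m * g E)" for e m
  define rk where "rk e = (SOME m. P e m)" for e
  have rk: "P e (rk e)" if "e \<in> S" "e * e = e" for e
    unfolding rk_def by (rule someI_ex)
      (use trace_like_multiple[OF S E div' that] in \<open>simp add: P_def\<close>)
  have "(rk e = 0 \<longleftrightarrow> e = 0) \<and> (\<forall>g. trace_like S g \<longrightarrow> g e = real (rk e) * g E)"
    if "e \<in> S" "e * e = e" for e
    using rk[OF that] unfolding P_def .
  thus ?thesis using E by (intro bexI[of _ E] exI[of _ rk]) simp_all
qed

lemma trace_like_dim_left:
  assumes alg: "algebra_on S u" and h: "h \<in> S"
  shows "trace_like S (\<lambda>e. real (dim (peirce S e h)))"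
  unfolding trace_like_def
proof (intro conjI ballI impI; elim conjE)
  note A = algebra_onD[OF alg]
  note sp = subspace_peirce[OF A(1)]
  fix e f assume ef: "e \<in> S" "f \<in> S" "e * e = e" "f * f = f" "e * f = 0" "f * e = 0"
  have "peirce S (e + f) h = {x + y | x y. x \<in> peirce S e h \<and> y \<in> peirce S f h}" (is "?L = ?R")
  proof
    show "?L \<subseteq> ?R"
    proof
      fix x assume x: "x \<in> ?L"
      note x' = peirceE[OF x]
      have "e * x \<in> peirce S e h" "f * x \<in> peirce S f h"
        using A(2) ef x' by (simp_all add: peirce_def mult.assoc) (simp_all add: mult.assoc[symmetric])
      moreover have "x = e * x + f * x" using x'(2) by (simp add: distrib_right)
      ultimately show "x \<in> ?R" by blast
    qed
    show "?R \<subseteq> ?L"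
    proof
      fix z assume "z \<in> ?R"
      then obtain x y where xy: "z = x + y" "x \<in> peirce S e h" "y \<in> peirce S f h" by blast
      note x = peirceE[OF xy(2)]
      note y = peirceE[OF xy(3)]
      have "e * y = 0" "f * x = 0"
        using x(2) y(2) ef(5,6) by (metis mult.assoc mult_zero_left)+
      thus "z \<in> ?L" using x y xy(1) A(7) by (simp add: peirce_def distrib_left distrib_right)
    qed
  qed
  moreover have "peirce S e h \<inter> peirce S f h = {0}"
  proof -
    have "x = 0" if "x \<in> peirce S e h" "x \<in> peirce S f h" for x
      using peirceE(2)[OF that(1)] peirceE(2)[OF that(2)] ef(5) by (metis mult.assoc mult_zero_left)
    thus ?thesis using subspace_0[OF sp] by blast
  qed
  ultimately show "real (dim (peirce S (e + f) h)) = real (dim (peirce S e h)) + real (dim (peirce S f h))"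
    using dim_direct_sum[OF sp sp] by simp
next
  note A = algebra_onD[OF alg]
  note sp = subspace_peirce[OF A(1)]
  fix e f a b
  assume "e \<in> S" "f \<in> S" and a: "a \<in> peirce S e f" and b: "b \<in> peirce S f e"
    and ab: "a * b = e" "b * a = f"
  have "bij_betw (\<lambda>x. b * x) (peirce S e h) (peirce S f h)"
  proof (rule bij_betwI[where g = "\<lambda>x. a * x"])
    show "(\<lambda>x. b * x) \<in> peirce S e h \<rightarrow> peirce S f h" "(\<lambda>x. a * x) \<in> peirce S f h \<rightarrow> peirce S e h"
      using peirce_mult[OF alg b] peirce_mult[OF alg a] by blast+
    show "a * (b * x) = x" if "x \<in> peirce S e h" for x
      using peirceE(2)[OF that] ab by (simp add: mult.assoc[symmetric])
    show "b * (a * x) = x" if "x \<in> peirce S f h" for x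
      using peirceE(2)[OF that] ab by (simp add: mult.assoc[symmetric])
  qed
  thus "real (dim (peirce S e h)) = real (dim (peirce S f h))"
    using dim_bij_eq[OF lin_mult_left sp] by simp
qed

lemma trace_like_dim_right:
  assumes alg: "algebra_on S u" and h: "h \<in> S"
  shows "trace_like S (\<lambda>e. real (dim (peirce S h e)))"
  unfolding trace_like_def
proof (intro conjI ballI impI; elim conjE)
  note A = algebra_onD[OF alg]
  note sp = subspace_peirce[OF A(1)]
  fix e f assume ef: "e \<in> S" "f \<in> S" "e * e = e" "f * f = f" "e * f = 0" "f * e = 0"
  have "peirce S h (e + f) = {x + y | x y. x \<in> peirce S h e \<and> y \<in> peirce S h f}" (is "?L = ?R")
  proof
    show "?L \<subseteq> ?R"
    proof
      fix x assume x: "x \<in> ?L"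
      note x' = peirceE[OF x]
      have "x * e \<in> peirce S h e" "x * f \<in> peirce S h f"
        using A(2) ef x' by (simp_all add: peirce_def mult.assoc) (simp_all add: mult.assoc[symmetric])
      moreover have "x = x * e + x * f" using x'(3) by (simp add: distrib_left)
      ultimately show "x \<in> ?R" by blast
    qed
    show "?R \<subseteq> ?L"
    proof
      fix z assume "z \<in> ?R"
      then obtain x y where xy: "z = x + y" "x \<in> peirce S h e" "y \<in> peirce S h f" by blast
      note x = peirceE[OF xy(2)]
      note y = peirceE[OF xy(3)]
      have "x * f = 0" "y * e = 0"
        using x(3) y(3) ef(5,6) by (metis mult.assoc mult_zero_right)+
      thus "z \<in> ?L" using x y xy(1) A(7) by (simp add: peirce_def distrib_left distrib_right)
    qed
  qed
  moreover have "peirce S h e \<inter> peirce S h f = {0}"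
  proof -
    have "x = 0" if "x \<in> peirce S h e" "x \<in> peirce S h f" for x
      using peirceE(3)[OF that(1)] peirceE(3)[OF that(2)] ef(5) by (metis mult.assoc mult_zero_right)
    thus ?thesis using subspace_0[OF sp] by blast
  qed
  ultimately show "real (dim (peirce S h (e + f))) = real (dim (peirce S h e)) + real (dim (peirce S h f))"
    using dim_direct_sum[OF sp sp] by simp
next
  note A = algebra_onD[OF alg]
  note sp = subspace_peirce[OF A(1)]
  fix e f a b
  assume "e \<in> S" "f \<in> S" and a: "a \<in> peirce S e f" and b: "b \<in> peirce S f e"
    and ab: "a * b = e" "b * a = f"
  have "bij_betw (\<lambda>x. x * a) (peirce S h e) (peirce S h f)"
  proof (rule bij_betwI[where g = "\<lambda>x. x * b"])
    show "(\<lambda>x. x * a) \<in> peirce S h e \<rightarrow> peirce S h f" "(\<lambda>x. x * b) \<in> peirce S h f \<rightarrow> peirce S h e"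
      using peirce_mult[OF alg _ b] peirce_mult[OF alg _ a] by blast+
    show "x * a * b = x" if "x \<in> peirce S h e" for x
      using peirceE(3)[OF that] ab by (simp add: mult.assoc)
    show "x * b * a = x" if "x \<in> peirce S h f" for x
      using peirceE(3)[OF that] ab by (simp add: mult.assoc)
  qed
  thus "real (dim (peirce S h e)) = real (dim (peirce S h f))"
    using dim_bij_eq[OF lin_mult_right sp] by simp
qed

text \<open>
  Here \<open>d = dim ESE\<close>. In particular ranks are proportional to \<open>sqrt (dim eSe)\<close>, a quantity that
  does not depend on the choice of \<open>E\<close>.
\<close>

lemma peirce_dims:
  assumes S: "simple_alg S u"
  shows "\<exists>d>0. \<exists>rk::'a \<Rightarrow> nat. (\<forall>e\<in>S. e * e = e \<longrightarrow> (rk e = 0 \<longleftrightarrow> e = 0))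
    \<and> (\<forall>e\<in>S. \<forall>f\<in>S. e * e = e \<longrightarrow> f * f = f \<longrightarrow> dim (peirce S e f) = rk e * rk f * d)
    \<and> (\<forall>e\<in>S. \<forall>f\<in>S. \<forall>g. e * e = e \<longrightarrow> f * f = f \<longrightarrow> trace_like S g
      \<longrightarrow> g e * real (rk f) = g f * real (rk e))"
proof -
  note alg = simple_algD(1)[OF S]
  note A = algebra_onD[OF alg]
  obtain E and rk :: "'a \<Rightarrow> nat" where E: "E \<in> S" "E * E = E" "E \<noteq> 0"
    and rk0: "\<forall>e\<in>S. e * e = e \<longrightarrow> (rk e = 0 \<longleftrightarrow> e = 0)"
    and rk': "\<forall>e\<in>S. \<forall>g. e * e = e \<longrightarrow> trace_like S g \<longrightarrow> g e = real (rk e) * g E"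
    using rank_function[OF S] by (elim bexE exE conjE)
  have rk: "g e = real (rk e) * g E" if "e \<in> S" "e * e = e" "trace_like S g" for e g
    using rk' that by blast
  define d where "d = dim (peirce S E E)"
  have "E \<in> peirce S E E" using E by (simp add: peirce_def)
  hence "d \<noteq> 0" unfolding d_def using dim_zero_iff[OF subspace_peirce[OF A(1)]] E(3) by blast
  have dims: "dim (peirce S e f) = rk e * rk f * d"
    if e: "e \<in> S" "e * e = e" and f: "f \<in> S" "f * f = f" for e f
  proof -
    have "real (dim (peirce S e f)) = real (rk e) * real (dim (peirce S E f))"
      using rk[OF e trace_like_dim_left[OF alg f(1)]] .
    also have "real (dim (peirce S E f)) = real (rk f) * real d"
      using rk[OF f trace_like_dim_right[OF alg E(1)]] unfolding d_def .
    finally have "real (dim (peirce S e f)) = real (rk e * rk f * d)" by simp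
    thus ?thesis by (simp only: of_nat_eq_iff)
  qed
  have ratio: "g e * real (rk f) = g f * real (rk e)"
    if e: "e \<in> S" "e * e = e" and f: "f \<in> S" "f * f = f" and g: "trace_like S g" for e f g
    using rk[OF e g] rk[OF f g] by simp
  show ?thesis
    using rk0 dims ratio \<open>d \<noteq> 0\<close> by (intro exI[of _ d] exI[of _ rk] conjI) simp_all
qed

lemma trace_like_pos:
  assumes S: "simple_alg S u" and g: "trace_like S g"
    and e: "e \<in> S" "e * e = e" "e \<noteq> 0" and f: "f \<in> S" "f * f = f" "f \<noteq> 0"
    and "g e > 0"
  shows "g f > 0"
proof -
  obtain d and rk :: "'a \<Rightarrow> nat" where rk: "\<forall>e\<in>S. e * e = e \<longrightarrow> (rk e = 0 \<longleftrightarrow> e = 0)"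
    and dims: "\<forall>e\<in>S. \<forall>f\<in>S. e * e = e \<longrightarrow> f * f = f \<longrightarrow> dim (peirce S e f) = rk e * rk f * d"
    and ratio: "\<forall>e\<in>S. \<forall>f\<in>S. \<forall>g. e * e = e \<longrightarrow> f * f = f \<longrightarrow> trace_like S g
      \<longrightarrow> g e * real (rk f) = g f * real (rk e)"
    using peirce_dims[OF S] by (elim exE conjE)
  have "g f * real (rk e) = g e * real (rk f)" using ratio f(1,2) e(1,2) g by blast
  moreover have "rk f \<noteq> 0" "rk e \<noteq> 0" using rk e f by blast+
  ultimately show ?thesis using \<open>g e > 0\<close> by (metis mult_pos_pos zero_less_mult_pos2 of_nat_0_less_iff neq0_conv)
qed

lemma peirce_dim_square:
  assumes S: "simple_alg S u" and e: "e \<in> S" "e * e = e" and f: "f \<in> S" "f * f = f"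
  shows "(dim (peirce S e f))\<^sup>2 = dim (corner S e) * dim (corner S f)"
proof -
  obtain d and rk :: "'a \<Rightarrow> nat" where rk: "\<forall>e\<in>S. e * e = e \<longrightarrow> (rk e = 0 \<longleftrightarrow> e = 0)"
    and dims: "\<forall>e\<in>S. \<forall>f\<in>S. e * e = e \<longrightarrow> f * f = f \<longrightarrow> dim (peirce S e f) = rk e * rk f * d"
    and ratio: "\<forall>e\<in>S. \<forall>f\<in>S. \<forall>g. e * e = e \<longrightarrow> f * f = f \<longrightarrow> trace_like S g
      \<longrightarrow> g e * real (rk f) = g f * real (rk e)"
    using peirce_dims[OF S] by (elim exE conjE)
  show ?thesis unfolding corner_eq_peirce[OF simple_algD(1)[OF S] e] corner_eq_peirce[OF simple_algD(1)[OF S] f]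
    using dims e f by (simp add: power2_eq_square)
qed

lemma corner_dims_ratio_square:
  assumes S: "simple_alg S u" and e: "e \<in> S" "e * e = e" "e \<noteq> 0" and f: "f \<in> S" "f * f = f" "f \<noteq> 0"
  obtains m n :: nat where "m > 0" "n > 0" "m\<^sup>2 * dim (corner S f) = n\<^sup>2 * dim (corner S e)"
proof -
  obtain d and rk :: "'a \<Rightarrow> nat" where rk: "\<forall>e\<in>S. e * e = e \<longrightarrow> (rk e = 0 \<longleftrightarrow> e = 0)"
    and dims: "\<forall>e\<in>S. \<forall>f\<in>S. e * e = e \<longrightarrow> f * f = f \<longrightarrow> dim (peirce S e f) = rk e * rk f * d"
    and ratio: "\<forall>e\<in>S. \<forall>f\<in>S. \<forall>g. e * e = e \<longrightarrow> f * f = f \<longrightarrow> trace_like S g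
      \<longrightarrow> g e * real (rk f) = g f * real (rk e)"
    using peirce_dims[OF S] by (elim exE conjE)
  have "(rk e)\<^sup>2 * dim (corner S f) = (rk f)\<^sup>2 * dim (corner S e)"
    unfolding corner_eq_peirce[OF simple_algD(1)[OF S] e(1,2)] corner_eq_peirce[OF simple_algD(1)[OF S] f(1,2)]
    using dims e f by (simp add: power2_eq_square)
  moreover have "rk f \<noteq> 0" "rk e \<noteq> 0" using rk e f by blast+
  ultimately show ?thesis using that[of "rk e" "rk f"] by simp
qed

lemma sum_orthogonal_idempotents:
  assumes alg: "algebra_on S u" and fin: "finite I"
    and f: "\<And>i. i \<in> I \<Longrightarrow> f i \<in> S" "\<And>i. i \<in> I \<Longrightarrow> f i * f i = f i"
    and orth: "\<And>i j. i \<in> I \<Longrightarrow> j \<in> I \<Longrightarrow> i \<noteq> j \<Longrightarrow> f i * f j = 0"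
  shows "sum f I \<in> S \<and> sum f I * sum f I = sum f I
    \<and> (\<forall>h\<in>S. h * h = h \<longrightarrow> dim (peirce S (sum f I) h) = (\<Sum>i\<in>I. dim (peirce S (f i) h)))"
  using fin f orth
proof (induction I rule: finite_induct)
  case empty
  have "peirce S 0 h = {0}" for h using algebra_onD(6)[OF alg] by (auto simp: peirce_def)
  thus ?case using algebra_onD(6)[OF alg] by simp
next
  case (insert i I)
  have IH: "sum f I \<in> S" "sum f I * sum f I = sum f I"
    "\<And>h. h \<in> S \<Longrightarrow> h * h = h \<Longrightarrow> dim (peirce S (sum f I) h) = (\<Sum>i\<in>I. dim (peirce S (f i) h))"
    using insert.IH insert.prems by blast+
  have fi: "f i \<in> S" "f i * f i = f i" using insert.prems by blast+
  have "f i * f j = 0" "f j * f i = 0" if "j \<in> I" for j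
    using insert.prems(3) that insert.hyps by blast+
  hence orth: "f i * sum f I = 0" "sum f I * f i = 0"
    by (simp_all add: sum_distrib_left sum_distrib_right)
  have s: "sum f (insert i I) = f i + sum f I" using insert.hyps by simp
  have "(f i + sum f I) * (f i + sum f I) = f i + sum f I"
    by (simp add: distrib_left distrib_right fi IH(2) orth)
  moreover have "f i + sum f I \<in> S" using algebra_onD(7)[OF alg] fi IH by blast
  moreover have "dim (peirce S (f i + sum f I) h) = (\<Sum>i\<in>insert i I. dim (peirce S (f i) h))"
    if h: "h \<in> S" "h * h = h" for h
  proof -
    have "real (dim (peirce S (f i + sum f I) h)) = real (dim (peirce S (f i) h)) + real (dim (peirce S (sum f I) h))"
      using trace_likeD(1)[OF trace_like_dim_left[OF alg h(1)] fi(1) IH(1) fi(2) IH(2) orth] .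
    hence "dim (peirce S (f i + sum f I) h) = dim (peirce S (f i) h) + dim (peirce S (sum f I) h)"
      by (metis of_nat_add of_nat_eq_iff)
    thus ?thesis using IH(3)[OF h] insert.hyps by simp
  qed
  ultimately show ?case unfolding s by blast
qed

text \<open>The dimensions of the \<open>f\<^sub>iS\<close> add up to that of \<open>S\<close>; divide by \<open>sqrt (dim S)\<close>.\<close>

lemma sqrt_dim_corner_sum:
  assumes S: "simple_alg S u" and fin: "finite I"
    and f: "\<And>i. i \<in> I \<Longrightarrow> f i \<in> S" "\<And>i. i \<in> I \<Longrightarrow> f i * f i = f i"
    and orth: "\<And>i j. i \<in> I \<Longrightarrow> j \<in> I \<Longrightarrow> i \<noteq> j \<Longrightarrow> f i * f j = 0"
    and sum: "sum f I = u"
  shows "sqrt (dim S) = (\<Sum>i\<in>I. sqrt (dim (corner S (f i))))"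
proof -
  note alg = simple_algD(1)[OF S]
  note A = algebra_onD[OF alg]
  have uu: "u * u = u" using A(3,4) by blast
  have pu: "peirce S u u = S" using A(4,5) by (auto simp: peirce_def)
  have cu: "corner S u = S" using corner_eq_peirce[OF alg A(3) uu] pu by simp
  have pos: "dim S > 0" using dim_zero_iff[OF A(1)] A(3) simple_algD(2)[OF S] by blast
  have each: "real (dim (peirce S (f i) u)) = sqrt (dim (corner S (f i))) * sqrt (dim S)" if "i \<in> I" for i
  proof -
    have "(real (dim (peirce S (f i) u)))\<^sup>2 = real (dim (corner S (f i))) * real (dim S)"
      using peirce_dim_square[OF S f(1,2)[OF that] A(3) uu] unfolding cu
      by (metis of_nat_mult of_nat_power)
    thus ?thesis by (metis of_nat_0_le_iff real_sqrt_mult real_sqrt_unique)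
  qed
  have "dim (peirce S (sum f I) u) = (\<Sum>i\<in>I. dim (peirce S (f i) u))"
    using sum_orthogonal_idempotents[OF alg fin f orth] A(3) uu by simp
  hence "dim S = (\<Sum>i\<in>I. dim (peirce S (f i) u))" by (simp add: sum pu)
  hence "real (dim S) = (\<Sum>i\<in>I. real (dim (peirce S (f i) u)))" by simp
  also have "\<dots> = (\<Sum>i\<in>I. sqrt (dim (corner S (f i)))) * sqrt (dim S)"
    using each by (simp add: sum_distrib_right)
  finally have "sqrt (dim S) * sqrt (dim S) = (\<Sum>i\<in>I. sqrt (dim (corner S (f i)))) * sqrt (dim S)" by simp
  moreover have "sqrt (dim S) \<noteq> 0" using pos by (simp del: dim_eq_0)
  ultimately show ?thesis using mult_right_cancel by blast
qed

end

section \<open>Bases over subfields and the double centraliser formula\<close>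

context fd_algebra
begin

lemma field_onD:
  assumes "field_on K e"
  shows "algebra_on K e" "e \<noteq> 0" "\<And>x y. x \<in> K \<Longrightarrow> y \<in> K \<Longrightarrow> x * y = y * x"
    "\<And>x. x \<in> K \<Longrightarrow> x \<noteq> 0 \<Longrightarrow> \<exists>y\<in>K. x * y = e \<and> y * x = e"
proof -
  show *: "algebra_on K e" "e \<noteq> 0" "\<And>x y. x \<in> K \<Longrightarrow> y \<in> K \<Longrightarrow> x * y = y * x"
    using assms unfolding field_on_def by blast+
  show "\<exists>y\<in>K. x * y = e \<and> y * x = e" if x: "x \<in> K" "x \<noteq> 0" for x
  proof -
    have "\<forall>x\<in>K. x \<noteq> 0 \<longrightarrow> (\<exists>y\<in>K. x * y = e)" using assms unfolding field_on_def by (elim conjE)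
    then obtain y where y: "y \<in> K" "x * y = e" using x by blast
    have "y * x = e" by (rule trans[OF *(3)[OF y(1) x(1)] y(2)])
    thus ?thesis using y by blast
  qed
qed

lemma field_dim_pos: "field_on K e \<Longrightarrow> dim K > 0"
proof -
  assume K: "field_on K e"
  note A = algebra_onD[OF field_onD(1)[OF K]]
  have "K \<noteq> {0}" using A(3) field_onD(2)[OF K] by blast
  thus "dim K > 0" using dim_zero_iff[OF A(1)] by (metis neq0_conv)
qed

text \<open>
  Indexed families of elements, with coefficients acting from the left. The carrier \<open>K\<close> of the
  coefficients will be a subfield, the centre, or a product of fields.
\<close>

definition indep_over :: "'a set \<Rightarrow> nat \<Rightarrow> (nat \<Rightarrow> 'a) \<Rightarrow> bool" where
  "indep_over K r b \<longleftrightarrow> (\<forall>c. (\<forall>i<r. c i \<in> K) \<and> (\<Sum>i<r. c i * b i) = 0 \<longrightarrow> (\<forall>i<r. c i = 0))"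

definition span_over :: "'a set \<Rightarrow> nat \<Rightarrow> (nat \<Rightarrow> 'a) \<Rightarrow> 'a set" where
  "span_over K r b = {\<Sum>i<r. c i * b i | c. \<forall>i<r. c i \<in> K}"

definition basis_over :: "'a set \<Rightarrow> 'a set \<Rightarrow> nat \<Rightarrow> (nat \<Rightarrow> 'a) \<Rightarrow> bool" where
  "basis_over K V r b \<longleftrightarrow> (\<forall>i<r. b i \<in> V) \<and> indep_over K r b \<and> span_over K r b = V"

lemma span_overI:
  "(\<And>i. i < r \<Longrightarrow> c i \<in> K) \<Longrightarrow> x = (\<Sum>i<r. c i * b i) \<Longrightarrow> x \<in> span_over K r b"
  unfolding span_over_def by (intro CollectI exI[of _ c]) simp

lemma indep_overD:
  assumes "indep_over K r b" "\<And>i. i < r \<Longrightarrow> c i \<in> K" "(\<Sum>i<r. c i * b i) = 0" "i < r"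
  shows "c i = 0"
  using assms unfolding indep_over_def by blast

lemma indep_overD2:
  assumes K: "subspace K" and "indep_over K r b" "\<And>i. i < r \<Longrightarrow> c i \<in> K" "\<And>i. i < r \<Longrightarrow> d i \<in> K"
    "(\<Sum>i<r. c i * b i) = (\<Sum>i<r. d i * b i)" "i < r"
  shows "c i = d i"
proof -
  have "(\<Sum>i<r. (c i - d i) * b i) = 0" using assms(5) by (simp add: left_diff_distrib sum_subtractf)
  moreover have "\<And>i. i < r \<Longrightarrow> c i - d i \<in> K" using assms(3,4) subspace_diff[OF K] by blast
  ultimately have "c i - d i = 0" using indep_overD[OF assms(2), of "\<lambda>i. c i - d i" i] assms(6) by blast
  thus ?thesis by simp
qed

lemma indep_over_Suc:
  assumes K: "subspace K" and ind: "indep_over K (Suc r) b"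
  shows "indep_over K r b"
  unfolding indep_over_def
proof (intro allI impI; elim conjE)
  fix c i assume c: "\<forall>i<r. c i \<in> K" "(\<Sum>i<r. c i * b i) = 0" and i: "i < r"
  let ?c = "\<lambda>i. if i < r then c i else 0"
  have "?c i = 0"
  proof (rule indep_overD[OF ind, of ?c i])
    show "?c i \<in> K" if "i < Suc r" for i using c(1) subspace_0[OF K] by simp
    show "(\<Sum>i<Suc r. ?c i * b i) = 0" using c(2) by simp
  qed (use i in simp)
  thus "c i = 0" using i by simp
qed

lemma span_over_Suc:
  assumes K: "subspace K"
  shows "span_over K (Suc r) b = {x + y | x y. x \<in> span_over K r b \<and> y \<in> (\<lambda>k. k * b r) ` K}"
proof
  show "span_over K (Suc r) b \<subseteq> {x + y | x y. x \<in> span_over K r b \<and> y \<in> (\<lambda>k. k * b r) ` K}"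
  proof
    fix z assume "z \<in> span_over K (Suc r) b"
    then obtain c where c: "\<forall>i<Suc r. c i \<in> K" "z = (\<Sum>i<Suc r. c i * b i)"
      unfolding span_over_def by blast
    have "(\<Sum>i<r. c i * b i) \<in> span_over K r b" by (rule span_overI[of r c]) (use c(1) in simp_all)
    moreover have "c r * b r \<in> (\<lambda>k. k * b r) ` K" using c(1) by blast
    ultimately show "z \<in> {x + y | x y. x \<in> span_over K r b \<and> y \<in> (\<lambda>k. k * b r) ` K}"
      using c(2) unfolding sum.lessThan_Suc by blast
  qed
  show "{x + y | x y. x \<in> span_over K r b \<and> y \<in> (\<lambda>k. k * b r) ` K} \<subseteq> span_over K (Suc r) b"
  proof
    fix z assume "z \<in> {x + y | x y. x \<in> span_over K r b \<and> y \<in> (\<lambda>k. k * b r) ` K}"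
    then obtain c k where c: "\<forall>i<r. c i \<in> K" "k \<in> K" "z = (\<Sum>i<r. c i * b i) + k * b r"
      unfolding span_over_def by blast
    let ?c = "\<lambda>i. if i < r then c i else k"
    have "z = (\<Sum>i<Suc r. ?c i * b i)" using c(3) by simp
    moreover have "\<forall>i<Suc r. ?c i \<in> K" using c by simp
    ultimately show "z \<in> span_over K (Suc r) b" by (intro span_overI[of "Suc r" ?c]) simp_all
  qed
qed

lemma subspace_span_over:
  assumes K: "subspace K"
  shows "subspace (span_over K r b)"
proof (induction r)
  case 0
  have "span_over K 0 b = {0}" by (auto simp: span_over_def)
  thus ?case by simp
next
  case (Suc r)
  show ?case unfolding span_over_Suc[OF K]
    by (rule subspace_sums[OF Suc subspace_image_lin[OF lin_mult_right K]])
qed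

lemma dim_span_over:
  assumes K: "subspace K" and ind: "indep_over K r b"
  shows "dim (span_over K r b) = r * dim K"
  using ind
proof (induction r)
  case 0
  have "span_over K 0 b = {0}" by (auto simp: span_over_def)
  thus ?case by simp
next
  case (Suc r)
  let ?L = "(\<lambda>k. k * b r) ` K"
  have inj: "k = 0" if k: "k \<in> K" and x: "x \<in> span_over K r b" "x = k * b r" for k x
  proof -
    obtain c where c: "\<forall>i<r. c i \<in> K" "x = (\<Sum>i<r. c i * b i)"
      using x(1) unfolding span_over_def by blast
    let ?c = "\<lambda>i. if i < r then c i else - k"
    have "?c r = 0"
    proof (rule indep_overD[OF Suc.prems, of ?c r])
      show "?c i \<in> K" if "i < Suc r" for i using c(1) k subspace_neg[OF K] by simp
      show "(\<Sum>i<Suc r. ?c i * b i) = 0" using c(2) x(2) by simp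
    qed simp
    thus ?thesis by simp
  qed
  have z: "0 \<in> span_over K r b" by (rule subspace_0[OF subspace_span_over[OF K]])
  have "inj_on (\<lambda>k. k * b r) K"
    by (rule inj_onI_lin[OF lin_mult_right K]) (use inj z in simp)
  hence "dim ?L = dim K" by (rule dim_image_inj[OF lin_mult_right K])
  moreover have "span_over K r b \<inter> ?L = {0}"
  proof -
    have "x = 0" if x: "x \<in> span_over K r b" "x \<in> ?L" for x
    proof -
      obtain k where k: "k \<in> K" "x = k * b r" using x(2) by blast
      show ?thesis using inj[OF k(1) x(1) k(2)] k(2) by simp
    qed
    moreover have "0 \<in> ?L" by (rule subspace_0[OF subspace_image_lin[OF lin_mult_right K]])
    ultimately show ?thesis using z by blast
  qed
  ultimately have "dim (span_over K (Suc r) b) = dim (span_over K r b) + dim K"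
    unfolding span_over_Suc[OF K]
    using dim_direct_sum[OF subspace_span_over[OF K] subspace_image_lin[OF lin_mult_right K]] by simp
  thus ?case using Suc.IH indep_over_Suc[OF K Suc.prems] by simp
qed

lemma basis_over_dim: "subspace K \<Longrightarrow> basis_over K V r b \<Longrightarrow> dim V = r * dim K"
  unfolding basis_over_def using dim_span_over by metis

lemma basis_over_exists:
  assumes K: "field_on K e" and V: "subspace V" and KV: "\<And>k v. k \<in> K \<Longrightarrow> v \<in> V \<Longrightarrow> k * v \<in> V"
    and e: "\<And>v. v \<in> V \<Longrightarrow> e * v = v"
  shows "\<exists>r b. basis_over K V r b"
proof -
  note A = algebra_onD[OF field_onD(1)[OF K]]
  define P where "P r \<longleftrightarrow> (\<exists>b. (\<forall>i<r. b i \<in> V) \<and> indep_over K r b)" for r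
  have sub: "span_over K r b \<subseteq> V" if "\<forall>i<r. b i \<in> V" for r b
  proof
    fix x assume "x \<in> span_over K r b"
    then obtain c where "\<forall>i<r. c i \<in> K" "x = (\<Sum>i<r. c i * b i)" unfolding span_over_def by blast
    thus "x \<in> V" using that KV by (auto intro!: subspace_sum[OF V])
  qed
  have bound: "r \<le> dim V" if "P r" for r
  proof -
    obtain b where b: "\<forall>i<r. b i \<in> V" "indep_over K r b" using \<open>P r\<close> unfolding P_def by blast
    have "r * dim K \<le> dim V" using dim_subset[OF sub[OF b(1)]] dim_span_over[OF A(1) b(2)] by simp
    moreover have "r * 1 \<le> r * dim K" using field_dim_pos[OF K] by (intro mult_le_mono2) linarith
    ultimately show ?thesis by linarith
  qed
  have "P 0" unfolding P_def indep_over_def by simp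
  then obtain r where r: "P r" "\<And>s. P s \<Longrightarrow> s \<le> r"
    using GreatestI_ex_nat[of P "dim V"] Greatest_le_nat[of P _ "dim V"] bound by blast
  obtain b where b: "\<forall>i<r. b i \<in> V" "indep_over K r b" using r(1) unfolding P_def by blast
  have "V \<subseteq> span_over K r b"
  proof
    fix v assume v: "v \<in> V"
    show "v \<in> span_over K r b"
    proof (rule ccontr)
      assume nv: "v \<notin> span_over K r b"
      let ?b = "\<lambda>i. if i < r then b i else v"
      have "indep_over K (Suc r) ?b"
        unfolding indep_over_def
      proof (rule allI, rule impI, elim conjE)
        fix c assume c: "\<forall>i<Suc r. c i \<in> K" "(\<Sum>i<Suc r. c i * ?b i) = 0"
        have eq: "(\<Sum>i<r. c i * b i) + c r * v = 0" using c(2) by simp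
        have "c r = 0"
        proof (rule ccontr)
          assume "c r \<noteq> 0"
          then obtain k where k: "k \<in> K" "k * c r = e" using field_onD(4)[OF K, of "c r"] c(1) by auto
          have "c r * v = - (\<Sum>i<r. c i * b i)" using eq by (simp add: eq_neg_iff_add_eq_0 add.commute)
          hence "k * (c r * v) = (\<Sum>i<r. - (k * c i) * b i)"
            by (simp add: sum_distrib_left sum_negf mult.assoc)
          moreover have "k * (c r * v) = v" using k(2) e[OF v] by (simp add: mult.assoc[symmetric])
          moreover have "\<forall>i<r. - (k * c i) \<in> K" using c(1) k(1) A(2,9) by simp
          ultimately have "v \<in> span_over K r b"
            by (intro span_overI[of r "\<lambda>i. - (k * c i)"]) simp_all
          thus False using nv by blast
        qed
        moreover have "c i = 0" if "i < r" for i
          by (rule indep_overD[OF b(2) _ _ that]) (use c(1) eq \<open>c r = 0\<close> in simp_all)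
        ultimately show "\<forall>i<Suc r. c i = 0" using less_Suc_eq by auto
      qed
      moreover have "\<forall>i<Suc r. ?b i \<in> V" using b(1) v by simp
      ultimately have "P (Suc r)" unfolding P_def by (intro exI[of _ ?b]) simp
      thus False using r(2) by fastforce
    qed
  qed
  thus ?thesis unfolding basis_over_def using b sub[OF b(1)] by blast
qed

lemma basis_over_coords:
  assumes "basis_over K V r b" "x \<in> V"
  shows "\<exists>c. (\<forall>i<r. c i \<in> K) \<and> x = (\<Sum>i<r. c i * b i)"
  using assms unfolding basis_over_def span_over_def by blast

text \<open>
  The injectivity half of \<open>S \<otimes>\<^sub>Z S\<^sup>o\<^sup>p \<cong> End\<^sub>Z(S)\<close>. In a relation of length \<open>s + 1\<close> that involves the
  last \<open>b\<close>, the last coefficient may be taken to be \<open>u\<close>, since these coefficients form an ideal.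
  Commutators of its coefficients with any \<open>y\<close> then give a relation of length \<open>s\<close>, so the
  coefficients are central, contradicting independence at \<open>x = u\<close>.
\<close>

lemma two_sided_independent:
  assumes S: "simple_alg S u"
  shows "\<lbrakk>indep_over (centre S) s b; \<And>j. j < s \<Longrightarrow> b j \<in> S; \<And>j. j < s \<Longrightarrow> a j \<in> S;
     \<And>x. x \<in> S \<Longrightarrow> (\<Sum>j<s. a j * x * b j) = 0; j < s\<rbrakk> \<Longrightarrow> a j = 0"
proof (induction s arbitrary: a j)
  case 0
  thus ?case by simp
next
  case (Suc s)
  note alg = simple_algD(1)[OF S]
  note A = algebra_onD[OF alg]
  note subZ = subspace_centre[OF A(1)]
  have ind: "indep_over (centre S) s b" using indep_over_Suc[OF subZ Suc.prems(1)] .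
  have IH: "a j = 0" if "\<And>j. j < s \<Longrightarrow> a j \<in> S" "\<And>x. x \<in> S \<Longrightarrow> (\<Sum>j<s. a j * x * b j) = 0" "j < s" for a j
    using Suc.IH[OF ind _ that] Suc.prems(2) by simp
  define R where "R a \<longleftrightarrow> (\<forall>j<Suc s. a j \<in> S) \<and> (\<forall>x\<in>S. (\<Sum>j<Suc s. a j * x * b j) = 0)" for a
  have Ra: "R a" unfolding R_def using Suc.prems by blast
  have "a s = 0"
  proof (rule ccontr)
    assume as: "a s \<noteq> 0"
    have "ideal_on S {a s | a. R a}"
    proof (rule ideal_onI)
      show "{a s | a. R a} \<subseteq> S" unfolding R_def by blast
      have "R (\<lambda>_. 0)" unfolding R_def using A(6) by simp
      thus "0 \<in> {a s | a. R a}" by force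
      fix x y assume "x \<in> {a s | a. R a}" "y \<in> {a s | a. R a}"
      then obtain a a' where aa: "R a" "R a'" "x = a s" "y = a' s" by blast
      have "R (\<lambda>j. a j - a' j)" using aa(1,2) A(8) unfolding R_def
        by (auto simp: left_diff_distrib sum_subtractf simp del: sum.lessThan_Suc)
      thus "x - y \<in> {a s | a. R a}" using aa(3,4) by force
    next
      fix y x assume y: "y \<in> S" and "x \<in> {a s | a. R a}"
      then obtain a where a: "R a" "x = a s" by blast
      have "(\<Sum>j<Suc s. y * a j * x * b j) = 0" if "x \<in> S" for x
      proof -
        have "(\<Sum>j<Suc s. y * a j * x * b j) = y * (\<Sum>j<Suc s. a j * x * b j)"
          unfolding sum_distrib_left by (simp only: mult.assoc)
        thus ?thesis using a(1) that unfolding R_def by simp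
      qed
      hence "R (\<lambda>j. y * a j)" using a(1) A(2)[OF y] unfolding R_def by blast
      thus "y * x \<in> {a s | a. R a}" using a(2) by force
      have "(\<Sum>j<Suc s. a j * y * x * b j) = 0" if "x \<in> S" for x
      proof -
        have "(\<Sum>j<Suc s. a j * (y * x) * b j) = 0" using a(1) A(2)[OF y that] unfolding R_def by blast
        thus ?thesis by (simp only: mult.assoc)
      qed
      hence "R (\<lambda>j. a j * y)" using a(1) A(2)[OF _ y] unfolding R_def by blast
      thus "x * y \<in> {a s | a. R a}" using a(2) by force
    qed
    moreover have "a s \<in> {a s | a. R a}" using Ra by blast
    ultimately have "{a s | a. R a} = S" using simple_algD(3)[OF S] as by blast
    then obtain a where a: "R a" "a s = u" using A(3) by force
    have cent: "a j \<in> centre S" if j: "j < Suc s" for j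
    proof (rule centreI)
      show "a j \<in> S" using a(1) j unfolding R_def by blast
      fix y assume y: "y \<in> S"
      show "a j * y = y * a j"
      proof (cases "j = s")
        case True thus ?thesis using a(2) A(4,5) y by simp
      next
        case False
        have "a j * y - y * a j = 0"
        proof (rule IH)
          show "a j * y - y * a j \<in> S" if "j < s" for j
            using a(1) that A(2,8) y unfolding R_def by simp
          show "j < s" using False j by simp
          fix x assume x: "x \<in> S"
          have "(\<Sum>j<s. (a j * y - y * a j) * x * b j) = (\<Sum>j<Suc s. (a j * y - y * a j) * x * b j)"
            using a(2) A(4,5) y by simp
          also have "\<dots> = (\<Sum>j<Suc s. a j * (y * x) * b j) - y * (\<Sum>j<Suc s. a j * x * b j)"
            unfolding sum_distrib_left sum_subtractf[symmetric]
            by (simp only: mult.assoc left_diff_distrib)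
          also have "\<dots> = 0" using a(1) A(2)[OF y x] x unfolding R_def by simp
          finally show "(\<Sum>j<s. (a j * y - y * a j) * x * b j) = 0" .
        qed
        thus ?thesis by simp
      qed
    qed
    have "(\<Sum>j<Suc s. a j * b j) = (\<Sum>j<Suc s. a j * u * b j)"
      using a(1) A(5) unfolding R_def by (intro sum.cong) simp_all
    also have "\<dots> = 0" using a(1) A(3) unfolding R_def by blast
    finally have "a s = 0" using indep_overD[OF Suc.prems(1), of a s] cent by blast
    thus False using a(2) simple_algD(2)[OF S] by simp
  qed
  moreover have "a j = 0" if "j < s" for j
  proof (rule IH[OF _ _ that])
    show "a j \<in> S" if "j < s" for j using Suc.prems(3) that by simp
    show "(\<Sum>j<s. a j * x * b j) = 0" if "x \<in> S" for x
      using Suc.prems(4)[OF that] \<open>a s = 0\<close> by simp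
  qed
  ultimately show ?case using Suc.prems(5) less_Suc_eq by auto
qed

text \<open>Powers \<open>C\<^sup>n\<close> of a subspace, as sequences supported on \<open>{..<n}\<close>.\<close>

definition power_space :: "nat \<Rightarrow> 'a set \<Rightarrow> (nat \<Rightarrow> 'a) set" where
  "power_space n C = {f. (\<forall>i<n. f i \<in> C) \<and> (\<forall>i\<ge>n. f i = 0)}"

definition scale_fun :: "'f \<Rightarrow> (nat \<Rightarrow> 'a) \<Rightarrow> nat \<Rightarrow> 'a" where
  "scale_fun c f = (\<lambda>i. c *s f i)"

lemma vector_space_scale_fun: "vector_space scale_fun"
  by unfold_locales (simp_all add: scale_fun_def fun_eq_iff scale_right_distrib scale_left_distrib)

lemma power_space_basis:
  assumes C: "subspace C"
  obtains \<beta> where "finite \<beta>" "card \<beta> = n * dim C" "\<not> module.dependent scale_fun \<beta>"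
    "module.span scale_fun \<beta> = power_space n C"
proof -
  interpret fs: vector_space scale_fun by (rule vector_space_scale_fun)
  obtain B where B: "B \<subseteq> C" "independent B" "C \<subseteq> span B" "card B = dim C" by (rule basis_exists)
  have finB: "finite B" using finiteI_independent[OF B(2)] .
  have B0: "x \<noteq> 0" if "x \<in> B" for x using that dependent_zero B(2) by blast
  define sg where "sg = (\<lambda>(j::nat, x::'a) i. if i = j then x else 0)"
  define \<beta> where "\<beta> = sg ` ({..<n} \<times> B)"
  have inj: "inj_on sg ({..<n} \<times> B)"
  proof (rule inj_onI; clarify)
    fix j x k y assume h: "j < n" "x \<in> B" "k < n" "y \<in> B" "sg (j, x) = sg (k, y)"
    have "x = (if j = k then y else 0)" using fun_cong[OF h(5), of j] by (simp add: sg_def)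
    thus "j = k \<and> x = y" using B0[OF h(2)] by (auto split: if_splits)
  qed
  have fin: "finite \<beta>" unfolding \<beta>_def using finB by simp
  have card: "card \<beta> = n * dim C" unfolding \<beta>_def using card_image[OF inj] B(4) by (simp add: card_cartesian_product)
  have sumF: "(\<Sum>g\<in>A. h g) i = (\<Sum>g\<in>A. h g i)" for A :: "'z set" and h :: "'z \<Rightarrow> nat \<Rightarrow> 'a" and i
    by (induction A rule: infinite_finite_induct) auto
  have eval: "(\<Sum>g\<in>\<beta>. scale_fun (c g) g) i = (if i < n then \<Sum>x\<in>B. c (sg (i, x)) *s x else 0)" for c i
  proof -
    have "(\<Sum>g\<in>\<beta>. scale_fun (c g) g) i = (\<Sum>p\<in>{..<n} \<times> B. c (sg p) *s sg p i)"
      unfolding sumF \<beta>_def by (simp add: sum.reindex[OF inj] scale_fun_def)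
    also have "\<dots> = (\<Sum>j<n. \<Sum>x\<in>B. c (sg (j, x)) *s (if i = j then x else 0))"
      unfolding sum.cartesian_product by (intro sum.cong) (auto simp: sg_def)
    also have "\<dots> = (\<Sum>j<n. if i = j then (\<Sum>x\<in>B. c (sg (j, x)) *s x) else 0)"
      by (intro sum.cong) auto
    also have "\<dots> = (if i < n then \<Sum>x\<in>B. c (sg (i, x)) *s x else 0)" by simp
    finally show ?thesis .
  qed
  have ind: "\<not> fs.dependent \<beta>"
  proof (rule fs.independent_if_scalars_zero[OF fin])
    fix c g assume s: "(\<Sum>g\<in>\<beta>. scale_fun (c g) g) = 0" and "g \<in> \<beta>"
    then obtain j x where jx: "j < n" "x \<in> B" "g = sg (j, x)" unfolding \<beta>_def by auto
    have "(\<Sum>x\<in>B. c (sg (j, x)) *s x) = 0" using eval[of c j] s jx(1) by simp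
    moreover have "\<forall>c. (\<Sum>x\<in>B. c x *s x) = 0 \<longrightarrow> (\<forall>x\<in>B. c x = 0)"
      using B(2) unfolding independent_explicit by (elim conjE)
    ultimately have "\<forall>x\<in>B. c (sg (j, x)) = 0" by (auto dest: spec[of _ "\<lambda>x. c (sg (j, x))"])
    thus "c g = 0" using jx by simp
  qed
  have "fs.span \<beta> = power_space n C"
  proof
    show "fs.span \<beta> \<subseteq> power_space n C"
    proof (rule fs.span_minimal)
      show "\<beta> \<subseteq> power_space n C"
        using B(1) subspace_0[OF C] by (auto simp: \<beta>_def sg_def power_space_def)
      show "fs.subspace (power_space n C)"
        unfolding fs.subspace_def power_space_def scale_fun_def
        using subspace_0[OF C] subspace_add[OF C] subspace_scale[OF C] by simp
    qed
    show "power_space n C \<subseteq> fs.span \<beta>"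
    proof
      fix f assume f: "f \<in> power_space n C"
      have "\<exists>d. i < n \<longrightarrow> f i = (\<Sum>x\<in>B. d x *s x)" for i
      proof (cases "i < n")
        case True
        hence "f i \<in> span B" using f B(3) unfolding power_space_def by blast
        then obtain d where "f i = (\<Sum>x\<in>B. d x *s x)" using span_finite[OF finB] by auto
        thus ?thesis by blast
      qed simp
      then obtain d where d: "\<And>i. i < n \<Longrightarrow> f i = (\<Sum>x\<in>B. d i x *s x)" by metis
      define c where "c g = (let p = inv_into ({..<n} \<times> B) sg g in d (fst p) (snd p))" for g
      have c: "c (sg (i, x)) = d i x" if "i < n" "x \<in> B" for i x
        using that inv_into_f_f[OF inj, of "(i, x)"] by (simp add: c_def)
      have "f = (\<Sum>g\<in>\<beta>. scale_fun (c g) g)"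
      proof
        fix i
        have "(\<Sum>x\<in>B. c (sg (i, x)) *s x) = (\<Sum>x\<in>B. d i x *s x)" if "i < n"
          using c that by (intro sum.cong) simp_all
        thus "f i = (\<Sum>g\<in>\<beta>. scale_fun (c g) g) i"
          unfolding eval using d f by (auto simp: power_space_def)
      qed
      thus "f \<in> fs.span \<beta>" by (simp add: fs.span_sum fs.span_scale fs.span_base)
    qed
  qed
  thus ?thesis using that fin card ind by blast
qed

lemma power_space_map:
  assumes add: "\<And>f g. T (f + g) = T f + T g" and sc: "\<And>c f. T (scale_fun c f) = scale_fun c (T f)"
    and C: "subspace C" and D: "subspace D"
    and into: "T ` power_space s C \<subseteq> power_space r D"
    and inj: "\<And>f. f \<in> power_space s C \<Longrightarrow> T f = 0 \<Longrightarrow> f = 0"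
  shows "s * dim C = r * dim D \<longleftrightarrow> T ` power_space s C = power_space r D"
proof -
  interpret fs: vector_space scale_fun by (rule vector_space_scale_fun)
  interpret fp: vector_space_pair scale_fun scale_fun by unfold_locales
  obtain \<beta> where \<beta>: "finite \<beta>" "card \<beta> = s * dim C" "\<not> fs.dependent \<beta>" "fs.span \<beta> = power_space s C"
    by (rule power_space_basis[OF C])
  obtain \<gamma> where \<gamma>: "finite \<gamma>" "card \<gamma> = r * dim D" "\<not> fs.dependent \<gamma>" "fs.span \<gamma> = power_space r D"
    by (rule power_space_basis[OF D])
  have T: "Vector_Spaces.linear scale_fun scale_fun T"
    by (simp add: Vector_Spaces.linear_iff fs.vector_space_axioms add sc)
  have diff: "T (f - g) = T f - T g" for f g
    using add[of "f - g" g] by (simp add: algebra_simps)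
  have injT: "inj_on T (fs.span \<beta>)"
  proof (rule inj_onI)
    fix f g assume fg: "f \<in> fs.span \<beta>" "g \<in> fs.span \<beta>" "T f = T g"
    have "f - g \<in> power_space s C" using fs.span_diff[OF fg(1,2)] \<beta>(4) by simp
    moreover have "T (f - g) = 0" using diff fg(3) by simp
    ultimately have "f - g = 0" using inj by blast
    thus "f = g" by simp
  qed
  have indT: "\<not> fs.dependent (T ` \<beta>)"
    using fp.linear_independent_injective_image[OF T \<beta>(3) injT] .
  have "inj_on T \<beta>" using injT fs.span_superset inj_on_subset by blast
  hence cardT: "card (T ` \<beta>) = s * dim C" using card_image \<beta>(2) by metis
  have spanT: "fs.span (T ` \<beta>) = T ` power_space s C"
    using fp.linear_span_image[OF T] \<beta>(4) by metis
  have sub: "T ` \<beta> \<subseteq> fs.span \<gamma>" using into \<beta>(4) \<gamma>(4) fs.span_superset by blast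
  show ?thesis
  proof
    assume eq: "s * dim C = r * dim D"
    show "T ` power_space s C = power_space r D"
    proof (rule antisym[OF into], rule subsetI, rule ccontr)
      fix y assume y: "y \<in> power_space r D" "y \<notin> T ` power_space s C"
      hence "y \<notin> fs.span (T ` \<beta>)" using spanT by simp
      hence i: "\<not> fs.dependent (insert y (T ` \<beta>))" using fs.independent_insertI indT by blast
      have "y \<notin> T ` \<beta>" using \<open>y \<notin> fs.span (T ` \<beta>)\<close> fs.span_base by blast
      hence "card (insert y (T ` \<beta>)) = Suc (card (T ` \<beta>))" using \<beta>(1) by simp
      moreover have "insert y (T ` \<beta>) \<subseteq> fs.span \<gamma>" using sub y(1) \<gamma>(4) by simp
      ultimately show False
        using fs.independent_span_bound[OF \<gamma>(1) i] cardT \<gamma>(2) eq by simp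
    qed
  next
    assume eq: "T ` power_space s C = power_space r D"
    have "card (T ` \<beta>) \<le> card \<gamma>" using fs.independent_span_bound[OF \<gamma>(1) indT sub] by blast
    moreover have "\<gamma> \<subseteq> fs.span (T ` \<beta>)" using spanT eq \<gamma>(4) fs.span_superset[of \<gamma>] by simp
    hence "card \<gamma> \<le> card (T ` \<beta>)"
      using fs.independent_span_bound[OF finite_imageI[OF \<beta>(1)] \<gamma>(3)] by blast
    ultimately show "s * dim C = r * dim D" using cardT \<gamma>(2) by simp
  qed
qed

definition centraliser :: "'a set \<Rightarrow> 'a set \<Rightarrow> 'a set" where
  "centraliser S K = {x \<in> S. \<forall>k\<in>K. k * x = x * k}"

lemma subspace_centraliser: "subspace S \<Longrightarrow> subspace (centraliser S K)"
  unfolding subspace_def centraliser_def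
  by (simp add: distrib_left distrib_right scale_mult_left[symmetric] scale_mult_right[symmetric])

lemma centraliserD:
  assumes "x \<in> centraliser S K"
  shows "x \<in> S" "\<And>k. k \<in> K \<Longrightarrow> k * x = x * k"
  using assms unfolding centraliser_def by blast+

lemma centraliserI: "x \<in> S \<Longrightarrow> (\<And>k. k \<in> K \<Longrightarrow> k * x = x * k) \<Longrightarrow> x \<in> centraliser S K"
  unfolding centraliser_def by blast

text \<open>
  For bases \<open>b\<close> of \<open>S\<close> over its centre and \<open>c\<close> of \<open>S\<close> over \<open>K\<close>, sending \<open>(a\<^sub>j)\<close> to the values at
  the \<open>c\<^sub>i\<close> of \<open>x \<mapsto> \<Sum> a\<^sub>j x b\<^sub>j\<close> is injective on \<open>C\<^sup>s\<close>, where \<open>C\<close> is the centraliser of \<open>K\<close>.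
  With \<open>K\<close> replaced by the centre this shows that all centre-linear maps have the form
  \<open>x \<mapsto> \<Sum> a\<^sub>j x b\<^sub>j\<close>, and the left \<open>K\<close>-linear ones are those with all \<open>a\<^sub>j\<close> in \<open>C\<close>. So \<open>C\<^sup>s\<close> maps
  onto \<open>S\<^sup>r\<close>, and counting dimensions gives the formula.
\<close>

lemma centraliser_map_inj:
  assumes S: "simple_alg S u" and K: "field_on K u" "K \<subseteq> S"
    and b: "indep_over (centre S) s b" "\<And>j. j < s \<Longrightarrow> b j \<in> S"
    and c: "basis_over K S r c"
    and a: "\<And>j. j < s \<Longrightarrow> a j \<in> centraliser S K"
    and 0: "\<And>i. i < r \<Longrightarrow> (\<Sum>j<s. a j * c i * b j) = 0" and j: "j < s"
  shows "a j = 0"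
proof (rule two_sided_independent[OF S b _ _ j])
  show "a j \<in> S" if "j < s" for j using a[OF that] centraliserD(1) by blast
  fix x assume "x \<in> S"
  then obtain k where k: "\<forall>i<r. k i \<in> K" "x = (\<Sum>i<r. k i * c i)"
    using basis_over_coords[OF c] by blast
  have "(\<Sum>j<s. a j * x * b j) = (\<Sum>j<s. \<Sum>i<r. a j * k i * c i * b j)"
    unfolding k(2) by (simp add: sum_distrib_left sum_distrib_right mult.assoc)
  also have "\<dots> = (\<Sum>j<s. \<Sum>i<r. k i * (a j * c i * b j))"
  proof (intro sum.cong refl)
    fix j i assume "j \<in> {..<s}" "i \<in> {..<r}"
    hence "a j * k i = k i * a j" using centraliserD(2)[OF a[of j], of "k i"] k(1) by simp
    thus "a j * k i * c i * b j = k i * (a j * c i * b j)" by (simp add: mult.assoc)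
  qed
  also have "\<dots> = (\<Sum>i<r. k i * (\<Sum>j<s. a j * c i * b j))"
    unfolding sum_distrib_left by (rule sum.swap)
  also have "\<dots> = 0" using 0 by simp
  finally show "(\<Sum>j<s. a j * x * b j) = 0" .
next
  show "j < s" if "j < s" for j using that .
qed

lemma two_sided_map_linear:
  fixes c b :: "nat \<Rightarrow> 'a" and r s :: nat
  defines "T \<equiv> \<lambda>a i. if i < r then \<Sum>j<s. a j * c i * b j else 0"
  shows "T (f + g) = T f + T g" "T (scale_fun k f) = scale_fun k (T f)"
  by (simp_all add: T_def fun_eq_iff scale_fun_def distrib_right sum.distrib scale_sum_right
      scale_mult_left[symmetric])

lemma two_sided_map_into:
  assumes S: "algebra_on S u" and C: "C \<subseteq> S" and c: "\<And>i. i < r \<Longrightarrow> c i \<in> S" and b: "\<And>j. j < s \<Longrightarrow> b j \<in> S"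
  shows "(\<lambda>a i. if i < r then \<Sum>j<s. a j * c i * b j else 0) ` power_space s C \<subseteq> power_space r S"
proof -
  note A = algebra_onD[OF S]
  have "(\<Sum>j<s. a j * c i * b j) \<in> S" if "i < r" "a \<in> power_space s C" for a i
    by (rule subspace_sum[OF A(1)]) (use that C c b A(2) in \<open>auto simp: power_space_def\<close>)
  thus ?thesis by (auto simp: power_space_def)
qed

lemma centre_linear_two_sided:
  assumes S: "simple_alg S u" and b: "basis_over (centre S) S s b"
    and f: "\<And>x y. x \<in> S \<Longrightarrow> y \<in> S \<Longrightarrow> f (x + y) = f x + f y"
      "\<And>z x. z \<in> centre S \<Longrightarrow> x \<in> S \<Longrightarrow> f (z * x) = z * f x"
      "\<And>x. x \<in> S \<Longrightarrow> f x \<in> S"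
  shows "\<exists>a. (\<forall>j<s. a j \<in> S) \<and> (\<forall>x\<in>S. f x = (\<Sum>j<s. a j * x * b j))"
proof -
  note alg = simple_algD(1)[OF S]
  note A = algebra_onD[OF alg]
  have bS: "b j \<in> S" if "j < s" for j using b that unfolding basis_over_def by blast
  have ind: "indep_over (centre S) s b" using b unfolding basis_over_def by blast
  let ?T = "\<lambda>a i. if i < s then \<Sum>j<s. a j * b i * b j else 0"
  have cS: "a j \<in> centraliser S (centre S)" if "a \<in> power_space s S" "j < s" for a j
    using that centreD(2) unfolding power_space_def by (intro centraliserI) auto
  have inj: "a = 0" if a: "a \<in> power_space s S" "?T a = 0" for a
  proof
    fix j
    have "a j = 0" if "j < s"
    proof (rule centraliser_map_inj[OF S simple_centre_field[OF S] _ ind bS b cS[OF a(1)] _ that])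
      show "centre S \<subseteq> S" using centreD(1) by blast
      show "(\<Sum>j<s. a j * b i * b j) = 0" if "i < s" for i
        using fun_cong[OF a(2), of i] that by simp
    qed
    moreover have "a j = 0" if "\<not> j < s" using that a(1) by (simp add: power_space_def)
    ultimately show "a j = 0 j" by (cases "j < s") simp_all
  qed
  have "?T ` power_space s S = power_space s S"
    by (rule power_space_map[OF two_sided_map_linear A(1) A(1) two_sided_map_into[OF alg _ bS bS] inj, THEN iffD1])
      simp_all
  moreover have "(\<lambda>i. if i < s then f (b i) else 0) \<in> power_space s S"
    using f(3) bS by (simp add: power_space_def)
  ultimately have "(\<lambda>i. if i < s then f (b i) else 0) \<in> ?T ` power_space s S" by (simp only:)
  then obtain a where a: "(\<lambda>i. if i < s then f (b i) else 0) = ?T a" "a \<in> power_space s S"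
    by (rule imageE)
  have fb: "f (b i) = (\<Sum>j<s. a j * b i * b j)" if "i < s" for i
    using fun_cong[OF a(1), of i] that by simp
  have "f x = (\<Sum>j<s. a j * x * b j)" if x: "x \<in> S" for x
  proof -
    obtain z where z: "\<forall>i<s. z i \<in> centre S" "x = (\<Sum>i<s. z i * b i)"
      using basis_over_coords[OF b x] by blast
    have f0: "f 0 = 0" using f(1)[OF A(6) A(6)] by simp
    have fsum: "f (\<Sum>i<n. z i * b i) = (\<Sum>i<n. z i * f (b i))" if "n \<le> s" for n
      using that
    proof (induction n)
      case (Suc n)
      have "z i * b i \<in> S" if "i \<le> n" for i
        using A(2) bS[of i] centreD(1)[of "z i"] z(1) that Suc.prems by simp
      hence "f ((\<Sum>i<n. z i * b i) + z n * b n) = f (\<Sum>i<n. z i * b i) + f (z n * b n)"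
        by (intro f(1) subspace_sum[OF A(1)]) simp_all
      thus ?case using Suc f(2) bS z(1) by simp
    qed (simp add: f0)
    have "f x = (\<Sum>i<s. z i * (\<Sum>j<s. a j * b i * b j))"
      unfolding z(2) fsum[OF order_refl] by (intro sum.cong) (simp_all add: fb)
    also have "\<dots> = (\<Sum>j<s. \<Sum>i<s. z i * (a j * b i * b j))"
      unfolding sum_distrib_left by (rule sum.swap)
    also have "\<dots> = (\<Sum>j<s. \<Sum>i<s. a j * (z i * b i) * b j)"
    proof (intro sum.cong refl)
      fix j i assume "j \<in> {..<s}" "i \<in> {..<s}"
      hence "z i * a j = a j * z i" using centreD(2)[of "z i" S "a j"] z(1) a(2) unfolding power_space_def by simp
      thus "z i * (a j * b i * b j) = a j * (z i * b i) * b j" by (simp add: mult.assoc[symmetric])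
    qed
    also have "\<dots> = (\<Sum>j<s. a j * x * b j)"
      unfolding z(2) by (simp add: sum_distrib_left sum_distrib_right)
    finally show ?thesis .
  qed
  thus ?thesis using a(2) unfolding power_space_def by blast
qed

lemma double_centraliser_dim:
  assumes S: "simple_alg S u" and K: "field_on K u" "K \<subseteq> S" "centre S \<subseteq> K"
  shows "dim (centraliser S K) * dim K = dim (centre S) * dim S"
proof -
  note alg = simple_algD(1)[OF S]
  note A = algebra_onD[OF alg]
  note KA = algebra_onD[OF field_onD(1)[OF K(1)]]
  note ZA = algebra_onD[OF field_onD(1)[OF simple_centre_field[OF S]]]
  let ?C = "centraliser S K"
  obtain s b where b: "basis_over (centre S) S s b"
    using basis_over_exists[OF simple_centre_field[OF S] A(1)] A(2,4) centreD(1) by blast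
  obtain r c where c: "basis_over K S r c"
    using basis_over_exists[OF K(1) A(1)] A(2,4) K(2) by blast
  have bS: "b j \<in> S" if "j < s" for j using b that unfolding basis_over_def by blast
  have cS: "c j \<in> S" if "j < r" for j using c that unfolding basis_over_def by blast
  have indb: "indep_over (centre S) s b" using b unfolding basis_over_def by blast
  have indc: "indep_over K r c" using c unfolding basis_over_def by blast
  let ?T = "\<lambda>a i. if i < r then \<Sum>j<s. a j * c i * b j else 0"
  have CS: "?C \<subseteq> S" using centraliserD(1) by blast
  have inj: "a = 0" if a: "a \<in> power_space s ?C" "?T a = 0" for a
  proof
    fix j
    have "a j = 0" if "j < s"
    proof (rule centraliser_map_inj[OF S K(1,2) indb bS c _ _ that])
      show "a j \<in> ?C" if "j < s" for j using a(1) that by (simp add: power_space_def)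
      show "(\<Sum>j<s. a j * c i * b j) = 0" if "i < r" for i
        using fun_cong[OF a(2), of i] that by simp
    qed
    moreover have "a j = 0" if "\<not> j < s" using that a(1) by (simp add: power_space_def)
    ultimately show "a j = 0 j" by (cases "j < s") simp_all
  qed
  have surj: "?T ` power_space s ?C = power_space r S"
  proof (rule equalityI, rule two_sided_map_into[OF alg CS cS bS], assumption, assumption, rule subsetI)
    fix y assume y: "y \<in> power_space r S"
    have yS: "y i \<in> S" if "i < r" for i using y that by (simp add: power_space_def)
    define \<kappa> where "\<kappa> x = (SOME k. (\<forall>i<r. k i \<in> K) \<and> x = (\<Sum>i<r. k i * c i))" for x
    have \<kappa>: "(\<forall>i<r. \<kappa> x i \<in> K) \<and> x = (\<Sum>i<r. \<kappa> x i * c i)" if "x \<in> S" for x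
      unfolding \<kappa>_def by (rule someI_ex[OF basis_over_coords[OF c that]])
    have \<kappa>K: "\<kappa> x i \<in> K" if "x \<in> S" "i < r" for x i using \<kappa>[OF that(1)] that(2) by blast
    have uniq: "k i = \<kappa> x i" if "x \<in> S" "\<And>i. i < r \<Longrightarrow> k i \<in> K" "(\<Sum>i<r. k i * c i) = x" "i < r" for x k i
    proof (rule indep_overD2[OF KA(1) indc that(2) \<kappa>K[OF that(1)] _ that(4)])
      show "(\<Sum>i<r. k i * c i) = (\<Sum>i<r. \<kappa> x i * c i)" using \<kappa>[OF that(1)] that(3) by simp
    qed
    define f where "f x = (\<Sum>i<r. \<kappa> x i * y i)" for x
    have fadd: "f (x + x') = f x + f x'" if x: "x \<in> S" "x' \<in> S" for x x'
    proof -
      have "\<kappa> x i + \<kappa> x' i = \<kappa> (x + x') i" if "i < r" for i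
      proof (rule uniq[OF A(7)[OF x] _ _ that])
        show "\<kappa> x i + \<kappa> x' i \<in> K" if "i < r" for i using KA(7) \<kappa>K x that by blast
        show "(\<Sum>i<r. (\<kappa> x i + \<kappa> x' i) * c i) = x + x'"
          using \<kappa>[OF x(1)] \<kappa>[OF x(2)] by (simp add: distrib_right sum.distrib)
      qed
      thus ?thesis unfolding f_def sum.distrib[symmetric] distrib_right[symmetric]
        by (intro sum.cong) simp_all
    qed
    have fK: "f (k * x) = k * f x" if k: "k \<in> K" and x: "x \<in> S" for k x
    proof -
      have kS: "k * x \<in> S" using A(2) k x K(2) by blast
      have "k * \<kappa> x i = \<kappa> (k * x) i" if "i < r" for i
      proof (rule uniq[OF kS _ _ that])
        show "k * \<kappa> x i \<in> K" if "i < r" for i using KA(2) \<kappa>K x k that by blast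
        have "(\<Sum>i<r. k * \<kappa> x i * c i) = k * (\<Sum>i<r. \<kappa> x i * c i)"
          unfolding sum_distrib_left by (simp only: mult.assoc)
        thus "(\<Sum>i<r. k * \<kappa> x i * c i) = k * x" using \<kappa>[OF x] by simp
      qed
      thus ?thesis unfolding f_def sum_distrib_left
        by (intro sum.cong) (simp_all add: mult.assoc[symmetric])
    qed
    have fS: "f x \<in> S" if "x \<in> S" for x
      unfolding f_def
    proof (rule subspace_sum[OF A(1)])
      fix i assume "i \<in> {..<r}"
      thus "\<kappa> x i * y i \<in> S" using A(2) subsetD[OF K(2) \<kappa>K[OF that]] yS by simp
    qed
    have fZ: "f (z * x) = z * f x" if "z \<in> centre S" "x \<in> S" for z x using fK that K(3) by blast
    obtain a where a: "\<forall>j<s. a j \<in> S" "\<forall>x\<in>S. f x = (\<Sum>j<s. a j * x * b j)"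
      using centre_linear_two_sided[OF S b fadd fZ fS] by blast
    have aC: "a j \<in> ?C" if j: "j < s" for j
    proof (rule centraliserI)
      show "a j \<in> S" using a(1) j by blast
      fix k assume k: "k \<in> K"
      hence kS: "k \<in> S" using K(2) by blast
      have "k * a j - a j * k = 0"
      proof (rule two_sided_independent[OF S indb bS _ _ j])
        show "k * a j - a j * k \<in> S" if "j < s" for j using a(1) that A(2,8) kS by simp
        fix x assume x: "x \<in> S"
        have "(\<Sum>j<s. (k * a j - a j * k) * x * b j) = k * (\<Sum>j<s. a j * x * b j) - (\<Sum>j<s. a j * (k * x) * b j)"
          unfolding sum_distrib_left sum_subtractf[symmetric] by (simp only: mult.assoc left_diff_distrib)
        also have "\<dots> = k * f x - f (k * x)" using a(2) x A(2)[OF kS x] by simp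
        finally show "(\<Sum>j<s. (k * a j - a j * k) * x * b j) = 0" using fK[OF k x] by simp
      qed
      thus "k * a j = a j * k" by simp
    qed
    define a' where "a' j = (if j < s then a j else 0)" for j
    have a': "a' \<in> power_space s ?C" using aC by (simp add: power_space_def a'_def)
    have "y i = ?T a' i" for i
    proof (cases "i < r")
      case True
      have "(if l = i then u else 0) = \<kappa> (c i) l" if "l < r" for l
      proof (rule uniq[OF cS[OF True] _ _ that])
        show "(if l = i then u else 0) \<in> K" if "l < r" for l using KA(3,6) by simp
        have "(\<Sum>l<r. (if l = i then u else 0) * c l) = (\<Sum>l<r. if l = i then c l else 0)"
          using A(4) cS by (intro sum.cong) simp_all
        thus "(\<Sum>l<r. (if l = i then u else 0) * c l) = c i" using True by simp
      qed
      hence "f (c i) = (\<Sum>l<r. (if l = i then u else 0) * y l)" unfolding f_def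
        by (intro sum.cong) simp_all
      also have "\<dots> = (\<Sum>l<r. if l = i then y l else 0)"
        using A(4) yS by (intro sum.cong) simp_all
      also have "\<dots> = y i" using True by simp
      finally have "y i = (\<Sum>j<s. a j * c i * b j)" using a(2) cS[OF True] by simp
      thus ?thesis using True by (simp add: a'_def)
    next
      case False thus ?thesis using y by (simp add: power_space_def)
    qed
    thus "y \<in> ?T ` power_space s ?C" using a' by (intro image_eqI[of _ _ a']) (simp_all add: fun_eq_iff)
  qed
  have "s * dim ?C = r * dim S"
    by (rule power_space_map[OF two_sided_map_linear subspace_centraliser[OF A(1)] A(1)
          two_sided_map_into[OF alg CS cS bS] inj, THEN iffD2, OF _ _ _ _ surj]) simp_all
  moreover have dS: "dim S = s * dim (centre S)" by (rule basis_over_dim[OF ZA(1) b])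
  moreover have "dim S = r * dim K" by (rule basis_over_dim[OF KA(1) c])
  ultimately have "s * (dim ?C * dim K) = s * (dim (centre S) * dim S)"
    by (metis mult.assoc mult.commute)
  moreover have "dim S \<noteq> 0" using dim_zero_iff[OF A(1)] A(3) simple_algD(2)[OF S] by blast
  hence "s \<noteq> 0" unfolding dS by (rule contrapos_nn) (simp only: mult_0)
  ultimately show ?thesis by (simp only: mult_cancel1 simp_thms)
qed

end

section \<open>Free modules\<close>

context fd_algebra
begin

lemma left_basis_if_basis_over:
  assumes K: "algebra_on K e" "e \<noteq> 0" and e: "\<And>v. v \<in> V \<Longrightarrow> e * v = v" and b: "basis_over K V r b"
  shows "left_basis K V (b ` {..<r})" "card (b ` {..<r}) = r"
proof -
  note KA = algebra_onD[OF K(1)]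
  have bV: "b i \<in> V" if "i < r" for i using b that unfolding basis_over_def by blast
  have ind: "indep_over K r b" using b unfolding basis_over_def by blast
  have inj: "inj_on b {..<r}"
  proof (rule inj_onI, rule ccontr)
    fix i j assume ij: "i \<in> {..<r}" "j \<in> {..<r}" "b i = b j" "i \<noteq> j"
    let ?c = "\<lambda>l. if l = i then e else if l = j then - e else 0"
    have "(\<Sum>l<r. ?c l * b l) = (\<Sum>l<r. (if l = i then e * b i else 0) + (if l = j then - (e * b j) else 0))"
      using ij(4) by (intro sum.cong) auto
    also have "\<dots> = 0" unfolding sum.distrib using ij by simp
    finally have "?c i = 0" using ij(1) KA(3,6,9) indep_overD[OF ind, of ?c i] by auto
    thus False using K(2) by simp
  qed
  show "card (b ` {..<r}) = r" using card_image[OF inj] by simp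
  have sum_eq: "(\<Sum>v\<in>b ` {..<r}. f v * v) = (\<Sum>i<r. f (b i) * b i)" for f
    by (simp add: sum.reindex[OF inj])
  show "left_basis K V (b ` {..<r})"
    unfolding left_basis_def
  proof (intro conjI ballI)
    show "finite (b ` {..<r})" "b ` {..<r} \<subseteq> V" using bV by auto
    fix x assume "x \<in> V"
    then obtain c where c: "\<forall>i<r. c i \<in> K" "x = (\<Sum>i<r. c i * b i)" using basis_over_coords[OF b] by blast
    define f where "f = restrict (\<lambda>v. c (inv_into {..<r} b v)) (b ` {..<r})"
    have fb: "f (b i) = c i" if "i < r" for i
      using that inv_into_f_f[OF inj, of i] by (simp add: f_def)
    show "\<exists>!f. f \<in> (\<Pi>\<^sub>E v\<in>b ` {..<r}. K) \<and> x = (\<Sum>v\<in>b ` {..<r}. f v * v)"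
    proof (rule ex1I[of _ f])
      have "f \<in> (\<Pi>\<^sub>E v\<in>b ` {..<r}. K)"
        using fb c(1) by (intro PiE_I) (auto simp: f_def)
      moreover have "x = (\<Sum>i<r. f (b i) * b i)" unfolding c(2) using fb by (intro sum.cong) simp_all
      ultimately show "f \<in> (\<Pi>\<^sub>E v\<in>b ` {..<r}. K) \<and> x = (\<Sum>v\<in>b ` {..<r}. f v * v)"
        unfolding sum_eq by blast
      fix g assume g: "g \<in> (\<Pi>\<^sub>E v\<in>b ` {..<r}. K) \<and> x = (\<Sum>v\<in>b ` {..<r}. g v * v)"
      have gb: "g (b i) = c i" if "i < r" for i
      proof (rule indep_overD2[OF KA(1) ind _ _ _ that])
        show "g (b i) \<in> K" if "i < r" for i using g that by (auto simp: PiE_def Pi_def)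
        show "c i \<in> K" if "i < r" for i using c(1) that by blast
        show "(\<Sum>i<r. g (b i) * b i) = (\<Sum>i<r. c i * b i)" using g c(2) unfolding sum_eq by simp
      qed
      show "g = f"
      proof (rule PiE_ext)
        show "g \<in> (\<Pi>\<^sub>E v\<in>b ` {..<r}. K)" using g by blast
        show "f \<in> (\<Pi>\<^sub>E v\<in>b ` {..<r}. K)" by fact
        show "g v = f v" if "v \<in> b ` {..<r}" for v using that gb fb by auto
      qed
    qed
  qed
qed

lemma basis_over_if_left_basis:
  assumes K: "subspace K" and V: "subspace V" and KV: "\<And>k v. k \<in> K \<Longrightarrow> v \<in> V \<Longrightarrow> k * v \<in> V"
    and B: "left_basis K V B"
  shows "\<exists>b. basis_over K V (card B) b"
proof -
  have fin: "finite B" and BV: "B \<subseteq> V"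
    and ex1: "\<And>x. x \<in> V \<Longrightarrow> \<exists>!f. f \<in> (\<Pi>\<^sub>E b\<in>B. K) \<and> x = (\<Sum>b\<in>B. f b * b)"
    using B unfolding left_basis_def by blast+
  obtain b where b: "bij_betw b {..<card B} B"
    using ex_bij_betw_nat_finite[OF fin] atLeast0LessThan by metis
  have bB: "b i \<in> B" if "i < card B" for i using b that by (auto simp: bij_betw_def)
  have sum_eq: "(\<Sum>v\<in>B. f v * v) = (\<Sum>i<card B. f (b i) * b i)" for f
    using sum.reindex_bij_betw[OF b, of "\<lambda>v. f v * v"] by simp
  have "indep_over K (card B) b"
    unfolding indep_over_def
  proof (intro allI impI; elim conjE)
    fix c i assume c: "\<forall>i<card B. c i \<in> K" "(\<Sum>i<card B. c i * b i) = 0" and i: "i < card B"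
    define f where "f = restrict (\<lambda>v. c (inv_into {..<card B} b v)) B"
    have fb: "f (b i) = c i" if "i < card B" for i
      using that b bB[OF that] inv_into_f_f[of b "{..<card B}" i] by (simp add: f_def bij_betw_def)
    have "f \<in> (\<Pi>\<^sub>E b\<in>B. K)"
    proof (rule PiE_I)
      fix v assume "v \<in> B"
      then obtain i where "i < card B" "v = b i" using b by (auto simp: bij_betw_def)
      thus "f v \<in> K" using fb c(1) by simp
    qed (simp add: f_def)
    moreover have "0 = (\<Sum>v\<in>B. f v * v)"
    proof -
      have "(\<Sum>i<card B. f (b i) * b i) = (\<Sum>i<card B. c i * b i)" using fb by (intro sum.cong) simp_all
      thus ?thesis unfolding sum_eq using c(2) by simp
    qed
    moreover have "restrict (\<lambda>_. 0) B \<in> (\<Pi>\<^sub>E b\<in>B. K)" "0 = (\<Sum>v\<in>B. restrict (\<lambda>_. 0) B v * v)"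
      using subspace_0[OF K] by auto
    ultimately have "f = restrict (\<lambda>_. 0) B" using ex1[OF subspace_0[OF V]] by blast
    hence "f (b i) = 0" using bB[OF i] by simp
    thus "c i = 0" using fb[OF i] by simp
  qed
  moreover have "span_over K (card B) b = V"
  proof
    show "V \<subseteq> span_over K (card B) b"
    proof
      fix x assume "x \<in> V"
      then obtain f where f: "f \<in> (\<Pi>\<^sub>E b\<in>B. K)" "x = (\<Sum>b\<in>B. f b * b)" using ex1 by blast
      show "x \<in> span_over K (card B) b"
        by (rule span_overI[of _ "\<lambda>i. f (b i)"]) (use f bB sum_eq in auto)
    qed
    show "span_over K (card B) b \<subseteq> V"
    proof
      fix x assume "x \<in> span_over K (card B) b"
      then obtain c where c: "\<forall>i<card B. c i \<in> K" "x = (\<Sum>i<card B. c i * b i)"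
        unfolding span_over_def by blast
      have "c i * b i \<in> V" if "i < card B" for i using c(1) KV bB[OF that] BV that by blast
      thus "x \<in> V" unfolding c(2) by (intro subspace_sum[OF V]) simp
    qed
  qed
  ultimately show ?thesis unfolding basis_over_def using bB BV by (intro exI[of _ b]) auto
qed

lemma dim_over_field:
  assumes K: "field_on K e" and V: "subspace V" and KV: "\<And>k v. k \<in> K \<Longrightarrow> v \<in> V \<Longrightarrow> k * v \<in> V"
    and e: "\<And>v. v \<in> V \<Longrightarrow> e * v = v"
  shows "dim_over K V * dim K = dim V"
proof -
  note KA = algebra_onD[OF field_onD(1)[OF K]]
  have card: "card B * dim K = dim V" if "left_basis K V B" for B
    using basis_over_if_left_basis[OF KA(1) V KV that] basis_over_dim[OF KA(1)] by metis
  obtain r b where b: "basis_over K V r b" using basis_over_exists[OF K V KV e] by blast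
  have ex: "\<exists>B. left_basis K V B \<and> card B = r"
    using left_basis_if_basis_over[OF field_onD(1,2)[OF K] e b] by blast
  have "dim_over K V = r" unfolding dim_over_def
  proof (rule the_equality)
    show "\<exists>B. left_basis K V B \<and> card B = r" by fact
    fix n assume "\<exists>B. left_basis K V B \<and> card B = n"
    hence "n * dim K = r * dim K" using card ex by metis
    thus "n = r" using field_dim_pos[OF K] by (metis mult_cancel2 neq0_conv)
  qed
  thus ?thesis using basis_over_dim[OF KA(1) b] by simp
qed

text \<open>
  A product \<open>L\<close> of fields \<open>e\<^sub>iL\<close> acts on \<open>S\<close> with \<open>S = \<Sum> e\<^sub>iS\<close>; bases of the \<open>e\<^sub>iS\<close> of equal
  length \<open>r\<close> add up to an \<open>L\<close>-basis.
\<close>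

lemma free_if_equal_ranks:
  assumes S: "algebra_on S u" and L: "algebra_on L u" "L \<subseteq> S" "u \<noteq> 0"
    and comm: "\<And>x y. x \<in> L \<Longrightarrow> y \<in> L \<Longrightarrow> x * y = y * x"
    and fin: "finite I" and e: "\<And>i. i \<in> I \<Longrightarrow> e i \<in> L" "\<And>i. i \<in> I \<Longrightarrow> e i * e i = e i"
    and orth: "\<And>i j. i \<in> I \<Longrightarrow> j \<in> I \<Longrightarrow> i \<noteq> j \<Longrightarrow> e i * e j = 0"
    and sum: "sum e I = u"
    and field: "\<And>i. i \<in> I \<Longrightarrow> field_on (corner L (e i)) (e i)"
    and rank: "\<And>i. i \<in> I \<Longrightarrow> dim (peirce S (e i) u) = r * dim (corner L (e i))"
  shows "free_left_module L S"
proof -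
  note A = algebra_onD[OF S]
  note LA = algebra_onD[OF L(1)]
  have eS: "e i \<in> S" if "i \<in> I" for i using e(1)[OF that] L(2) by blast
  have corn: "corner L (e i) = peirce L (e i) (e i)" if "i \<in> I" for i
    by (rule corner_eq_peirce[OF L(1) e(1,2)]) (use that in simp_all)
  have "\<exists>b. basis_over (corner L (e i)) (peirce S (e i) u) r b" if i: "i \<in> I" for i
  proof -
    note K = field[OF i]
    note V = subspace_peirce[OF A(1), of "e i" u]
    have "\<exists>r b. basis_over (corner L (e i)) (peirce S (e i) u) r b"
    proof (rule basis_over_exists[OF K V])
      fix k v assume "k \<in> corner L (e i)" and v: "v \<in> peirce S (e i) u"
      hence "k \<in> peirce S (e i) (e i)" unfolding corn[OF i] using L(2) by (auto simp: peirce_def)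
      thus "k * v \<in> peirce S (e i) u" using peirce_mult[OF S] v by blast
    qed (rule peirceE(2))
    then obtain r' b where b: "basis_over (corner L (e i)) (peirce S (e i) u) r' b" by blast
    have "r' * dim (corner L (e i)) = r * dim (corner L (e i))"
      by (rule trans[OF basis_over_dim[OF algebra_onD(1)[OF field_onD(1)[OF K]] b, symmetric] rank[OF i]])
    hence "r' = r" using field_dim_pos[OF K] by (metis mult_cancel2 neq0_conv)
    thus ?thesis using b by blast
  qed
  then obtain b where b: "\<And>i. i \<in> I \<Longrightarrow> basis_over (corner L (e i)) (peirce S (e i) u) r (b i)" by metis
  have bV: "b i s \<in> S" "e i * b i s = b i s" if "i \<in> I" "s < r" for i s
    using b[OF that(1)] that(2) peirceE(1,2) unfolding basis_over_def by blast+
  have decomp: "x = (\<Sum>i\<in>I. e i * x)" if "x \<in> S" for x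
    unfolding sum_distrib_right[symmetric] sum using A(4)[OF that] by simp
  define \<beta> where "\<beta> s = (\<Sum>i\<in>I. b i s)" for s
  have e\<beta>: "e i * \<beta> s = b i s" if i: "i \<in> I" and s: "s < r" for i s
  proof -
    have "e i * \<beta> s = (\<Sum>j\<in>I. e i * (e j * b j s))"
      unfolding \<beta>_def sum_distrib_left using bV(2)[OF _ s] by (intro sum.cong) simp_all
    also have "\<dots> = (\<Sum>j\<in>I. if j = i then b i s else 0)"
      using orth[OF i] e(2)[OF i] bV(2)[OF i s] by (intro sum.cong) (auto simp: mult.assoc[symmetric])
    finally show ?thesis using i fin by simp
  qed
  have cK: "c * e i \<in> corner L (e i)" if c: "c \<in> L" and i: "i \<in> I" for c i
  proof -
    have "e i * c * e i = c * (e i * e i)" using comm[OF e(1)[OF i] c] by (simp only: mult.assoc)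
    thus ?thesis unfolding corner_def using e(2)[OF i] c by (intro CollectI exI[of _ c]) simp
  qed
  have ebas: "e i * (\<Sum>s<r. c s * \<beta> s) = (\<Sum>s<r. c s * e i * b i s)"
    if c: "\<And>s. s < r \<Longrightarrow> c s \<in> L" and i: "i \<in> I" for c i
    unfolding sum_distrib_left
  proof (intro sum.cong refl)
    fix s assume "s \<in> {..<r}"
    hence s: "s < r" by simp
    have "e i * (c s * \<beta> s) = c s * (e i * \<beta> s)"
      using comm[OF e(1)[OF i] c[OF s]] by (simp only: mult.assoc[symmetric])
    also have "\<dots> = c s * (e i * b i s)" using e\<beta>[OF i s] bV(2)[OF i s] by simp
    finally show "e i * (c s * \<beta> s) = c s * e i * b i s" by (simp only: mult.assoc)
  qed
  have "basis_over L S r \<beta>"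
    unfolding basis_over_def
  proof (intro conjI allI impI)
    show "\<beta> s \<in> S" if "s < r" for s
      unfolding \<beta>_def using bV(1) that by (intro subspace_sum[OF A(1)]) blast
    show "indep_over L r \<beta>"
      unfolding indep_over_def
    proof (intro allI impI; elim conjE)
      fix c s assume c: "\<forall>s<r. c s \<in> L" "(\<Sum>s<r. c s * \<beta> s) = 0" and s: "s < r"
      have "c s * e i = 0" if i: "i \<in> I" for i
      proof (rule indep_overD[of "corner L (e i)" r "b i" "\<lambda>s. c s * e i"])
        show "indep_over (corner L (e i)) r (b i)" using b[OF i] unfolding basis_over_def by blast
        show "c s * e i \<in> corner L (e i)" if "s < r" for s using cK[OF _ i] c(1) that by blast
        show "(\<Sum>s<r. c s * e i * b i s) = 0" using ebas[of c i] c i by simp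
      qed (rule s)
      hence "c s * (\<Sum>i\<in>I. e i) = 0" unfolding sum_distrib_left by simp
      thus "c s = 0" using sum LA(5) c(1) s by simp
    qed
    show "span_over L r \<beta> = S"
    proof
      show "span_over L r \<beta> \<subseteq> S"
      proof
        fix x assume "x \<in> span_over L r \<beta>"
        then obtain c where c: "\<forall>i<r. c i \<in> L" "x = (\<Sum>i<r. c i * \<beta> i)"
          unfolding span_over_def by blast
        show "x \<in> S" unfolding c(2)
        proof (rule subspace_sum[OF A(1)])
          fix s assume "s \<in> {..<r}"
          moreover have "\<beta> s \<in> S" if "s < r" for s
            unfolding \<beta>_def using bV(1) that by (intro subspace_sum[OF A(1)]) blast
          ultimately show "c s * \<beta> s \<in> S" using c(1) L(2) A(2) by (simp add: subset_iff)
        qed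
      qed
      show "S \<subseteq> span_over L r \<beta>"
      proof
        fix x assume x: "x \<in> S"
        have "\<exists>k. (\<forall>s<r. k s \<in> corner L (e i)) \<and> e i * x = (\<Sum>s<r. k s * b i s)" if i: "i \<in> I" for i
        proof (rule basis_over_coords[OF b[OF i]])
          show "e i * x \<in> peirce S (e i) u"
            using peirceI[OF S eS[OF i] A(3) e(2)[OF i] A(4)[OF A(3)] x] A(5)[OF A(2)[OF eS[OF i] x]] by simp
        qed
        then obtain k where k: "\<And>i. i \<in> I \<Longrightarrow> (\<forall>s<r. k i s \<in> corner L (e i)) \<and> e i * x = (\<Sum>s<r. k i s * b i s)"
          by metis
        have kL: "k i s \<in> L" "k i s * e i = k i s" "e i * k i s = k i s" if "i \<in> I" "s < r" for i s
          using k[OF that(1)] that(2) corn[OF that(1)] by (auto simp: peirce_def)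
        define c where "c s = (\<Sum>i\<in>I. k i s)" for s
        have cL: "c s \<in> L" if "s < r" for s
          unfolding c_def using kL(1) that by (intro subspace_sum[OF LA(1)]) blast
        have ce: "c s * e i = k i s" if i: "i \<in> I" and s: "s < r" for i s
        proof -
          have "c s * e i = (\<Sum>j\<in>I. k j s * (e j * e i))"
            unfolding c_def sum_distrib_right using kL(2)[OF _ s] by (intro sum.cong) (simp_all add: mult.assoc[symmetric])
          also have "\<dots> = (\<Sum>j\<in>I. if j = i then k i s else 0)"
            using orth[OF _ i] e(2)[OF i] kL(2)[OF i s] by (intro sum.cong) auto
          finally show ?thesis using i fin by simp
        qed
        have "(\<Sum>s<r. c s * \<beta> s) \<in> S"
        proof (rule subspace_sum[OF A(1)])
          fix s assume "s \<in> {..<r}"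
          moreover have "\<beta> s \<in> S" if "s < r" for s
            unfolding \<beta>_def using bV(1) that by (intro subspace_sum[OF A(1)]) blast
          ultimately show "c s * \<beta> s \<in> S" using cL L(2) A(2) by (simp add: subset_iff)
        qed
        moreover have "e i * (\<Sum>s<r. c s * \<beta> s) = e i * x" if i: "i \<in> I" for i
          using ebas[OF cL i] k[OF i] ce[OF i] by simp
        ultimately have "(\<Sum>s<r. c s * \<beta> s) = x"
          using decomp[OF x] decomp[of "\<Sum>s<r. c s * \<beta> s"] by simp
        thus "x \<in> span_over L r \<beta>" using cL by (intro span_overI[of r c]) simp_all
      qed
    qed
  qed
  thus ?thesis unfolding free_left_module_def
    using left_basis_if_basis_over(1)[OF L(1,3)] A(4) by blast
qed

section \<open>Maximal products of fields in a simple algebra\<close>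

text \<open>
  The centraliser \<open>C\<close> of \<open>K\<close> contains \<open>K\<close>, so it is a \<open>K\<close>-space of some dimension \<open>m \<ge> 1\<close>; now apply
  the double centraliser formula.
\<close>

lemma subfield_dim:
  assumes S: "simple_alg S u" and K: "field_on K u" "K \<subseteq> S" "centre S \<subseteq> K"
  obtains m where "m \<ge> 1" "dim (centre S) * dim S = m * (dim K)\<^sup>2" "m = 1 \<longrightarrow> centraliser S K = K"
proof -
  note alg = simple_algD(1)[OF S]
  note A = algebra_onD[OF alg]
  note KA = algebra_onD[OF field_onD(1)[OF K(1)]]
  let ?C = "centraliser S K"
  note sC = subspace_centraliser[OF A(1), of K]
  have KC: "K \<subseteq> ?C"
  proof
    fix x assume x: "x \<in> K"
    show "x \<in> ?C" by (rule centraliserI) (use x K(2) field_onD(3)[OF K(1) _ x] in blast)+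
  qed
  have "\<exists>m b. basis_over K ?C m b"
  proof (rule basis_over_exists[OF K(1) sC])
    fix k v assume k: "k \<in> K" and v: "v \<in> ?C"
    show "k * v \<in> ?C"
    proof (rule centraliserI)
      show "k * v \<in> S" using A(2) K(2) k centraliserD(1)[OF v] by blast
      fix l assume l: "l \<in> K"
      have "l * (k * v) = k * (l * v)" using field_onD(3)[OF K(1) l k] by (simp only: mult.assoc[symmetric])
      also have "\<dots> = k * v * l" using centraliserD(2)[OF v l] by (simp only: mult.assoc)
      finally show "l * (k * v) = k * v * l" .
    qed
  qed (use A(4) centraliserD(1) in blast)
  then obtain m b where b: "basis_over K ?C m b" by blast
  have dC: "dim ?C = m * dim K" using basis_over_dim[OF KA(1) b] .
  have "dim K \<le> dim ?C" using dim_subset[OF KC] .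
  hence "m \<noteq> 0" using dC field_dim_pos[OF K(1)] by (metis mult_0 not_le)
  moreover have "dim (centre S) * dim S = m * (dim K)\<^sup>2"
    using double_centraliser_dim[OF S K] unfolding dC by (simp only: power2_eq_square mult.assoc)
  moreover have "?C = K" if "m = 1"
    using eq_of_dim_eq[OF KA(1) sC KC] dC that by simp
  ultimately show ?thesis using that[of m] by simp
qed

lemma centre_corner_simple:
  assumes S: "simple_alg S u" and f: "f \<in> S" "f * f = f" "f \<noteq> 0"
  shows "centre (corner S f) = (\<lambda>z. f * z) ` centre S" "dim (centre (corner S f)) = dim (centre S)"
proof -
  note alg = simple_algD(1)[OF S]
  show *: "centre (corner S f) = (\<lambda>z. f * z) ` centre S"
    by (rule centre_corner[OF alg f(1,2) simple_full[OF S f(3)]])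
  have "inj_on (\<lambda>z. f * z) (centre S)"
    by (rule inj_onI_lin[OF lin_mult_left subspace_centre[OF algebra_onD(1)[OF alg]]])
      (rule full_mult_eq_0[OF alg f(1) simple_full[OF S f(3)]])
  thus "dim (centre (corner S f)) = dim (centre S)"
    unfolding * by (rule dim_image_inj[OF lin_mult_left subspace_centre[OF algebra_onD(1)[OF alg]]])
qed

lemma subfield_corner_dim:
  assumes S: "simple_alg S u" and f: "f \<in> S" "f * f = f"
    and K: "field_on K f" "K \<subseteq> S" "\<And>z. z \<in> centre S \<Longrightarrow> f * z \<in> K"
  obtains m where "m \<ge> 1" "dim (centre S) * dim (corner S f) = m * (dim K)\<^sup>2"
    "m = 1 \<longrightarrow> centraliser (corner S f) K = K"
proof -
  note alg = simple_algD(1)[OF S]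
  have f0: "f \<noteq> 0" by (rule field_onD(2)[OF K(1)])
  note c = centre_corner_simple[OF S f f0]
  have "K \<subseteq> corner S f" unfolding corner_eq_peirce[OF alg f] peirce_def
    using K(2) algebra_onD(4,5)[OF field_onD(1)[OF K(1)]] by blast
  moreover have "centre (corner S f) \<subseteq> K" unfolding c(1) using K(3) by blast
  ultimately show ?thesis
    using subfield_dim[OF simple_corner[OF S f f0] K(1)] that c(2) by metis
qed

text \<open>
  The numbers \<open>sqrt (dim f\<^sub>iSf\<^sub>i)\<close> add up to \<open>sqrt (dim S)\<close>, so lower bounds for them which add up
  to \<open>sqrt (dim S)\<close> as well are attained.
\<close>

lemma bounds_attained:
  assumes S: "simple_alg S u" and fin: "finite I"
    and f: "\<And>i. i \<in> I \<Longrightarrow> f i \<in> S" "\<And>i. i \<in> I \<Longrightarrow> f i * f i = f i"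
    and orth: "\<And>i j. i \<in> I \<Longrightarrow> j \<in> I \<Longrightarrow> i \<noteq> j \<Longrightarrow> f i * f j = 0"
    and sum: "sum f I = u"
    and bound: "\<And>i. i \<in> I \<Longrightarrow> (k i)\<^sup>2 \<le> dim (centre S) * dim (corner S (f i))"
    and total: "(\<Sum>i\<in>I. k i)\<^sup>2 = dim (centre S) * dim S"
    and i: "i \<in> I"
  shows "dim (centre S) * dim (corner S (f i)) = (k i)\<^sup>2
    \<and> dim (centre S) * dim (peirce S (f i) u) = k i * (\<Sum>j\<in>I. k j)
    \<and> dim (centre S) * dim (peirce S u (f i)) = k i * (\<Sum>j\<in>I. k j)"
proof -
  note alg = simple_algD(1)[OF S]
  note A = algebra_onD[OF alg]
  let ?z = "dim (centre S)"
  have uu: "u * u = u" using A(3,4) by blast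
  have cu: "corner S u = S" using corner_eq_peirce[OF alg A(3) uu] A(4,5) by (auto simp: peirce_def)
  have le: "real (k j) \<le> sqrt (real (?z * dim (corner S (f j))))" if "j \<in> I" for j
  proof -
    have "real ((k j)\<^sup>2) \<le> real (?z * dim (corner S (f j)))" using bound[OF that] by (simp only: of_nat_le_iff)
    thus ?thesis by (intro real_le_rsqrt) (simp only: of_nat_power)
  qed
  have sqrtS: "sqrt (real (dim S)) = (\<Sum>j\<in>I. sqrt (real (dim (corner S (f j)))))"
    by (rule sqrt_dim_corner_sum[OF S fin f orth sum]) simp_all
  have "(\<Sum>j\<in>I. real (k j)) = sqrt (real ((\<Sum>j\<in>I. k j)\<^sup>2))"
    by (simp only: of_nat_power real_sqrt_abs of_nat_sum abs_of_nonneg sum_nonneg of_nat_0_le_iff)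
  also have "\<dots> = sqrt (real ?z) * sqrt (real (dim S))" unfolding total by (simp only: of_nat_mult real_sqrt_mult)
  also have "\<dots> = (\<Sum>j\<in>I. sqrt (real (?z * dim (corner S (f j)))))"
    by (simp only: sqrtS sum_distrib_left of_nat_mult real_sqrt_mult)
  finally have "(\<Sum>j\<in>I. real (k j)) = (\<Sum>j\<in>I. sqrt (real (?z * dim (corner S (f j)))))" .
  hence "real (k i) = sqrt (real (?z * dim (corner S (f i))))"
    by (rule sum_mono_inv[OF _ le i fin])
  hence "(real (k i))\<^sup>2 = real (?z * dim (corner S (f i)))" by (simp only: real_sqrt_pow2 of_nat_0_le_iff)
  hence "real ((k i)\<^sup>2) = real (?z * dim (corner S (f i)))" by (simp only: of_nat_power)
  hence c: "?z * dim (corner S (f i)) = (k i)\<^sup>2" by (simp only: of_nat_eq_iff)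
  have sq: "?z * d = k i * (\<Sum>j\<in>I. k j)" if "d\<^sup>2 = dim (corner S (f i)) * dim S" for d
  proof -
    have "(?z * d)\<^sup>2 = (?z * dim (corner S (f i))) * (?z * dim S)"
      using that by (simp only: power_mult_distrib power2_eq_square mult.assoc mult.left_commute)
    also have "\<dots> = (k i * (\<Sum>j\<in>I. k j))\<^sup>2" unfolding c total[symmetric] by (simp only: power_mult_distrib)
    finally show ?thesis by (simp only: power2_eq_iff_nonneg zero_le)
  qed
  have "?z * dim (peirce S (f i) u) = k i * (\<Sum>j\<in>I. k j)"
    by (rule sq) (use peirce_dim_square[OF S f[OF i] A(3) uu] cu in simp)
  moreover have "?z * dim (peirce S u (f i)) = k i * (\<Sum>j\<in>I. k j)"
    by (rule sq) (use peirce_dim_square[OF S A(3) uu f[OF i]] cu in \<open>simp add: mult.commute\<close>)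
  ultimately show ?thesis using c by blast
qed

end

section \<open>Inheritance of the type by corners\<close>

locale fd_involution = fd_algebra scale Basis
  for scale :: "'f::field \<Rightarrow> 'a::ring_1 \<Rightarrow> 'a" (infixr \<open>*s\<close> 75) and Basis +
  fixes \<sigma> :: "'a \<Rightarrow> 'a"
  assumes inv_add: "\<sigma> (x + y) = \<sigma> x + \<sigma> y" and inv_mult: "\<sigma> (x * y) = \<sigma> y * \<sigma> x"
    and inv_scale: "\<sigma> (c *s x) = c *s \<sigma> x" and inv_inv [simp]: "\<sigma> (\<sigma> x) = x"
begin

lemma lin_inv: "lin \<sigma>"
  by (rule linI) (rule inv_add inv_scale)+

lemma inv_0 [simp]: "\<sigma> 0 = 0"
  and inv_minus: "\<sigma> (- x) = - \<sigma> x"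
  and inv_diff: "\<sigma> (x - y) = \<sigma> x - \<sigma> y"
  by (rule lin_0[OF lin_inv] lin_minus[OF lin_inv] lin_diff[OF lin_inv])+

lemma subspace_Skew: "subspace V \<Longrightarrow> subspace (Skew V \<sigma>)"
  unfolding subspace_def Skew_def by (simp add: inv_add inv_scale)

lemma subspace_Sym: "subspace V \<Longrightarrow> subspace (Sym V \<sigma>)"
  unfolding subspace_def Sym_def by (simp add: inv_add inv_scale)

lemma Symd_image: "Symd V \<sigma> = (\<lambda>x. x + \<sigma> x) ` V"
  unfolding Symd_def by blast

lemma lin_symmetrise: "lin (\<lambda>x. x + \<sigma> x)"
  by (rule linI) (simp_all add: inv_add inv_scale scale_right_distrib)

lemma subspace_Symd: "subspace V \<Longrightarrow> subspace (Symd V \<sigma>)"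
  unfolding Symd_image by (rule subspace_image_lin[OF lin_symmetrise])

text \<open>
  For symmetric \<open>e\<close> this is the corner \<open>eSe\<close>. It is stable under \<open>\<sigma>\<close> for every idempotent \<open>e\<close>, and
  this allows comparing symmetric idempotents through ones that are not symmetric.
\<close>

definition twisted_corner :: "'a set \<Rightarrow> 'a \<Rightarrow> 'a set" where
  "twisted_corner S e = peirce S e (\<sigma> e)"

text \<open>For symmetric \<open>e\<close>, its positivity is the dimension condition for \<open>eSe\<close> to be symplectic.\<close>

definition type_defect :: "'a set \<Rightarrow> 'a \<Rightarrow> real" where
  "type_defect S e = real (dim (Skew (twisted_corner S e) \<sigma>)) - real (dim (Symd (twisted_corner S e) \<sigma>))"

lemma inv_peirce:
  assumes "\<forall>x\<in>S. \<sigma> x \<in> S" "x \<in> peirce S e f"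
  shows "\<sigma> x \<in> peirce S (\<sigma> f) (\<sigma> e)"
  using assms unfolding peirce_def by (simp add: inv_mult[symmetric])

text \<open>
  The off-diagonal part \<open>M \<oplus> \<sigma>(M)\<close>, where \<open>M = eS\<sigma>(f)\<close>, contributes \<open>dim M\<close> both to the skew
  elements and to the symmetrised ones.
\<close>

lemma dim_orthogonal_decomposition:
  assumes S: "algebra_on S u" and stable: "\<forall>x\<in>S. \<sigma> x \<in> S"
    and ef: "e * f = 0" "f * e = 0"
    and P: "subspace P" "P \<subseteq> twisted_corner S e" and Q: "subspace Q" "Q \<subseteq> twisted_corner S f"
    and \<delta>: "lin \<delta>" "\<And>m. \<delta> m = \<sigma> m \<or> \<delta> m = - \<sigma> m"
  shows "dim {x + n | x n. x \<in> {p + q | p q. p \<in> P \<and> q \<in> Q} \<and> n \<in> (\<lambda>m. m + \<delta> m) ` peirce S e (\<sigma> f)}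
    = dim P + dim Q + dim (peirce S e (\<sigma> f))"
proof -
  note A = algebra_onD[OF S]
  let ?M = "peirce S e (\<sigma> f)"
  note sM = subspace_peirce[OF A(1), of e "\<sigma> f"]
  have \<sigma>ef: "\<sigma> e * \<sigma> f = 0" "\<sigma> f * \<sigma> e = 0" using ef by (simp_all add: inv_mult[symmetric])
  have pD: "e * p = p" "p * \<sigma> f = 0" "f * p = 0" if "p \<in> P" for p
  proof -
    have p: "e * p = p" "p * \<sigma> e = p" using P(2) that unfolding twisted_corner_def peirce_def by blast+
    show "e * p = p" by fact
    have "p * \<sigma> f = p * (\<sigma> e * \<sigma> f)" by (simp only: mult.assoc[symmetric] p(2))
    thus "p * \<sigma> f = 0" using \<sigma>ef by simp
    have "f * p = f * e * p" by (simp only: mult.assoc p(1))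
    thus "f * p = 0" using ef by simp
  qed
  have qD: "f * q = q" "e * q = 0" if "q \<in> Q" for q
  proof -
    show q: "f * q = q" using Q(2) that unfolding twisted_corner_def peirce_def by blast
    have "e * q = e * f * q" by (simp only: mult.assoc q)
    thus "e * q = 0" using ef by simp
  qed
  have mD: "e * m = m" "m * \<sigma> f = m" "e * \<delta> m = 0" if "m \<in> ?M" for m
  proof -
    show m: "e * m = m" "m * \<sigma> f = m" using peirceE[OF that] by blast+
    have "f * \<sigma> m = \<sigma> m" using m(2) by (metis inv_mult inv_inv)
    hence "e * \<sigma> m = e * f * \<sigma> m" by (simp only: mult.assoc)
    hence "e * \<sigma> m = 0" using ef by simp
    thus "e * \<delta> m = 0" using \<delta>(2)[of m] by auto
  qed
  have linN: "lin (\<lambda>m. m + \<delta> m)"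
    by (rule linI) (simp_all add: lin_add[OF \<delta>(1)] lin_scale[OF \<delta>(1)] scale_right_distrib)
  have e_sum: "e * (m + \<delta> m) = m" if "m \<in> ?M" for m
    using mD[OF that] by (simp add: distrib_left)
  have "inj_on (\<lambda>m. m + \<delta> m) ?M"
    by (rule inj_onI) (metis e_sum)
  hence dN: "dim ((\<lambda>m. m + \<delta> m) ` ?M) = dim ?M" by (rule dim_image_inj[OF linN sM])
  have PQ: "P \<inter> Q = {0}"
    using pD(1) qD(2) subspace_0[OF P(1)] subspace_0[OF Q(1)] by fastforce
  have sPQ: "subspace {p + q | p q. p \<in> P \<and> q \<in> Q}" by (rule subspace_sums[OF P(1) Q(1)])
  have sN: "subspace ((\<lambda>m. m + \<delta> m) ` ?M)" by (rule subspace_image_lin[OF linN sM])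
  have "{p + q | p q. p \<in> P \<and> q \<in> Q} \<inter> (\<lambda>m. m + \<delta> m) ` ?M = {0}"
  proof -
    have "x = 0" if x: "x \<in> {p + q | p q. p \<in> P \<and> q \<in> Q}" "x \<in> (\<lambda>m. m + \<delta> m) ` ?M" for x
    proof -
      obtain p q where pq: "p \<in> P" "q \<in> Q" "x = p + q" using x(1) by blast
      obtain m where m: "m \<in> ?M" "x = m + \<delta> m" using x(2) by blast
      have "m = e * x" using e_sum[OF m(1)] m(2) by simp
      also have "\<dots> = p" using pq pD(1) qD(2) by (simp add: distrib_left)
      finally have "m = p" .
      hence "m = 0" using mD(2)[OF m(1)] pD(2)[OF pq(1)] by simp
      thus ?thesis using m(2) lin_0[OF \<delta>(1)] by simp
    qed
    thus ?thesis using subspace_0[OF sPQ] subspace_0[OF sN] by blast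
  qed
  thus ?thesis using dim_direct_sum[OF sPQ sN] dim_direct_sum[OF P(1) Q(1) PQ] dN by simp
qed

lemma twisted_corner_sum:
  assumes S: "algebra_on S u" and stable: "\<forall>x\<in>S. \<sigma> x \<in> S"
    and e: "e \<in> S" "f \<in> S" "e * e = e" "f * f = f" and ef: "e * f = 0" "f * e = 0"
    and x: "x \<in> twisted_corner S (e + f)"
  shows "e * x * \<sigma> e \<in> twisted_corner S e" "f * x * \<sigma> f \<in> twisted_corner S f"
    "e * x * \<sigma> f \<in> peirce S e (\<sigma> f)" "f * x * \<sigma> e \<in> peirce S f (\<sigma> e)"
    "x = e * x * \<sigma> e + f * x * \<sigma> f + e * x * \<sigma> f + f * x * \<sigma> e"
proof -
  have xS: "x \<in> S" "(e + f) * x = x" "x * \<sigma> (e + f) = x"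
    using peirceE[OF x[unfolded twisted_corner_def]] by blast+
  have s: "\<sigma> e \<in> S" "\<sigma> f \<in> S" "\<sigma> e * \<sigma> e = \<sigma> e" "\<sigma> f * \<sigma> f = \<sigma> f"
    using e stable by (simp_all add: inv_mult[symmetric])
  show "e * x * \<sigma> e \<in> twisted_corner S e" "f * x * \<sigma> f \<in> twisted_corner S f"
    "e * x * \<sigma> f \<in> peirce S e (\<sigma> f)" "f * x * \<sigma> e \<in> peirce S f (\<sigma> e)"
    unfolding twisted_corner_def using peirceI[OF S] e s xS(1) by blast+
  have "(e + f) * x * \<sigma> (e + f) = e * x * \<sigma> e + f * x * \<sigma> f + e * x * \<sigma> f + f * x * \<sigma> e"
    by (simp add: inv_add distrib_left distrib_right add_ac)
  thus "x = e * x * \<sigma> e + f * x * \<sigma> f + e * x * \<sigma> f + f * x * \<sigma> e"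
    by (simp only: xS(2,3))
qed

lemma twisted_corner_parts:
  assumes S: "algebra_on S u" and stable: "\<forall>x\<in>S. \<sigma> x \<in> S"
    and e: "e \<in> S" "f \<in> S" "e * e = e" "f * f = f" and ef: "e * f = 0" "f * e = 0"
  shows "twisted_corner S e \<subseteq> twisted_corner S (e + f)" "twisted_corner S f \<subseteq> twisted_corner S (e + f)"
    "peirce S e (\<sigma> f) \<subseteq> twisted_corner S (e + f)"
proof -
  have \<sigma>ef: "\<sigma> e * \<sigma> f = 0" "\<sigma> f * \<sigma> e = 0" using ef by (simp_all add: inv_mult[symmetric])
  have l: "e * x = x \<Longrightarrow> f * x = 0" "f * x = x \<Longrightarrow> e * x = 0" for x
    using ef by (metis mult.assoc mult_zero_left)+
  have r: "x * \<sigma> e = x \<Longrightarrow> x * \<sigma> f = 0" "x * \<sigma> f = x \<Longrightarrow> x * \<sigma> e = 0" for x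
    using \<sigma>ef by (metis mult.assoc mult_zero_right)+
  show "twisted_corner S e \<subseteq> twisted_corner S (e + f)" "twisted_corner S f \<subseteq> twisted_corner S (e + f)"
    "peirce S e (\<sigma> f) \<subseteq> twisted_corner S (e + f)"
    unfolding twisted_corner_def peirce_def
    using l r by (auto simp: distrib_left distrib_right inv_add)
qed

lemma dim_Skew_twisted_corner:
  assumes S: "algebra_on S u" and stable: "\<forall>x\<in>S. \<sigma> x \<in> S"
    and e: "e \<in> S" "f \<in> S" "e * e = e" "f * f = f" and ef: "e * f = 0" "f * e = 0"
  shows "dim (Skew (twisted_corner S (e + f)) \<sigma>)
    = dim (Skew (twisted_corner S e) \<sigma>) + dim (Skew (twisted_corner S f) \<sigma>) + dim (peirce S e (\<sigma> f))"
proof -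
  note A = algebra_onD[OF S]
  let ?P = "Skew (twisted_corner S e) \<sigma>" and ?Q = "Skew (twisted_corner S f) \<sigma>" and ?M = "peirce S e (\<sigma> f)"
  note parts = twisted_corner_parts[OF S stable e ef]
  have sW: "subspace (twisted_corner S g)" for g unfolding twisted_corner_def by (rule subspace_peirce[OF A(1)])
  have "Skew (twisted_corner S (e + f)) \<sigma>
    = {x + n | x n. x \<in> {p + q | p q. p \<in> ?P \<and> q \<in> ?Q} \<and> n \<in> (\<lambda>m. m + - \<sigma> m) ` ?M}" (is "?L = ?R")
  proof
    show "?L \<subseteq> ?R"
    proof
      fix x assume "x \<in> ?L"
      hence x: "x \<in> twisted_corner S (e + f)" "\<sigma> x = - x" unfolding Skew_def by blast+
      note d = twisted_corner_sum[OF S stable e ef x(1)]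
      have "e * x * \<sigma> e \<in> ?P" "f * x * \<sigma> f \<in> ?Q"
        using d(1,2) x(2) by (simp_all add: Skew_def inv_mult mult.assoc)
      moreover have "f * x * \<sigma> e = - \<sigma> (e * x * \<sigma> f)"
        using x(2) by (simp add: inv_mult mult.assoc)
      hence "x = e * x * \<sigma> e + f * x * \<sigma> f + (e * x * \<sigma> f + - \<sigma> (e * x * \<sigma> f))"
        using d(5) by (simp only: add.assoc)
      ultimately show "x \<in> ?R" using d(3) by blast
    qed
    show "?R \<subseteq> ?L"
    proof
      fix x assume "x \<in> ?R"
      then obtain p q m where x: "x = p + q + (m + - \<sigma> m)" "p \<in> ?P" "q \<in> ?Q" "m \<in> ?M" by blast
      have "\<sigma> m \<in> twisted_corner S (e + f)"
        using inv_peirce[OF stable] parts(3) x(4) unfolding twisted_corner_def by (metis inv_inv subsetD)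
      hence "x \<in> twisted_corner S (e + f)" unfolding x(1) using x(2-4) parts
        by (intro subspace_add[OF sW] subspace_neg[OF sW]) (auto simp: Skew_def)
      moreover have "\<sigma> x = - x" using x(2,3) unfolding x(1)
        by (simp add: inv_add inv_minus inv_diff Skew_def)
      ultimately show "x \<in> ?L" unfolding Skew_def by blast
    qed
  qed
  moreover have "lin (\<lambda>m. - \<sigma> m)" by (rule linI) (simp_all add: inv_add inv_scale)
  ultimately show ?thesis
    using dim_orthogonal_decomposition[OF S stable ef subspace_Skew[OF sW] _ subspace_Skew[OF sW] _, where \<delta> = "\<lambda>m. - \<sigma> m"]
    by (simp add: Skew_def)
qed

lemma dim_Symd_twisted_corner:
  assumes S: "algebra_on S u" and stable: "\<forall>x\<in>S. \<sigma> x \<in> S"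
    and e: "e \<in> S" "f \<in> S" "e * e = e" "f * f = f" and ef: "e * f = 0" "f * e = 0"
  shows "dim (Symd (twisted_corner S (e + f)) \<sigma>)
    = dim (Symd (twisted_corner S e) \<sigma>) + dim (Symd (twisted_corner S f) \<sigma>) + dim (peirce S e (\<sigma> f))"
proof -
  note A = algebra_onD[OF S]
  let ?P = "Symd (twisted_corner S e) \<sigma>" and ?Q = "Symd (twisted_corner S f) \<sigma>" and ?M = "peirce S e (\<sigma> f)"
  note parts = twisted_corner_parts[OF S stable e ef]
  have sW: "subspace (twisted_corner S g)" for g unfolding twisted_corner_def by (rule subspace_peirce[OF A(1)])
  have stW: "\<sigma> x \<in> twisted_corner S g" if "x \<in> twisted_corner S g" for x g
    using inv_peirce[OF stable that[unfolded twisted_corner_def]] unfolding twisted_corner_def by simp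
  have sub: "Symd (twisted_corner S g) \<sigma> \<subseteq> twisted_corner S g" for g
    unfolding Symd_image using stW subspace_add[OF sW] by blast
  have "Symd (twisted_corner S (e + f)) \<sigma>
    = {x + n | x n. x \<in> {p + q | p q. p \<in> ?P \<and> q \<in> ?Q} \<and> n \<in> (\<lambda>m. m + \<sigma> m) ` ?M}" (is "?L = ?R")
  proof
    show "?L \<subseteq> ?R"
    proof
      fix y assume "y \<in> ?L"
      then obtain x where x: "x \<in> twisted_corner S (e + f)" "y = x + \<sigma> x" unfolding Symd_def by blast
      note d = twisted_corner_sum[OF S stable e ef x(1)]
      let ?a = "e * x * \<sigma> e" and ?b = "f * x * \<sigma> f" and ?m = "e * x * \<sigma> f + \<sigma> (f * x * \<sigma> e)"
      have "?a + \<sigma> ?a \<in> ?P" "?b + \<sigma> ?b \<in> ?Q" using d(1,2) unfolding Symd_def by blast+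
      moreover have "?m \<in> ?M"
        using d(3) inv_peirce[OF stable d(4)] by (intro subspace_add[OF subspace_peirce[OF A(1)]]) simp_all
      moreover have "y = ?a + \<sigma> ?a + (?b + \<sigma> ?b) + (?m + \<sigma> ?m)"
      proof -
        have "\<sigma> x = \<sigma> ?a + \<sigma> ?b + \<sigma> (e * x * \<sigma> f) + \<sigma> (f * x * \<sigma> e)"
          using d(5) by (metis inv_add)
        thus ?thesis using d(5) x(2) by (simp add: inv_add add.assoc add.left_commute)
      qed
      ultimately show "y \<in> ?R" by blast
    qed
    show "?R \<subseteq> ?L"
    proof
      fix y assume "y \<in> ?R"
      then obtain p q m where y: "y = p + q + (m + \<sigma> m)" "p \<in> ?P" "q \<in> ?Q" "m \<in> ?M" by blast
      obtain a where a: "a \<in> twisted_corner S e" "p = a + \<sigma> a" using y(2) unfolding Symd_def by blast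
      obtain b where b: "b \<in> twisted_corner S f" "q = b + \<sigma> b" using y(3) unfolding Symd_def by blast
      have "a + b + m \<in> twisted_corner S (e + f)"
        using a(1) b(1) y(4) parts by (intro subspace_add[OF sW]) blast+
      moreover have "y = a + b + m + \<sigma> (a + b + m)"
        unfolding y(1) a(2) b(2) by (simp add: inv_add add.assoc add.left_commute)
      ultimately show "y \<in> ?L" unfolding Symd_def by blast
    qed
  qed
  thus ?thesis
    using dim_orthogonal_decomposition[OF S stable ef subspace_Symd[OF sW] sub subspace_Symd[OF sW] sub lin_inv]
    by simp
qed

lemma trace_like_type_defect:
  assumes S: "algebra_on S u" and stable: "\<forall>x\<in>S. \<sigma> x \<in> S"
  shows "trace_like S (type_defect S)"
  unfolding trace_like_def
proof (intro conjI ballI impI; elim conjE)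
  fix e f assume "e \<in> S" "f \<in> S" "e * e = e" "f * f = f" "e * f = 0" "f * e = 0"
  note h = S stable this
  show "type_defect S (e + f) = type_defect S e + type_defect S f"
    unfolding type_defect_def dim_Skew_twisted_corner[OF h] dim_Symd_twisted_corner[OF h] by simp
next
  note A = algebra_onD[OF S]
  have sW: "subspace (twisted_corner S g)" for g unfolding twisted_corner_def by (rule subspace_peirce[OF A(1)])
  fix e f a b assume e: "e \<in> S" "f \<in> S" and a: "a \<in> peirce S e f" and b: "b \<in> peirce S f e"
    and ab: "a * b = e" "b * a = f"
  let ?T = "\<lambda>x. b * x * \<sigma> b" and ?T' = "\<lambda>x. a * x * \<sigma> a"
  have into: "?T x \<in> twisted_corner S f" if "x \<in> twisted_corner S e" for x
    using peirce_mult[OF S peirce_mult[OF S b that[unfolded twisted_corner_def]] inv_peirce[OF stable b]]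
    unfolding twisted_corner_def by simp
  have into': "?T' x \<in> twisted_corner S e" if "x \<in> twisted_corner S f" for x
    using peirce_mult[OF S peirce_mult[OF S a that[unfolded twisted_corner_def]] inv_peirce[OF stable a]]
    unfolding twisted_corner_def by simp
  have inv1: "?T' (?T x) = x" if "x \<in> twisted_corner S e" for x
  proof -
    have "?T' (?T x) = (a * b) * x * \<sigma> (a * b)" by (simp add: inv_mult mult.assoc)
    also have "\<dots> = x" using that ab unfolding twisted_corner_def peirce_def by simp
    finally show ?thesis .
  qed
  have inv2: "?T (?T' x) = x" if "x \<in> twisted_corner S f" for x
  proof -
    have "?T (?T' x) = (b * a) * x * \<sigma> (b * a)" by (simp add: inv_mult mult.assoc)
    also have "\<dots> = x" using that ab unfolding twisted_corner_def peirce_def by simp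
    finally show ?thesis .
  qed
  have comm: "\<sigma> (?T x) = ?T (\<sigma> x)" "\<sigma> (?T' x) = ?T' (\<sigma> x)" for x by (simp_all add: inv_mult mult.assoc)
  have "bij_betw ?T (Skew (twisted_corner S e) \<sigma>) (Skew (twisted_corner S f) \<sigma>)"
  proof (rule bij_betwI[where g = ?T'])
    show "?T \<in> Skew (twisted_corner S e) \<sigma> \<rightarrow> Skew (twisted_corner S f) \<sigma>"
      "?T' \<in> Skew (twisted_corner S f) \<sigma> \<rightarrow> Skew (twisted_corner S e) \<sigma>"
      unfolding Skew_def using into into' comm by auto
  qed (use inv1 inv2 in \<open>auto simp: Skew_def\<close>)
  hence "dim (Skew (twisted_corner S f) \<sigma>) = dim (Skew (twisted_corner S e) \<sigma>)"
    by (rule dim_bij_eq[OF lin_mult_both subspace_Skew[OF sW]])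
  moreover have sub: "Symd (twisted_corner S g) \<sigma> \<subseteq> twisted_corner S g" for g
    unfolding Symd_image twisted_corner_def
    using inv_peirce[OF stable] subspace_add[OF subspace_peirce[OF A(1)]] by fastforce
  have "bij_betw ?T (Symd (twisted_corner S e) \<sigma>) (Symd (twisted_corner S f) \<sigma>)"
  proof (rule bij_betwI[where g = ?T'])
    have "?T (x + \<sigma> x) = ?T x + \<sigma> (?T x)" "?T' (x + \<sigma> x) = ?T' x + \<sigma> (?T' x)" for x
      unfolding comm by (simp_all add: distrib_left distrib_right)
    thus "?T \<in> Symd (twisted_corner S e) \<sigma> \<rightarrow> Symd (twisted_corner S f) \<sigma>"
      "?T' \<in> Symd (twisted_corner S f) \<sigma> \<rightarrow> Symd (twisted_corner S e) \<sigma>"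
      unfolding Symd_image using into into' by (auto intro!: imageI)
  qed (use inv1 inv2 sub in blast)+
  hence "dim (Symd (twisted_corner S f) \<sigma>) = dim (Symd (twisted_corner S e) \<sigma>)"
    by (rule dim_bij_eq[OF lin_mult_both subspace_Symd[OF sW]])
  ultimately show "type_defect S e = type_defect S f" unfolding type_defect_def by simp
qed

lemma Skew_Symd_dims_corner:
  assumes S: "simple_alg S u" and stable: "\<forall>x\<in>S. \<sigma> x \<in> S"
    and e: "e \<in> S" "e * e = e" "e \<noteq> 0" "\<sigma> e = e" and f: "f \<in> S" "f * f = f" "f \<noteq> 0" "\<sigma> f = f"
    and less: "dim (Symd (corner S e) \<sigma>) < dim (Skew (corner S e) \<sigma>)"
  shows "dim (Symd (corner S f) \<sigma>) < dim (Skew (corner S f) \<sigma>)"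
proof -
  note alg = simple_algD(1)[OF S]
  have "corner S e = twisted_corner S e" "corner S f = twisted_corner S f"
    unfolding twisted_corner_def e(4) f(4) by (rule corner_eq_peirce[OF alg]; fact)+
  thus ?thesis
    using trace_like_pos[OF S trace_like_type_defect[OF alg stable] e(1-3) f(1-3)] less
    unfolding type_defect_def by simp
qed

end

section \<open>Separable elements\<close>

text \<open>An element of least degree in the ideal generated by \<open>p\<close> and \<open>q\<close> divides both of them.\<close>

lemma coprime_poly_bezout:
  fixes p q :: "'f::field poly"
  assumes "coprime p q" "p \<noteq> 0"
  obtains a b where "a * p + b * q = 1"
proof -
  define I where "I = {a * p + b * q | a b. True}"
  have Iadd: "x - c * y \<in> I" if xy: "x \<in> I" "y \<in> I" for x y c
  proof -
    obtain a b a' b' where "x = a * p + b * q" "y = a' * p + b' * q" using xy unfolding I_def by blast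
    hence "x - c * y = (a - c * a') * p + (b - c * b') * q" by (simp add: algebra_simps)
    thus ?thesis unfolding I_def by blast
  qed
  have pI: "p \<in> I" unfolding I_def by (rule CollectI, rule exI[of _ 1], rule exI[of _ 0]) simp
  have qI: "q \<in> I" unfolding I_def by (rule CollectI, rule exI[of _ 0], rule exI[of _ 1]) simp
  have "\<exists>d. d \<in> I \<and> d \<noteq> 0" using pI assms(2) by blast
  then obtain d where d: "d \<in> I" "d \<noteq> 0" and min: "\<And>x. x \<in> I \<Longrightarrow> x \<noteq> 0 \<Longrightarrow> degree d \<le> degree x"
    using ex_has_least_nat[of "\<lambda>d. d \<in> I \<and> d \<noteq> 0" _ degree] by blast
  have dvd: "d dvd x" if x: "x \<in> I" for x
  proof (rule ccontr)
    assume "\<not> d dvd x"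
    hence "x mod d \<noteq> 0" by (simp add: mod_eq_0_iff_dvd)
    moreover have "x mod d = x - (x div d) * d" by (simp add: minus_div_mult_eq_mod)
    hence "x mod d \<in> I" using Iadd[OF x d(1)] by simp
    ultimately have "degree d \<le> degree (x mod d)" using min by blast
    moreover have "degree (x mod d) < degree d"
      using degree_mod_less[OF d(2), of x] \<open>x mod d \<noteq> 0\<close> by blast
    ultimately show False by simp
  qed
  have "is_unit d" using assms(1) dvd[OF pI] dvd[OF qI] by (rule coprime_common_divisor)
  then obtain e where e: "1 = d * e" by (elim dvdE)
  obtain a b where "d = a * p + b * q" using d(1) unfolding I_def by blast
  hence "(e * a) * p + (e * b) * q = 1" using e by (simp add: algebra_simps)
  thus ?thesis by (rule that)
qed

context fd_algebra
begin

definition poly_at :: "'f poly \<Rightarrow> 'a \<Rightarrow> 'a" where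
  "poly_at p x = (\<Sum>i\<le>degree p. coeff p i *s x ^ i)"

lemma eval_on_poly_at: "eval_on u p x = u * poly_at p x"
  by (simp add: eval_on_def poly_at_def)

lemma poly_at_bound:
  assumes "degree p \<le> n"
  shows "poly_at p x = (\<Sum>i\<le>n. coeff p i *s x ^ i)"
  unfolding poly_at_def
  by (rule sum.mono_neutral_left) (use assms in \<open>auto simp: coeff_eq_0\<close>)

lemma poly_at_pCons: "poly_at (pCons a p) x = a *s 1 + x * poly_at p x"
proof -
  have "degree (pCons a p) \<le> Suc (degree p)" by (rule degree_pCons_le)
  hence "poly_at (pCons a p) x = (\<Sum>i\<le>Suc (degree p). coeff (pCons a p) i *s x ^ i)" by (rule poly_at_bound)
  also have "\<dots> = a *s 1 + (\<Sum>i\<le>degree p. coeff p i *s x ^ Suc i)"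
    by (subst sum.atMost_Suc_shift) simp
  also have "(\<Sum>i\<le>degree p. coeff p i *s x ^ Suc i) = x * poly_at p x"
    by (simp add: poly_at_def sum_distrib_left scale_mult_right)
  finally show ?thesis .
qed

lemma poly_at_0 [simp]: "poly_at 0 x = 0"
  by (simp add: poly_at_def)

lemma poly_at_add: "poly_at (p + q) x = poly_at p x + poly_at q x"
  by (induction p q rule: poly_induct2)
    (simp_all add: poly_at_pCons scale_left_distrib distrib_left add_ac)

lemma poly_at_smult: "poly_at (smult c p) x = c *s poly_at p x"
  by (induction p) (simp_all add: poly_at_pCons scale_right_distrib scale_mult_right)

lemma poly_at_mult: "poly_at (p * q) x = poly_at p x * poly_at q x"
proof (induction p)
  case (pCons a p)
  have "poly_at (pCons a p * q) x = a *s poly_at q x + (0 *s 1 + x * poly_at (p * q) x)"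
    by (simp add: poly_at_add poly_at_smult poly_at_pCons)
  thus ?case using pCons by (simp add: poly_at_pCons distrib_right mult.assoc scale_mult_left[symmetric])
qed simp

lemma poly_at_1: "poly_at 1 x = 1"
  by (simp add: poly_at_def)

lemma poly_at_commute: "x * y = y * x \<Longrightarrow> poly_at p x * y = y * poly_at p x"
proof (induction p)
  case (pCons a p)
  have "x * poly_at p x * y = x * (y * poly_at p x)" using pCons by (simp add: mult.assoc)
  also have "\<dots> = y * x * poly_at p x" using pCons.prems by (simp add: mult.assoc[symmetric])
  finally show ?case
    by (simp add: poly_at_pCons distrib_left distrib_right scale_mult_left[symmetric] scale_mult_right[symmetric] mult.assoc)
qed simp

text \<open>The commutator with \<open>x\<close> is a derivation.\<close>

lemma poly_at_commutator:
  assumes y: "y = \<theta> * x - x * \<theta>" and comm: "\<theta> * y = y * \<theta>"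
  shows "poly_at p \<theta> * x - x * poly_at p \<theta> = poly_at (pderiv p) \<theta> * y"
proof (induction p)
  case (pCons a p)
  let ?P = "poly_at p \<theta>" and ?D = "poly_at (pderiv p) \<theta>"
  have "poly_at (pCons a p) \<theta> * x - x * poly_at (pCons a p) \<theta> = \<theta> * ?P * x - x * \<theta> * ?P"
    by (simp add: poly_at_pCons distrib_left distrib_right scale_mult_left[symmetric] scale_mult_right[symmetric] mult.assoc)
  also have "\<dots> = \<theta> * (?P * x - x * ?P) + y * ?P"
    unfolding y by (simp add: left_diff_distrib right_diff_distrib mult.assoc)
  also have "\<dots> = \<theta> * ?D * y + ?P * y"
    using pCons poly_at_commute[OF comm, of p] by (simp add: mult.assoc)
  also have "\<dots> = poly_at (pderiv (pCons a p)) \<theta> * y"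
    by (simp add: pderiv_pCons poly_at_add poly_at_pCons distrib_right add.commute)
  finally show ?case .
qed simp

definition separable_elt :: "'a \<Rightarrow> 'a \<Rightarrow> bool" where
  "separable_elt u \<theta> \<longleftrightarrow> (\<exists>p. p \<noteq> 0 \<and> eval_on u p \<theta> = 0 \<and> coprime p (pderiv p))"

text \<open>
  For a separable \<open>\<theta>\<close>, the map \<open>[\<theta>, -]\<close> is semisimple at \<open>0\<close>: if \<open>y = [\<theta>, x]\<close> commutes with \<open>\<theta>\<close>,
  then \<open>0 = [p(\<theta>), x] = p'(\<theta>) y\<close>, where \<open>p'(\<theta>)\<close> is invertible.
\<close>

lemma separable_commutator:
  assumes S: "algebra_on S u" and \<theta>: "\<theta> \<in> S" "separable_elt u \<theta>" and x: "x \<in> S"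
    and comm: "\<theta> * (\<theta> * x - x * \<theta>) = (\<theta> * x - x * \<theta>) * \<theta>"
  shows "\<theta> * x = x * \<theta>"
proof -
  note A = algebra_onD[OF S]
  define y where "y = \<theta> * x - x * \<theta>"
  have yS: "y \<in> S" unfolding y_def using A(2,8) \<theta>(1) x by blast
  have yc: "\<theta> * y = y * \<theta>" using comm unfolding y_def .
  obtain p where p: "p \<noteq> 0" "u * poly_at p \<theta> = 0" "coprime p (pderiv p)"
    using \<theta>(2) unfolding separable_elt_def eval_on_poly_at by blast
  have uc: "poly_at q \<theta> * u = u * poly_at q \<theta>" for q
    by (rule poly_at_commute) (use A(4,5) \<theta>(1) in simp)
  have "u * (poly_at p \<theta> * x) = 0" using p(2) by (simp add: mult.assoc[symmetric])
  moreover have "u * (x * poly_at p \<theta>) = 0"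
  proof -
    have "u * (x * poly_at p \<theta>) = x * (u * poly_at p \<theta>)"
      using A(4,5)[OF x] by (simp add: mult.assoc[symmetric])
    thus ?thesis using p(2) by simp
  qed
  ultimately have "u * (poly_at p \<theta> * x - x * poly_at p \<theta>) = 0" by (simp add: right_diff_distrib)
  hence "u * (poly_at (pderiv p) \<theta> * y) = 0"
    unfolding poly_at_commutator[OF y_def yc] .
  moreover have "u * (poly_at (pderiv p) \<theta> * y) = poly_at (pderiv p) \<theta> * y"
  proof -
    have "u * (poly_at (pderiv p) \<theta> * y) = poly_at (pderiv p) \<theta> * u * y"
      using uc[of "pderiv p"] by (simp only: mult.assoc[symmetric])
    thus ?thesis using A(4)[OF yS] by (simp only: mult.assoc)
  qed
  ultimately have d0: "poly_at (pderiv p) \<theta> * y = 0" by simp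
  have p0: "poly_at p \<theta> * y = 0"
  proof -
    have "poly_at p \<theta> * y = poly_at p \<theta> * u * y" using A(4)[OF yS] by (simp add: mult.assoc)
    thus ?thesis using uc[of p] p(2) by simp
  qed
  obtain a b where ab: "a * p + b * pderiv p = 1" using coprime_poly_bezout[OF p(3,1)] .
  have "y = poly_at (a * p + b * pderiv p) \<theta> * y" unfolding ab by (simp add: poly_at_1)
  also have "\<dots> = poly_at a \<theta> * (poly_at p \<theta> * y) + poly_at b \<theta> * (poly_at (pderiv p) \<theta> * y)"
    by (simp add: poly_at_add poly_at_mult distrib_right mult.assoc)
  also have "\<dots> = 0" using d0 p0 by simp
  finally show ?thesis unfolding y_def by simp
qed

end

section \<open>Symmetric maximal subfields\<close>

context fd_involution
begin

text \<open>
  For symmetric \<open>\<theta>\<close> the map \<open>[\<theta>, -]\<close> exchanges symmetric and skew elements. When it is semisimple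
  at \<open>0\<close>, passing to its kernel loses as many symmetric as skew dimensions, and the projection to
  the kernel along the image commutes with \<open>\<sigma>\<close>.
\<close>

lemma Sym_Skew_dims_kernel:
  assumes T: "subspace T" and stable: "\<forall>x\<in>T. \<sigma> x \<in> T" and \<theta>: "\<sigma> \<theta> = \<theta>"
    and into: "\<forall>x\<in>T. \<theta> * x - x * \<theta> \<in> T"
    and ss: "\<forall>x\<in>T. \<theta> * (\<theta> * x - x * \<theta>) = (\<theta> * x - x * \<theta>) * \<theta> \<longrightarrow> \<theta> * x = x * \<theta>"
  defines "T' \<equiv> {x \<in> T. \<theta> * x = x * \<theta>}"
  shows "dim (Sym T \<sigma>) + dim (Skew T' \<sigma>) = dim (Sym T' \<sigma>) + dim (Skew T \<sigma>)"
    "v \<in> T' \<Longrightarrow> v \<in> Symd T \<sigma> \<Longrightarrow> v \<in> Symd T' \<sigma>"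
proof -
  let ?D = "\<lambda>x. \<theta> * x - x * \<theta>"
  have D: "lin ?D"
    by (rule linI) (simp_all add: distrib_left distrib_right right_diff_distrib scale_right_diff_distrib
        scale_mult_left[symmetric] scale_mult_right[symmetric])
  have DD: "?D x = 0" if "x \<in> T" "?D (?D x) = 0" for x
    using bspec[OF ss that(1)] that(2) by simp
  have \<sigma>D: "\<sigma> (?D x) = - ?D (\<sigma> x)" for x by (simp add: inv_diff inv_mult \<theta>)
  have sT': "subspace T'" unfolding T'_def
    using subspace_kernel_lin[OF D T] by (simp only: right_minus_eq)
  have le: "dim X + dim Y' \<le> dim X' + dim Y"
    if X: "subspace X" "X \<subseteq> T" and Y: "subspace Y" and DX: "?D ` X \<subseteq> Y"
      and X': "X' = {x \<in> X. ?D x = 0}" and Y': "Y' = {x \<in> Y. ?D x = 0}" for X X' Y Y'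
  proof -
    have "?D ` X \<inter> Y' = {0}"
    proof -
      have "z = 0" if "z \<in> ?D ` X" "z \<in> Y'" for z
        using that DD X(2) unfolding Y' by blast
      thus ?thesis using subspace_0[OF subspace_image_lin[OF D X(1)]] subspace_0[OF subspace_kernel_lin[OF D Y]]
        unfolding Y' by blast
    qed
    hence "dim {a + b | a b. a \<in> ?D ` X \<and> b \<in> Y'} = dim (?D ` X) + dim Y'"
      unfolding Y' by (rule dim_direct_sum[OF subspace_image_lin[OF D X(1)] subspace_kernel_lin[OF D Y]])
    moreover have "{a + b | a b. a \<in> ?D ` X \<and> b \<in> Y'} \<subseteq> Y"
      using DX subspace_add[OF Y] unfolding Y' by blast
    hence "dim {a + b | a b. a \<in> ?D ` X \<and> b \<in> Y'} \<le> dim Y" by (rule dim_subset)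
    ultimately have "dim (?D ` X) + dim Y' \<le> dim Y" by linarith
    thus ?thesis using rank_nullity[OF D X(1)] unfolding X' by linarith
  qed
  have k: "Sym T' \<sigma> = {x \<in> Sym T \<sigma>. ?D x = 0}" "Skew T' \<sigma> = {x \<in> Skew T \<sigma>. ?D x = 0}"
    by (auto simp: T'_def Sym_def Skew_def)
  have i: "?D ` Sym T \<sigma> \<subseteq> Skew T \<sigma>" "?D ` Skew T \<sigma> \<subseteq> Sym T \<sigma>"
    using into \<sigma>D by (auto simp: Sym_def Skew_def)
  have t: "Sym T \<sigma> \<subseteq> T" "Skew T \<sigma> \<subseteq> T" by (auto simp: Sym_def Skew_def)
  have "dim (Sym T \<sigma>) + dim (Skew T' \<sigma>) \<le> dim (Sym T' \<sigma>) + dim (Skew T \<sigma>)"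
    by (rule le[OF subspace_Sym[OF T] t(1) subspace_Skew[OF T] i(1) k])
  moreover have "dim (Skew T \<sigma>) + dim (Sym T' \<sigma>) \<le> dim (Skew T' \<sigma>) + dim (Sym T \<sigma>)"
    by (rule le[OF subspace_Skew[OF T] t(2) subspace_Sym[OF T] i(2) k(2,1)])
  ultimately show "dim (Sym T \<sigma>) + dim (Skew T' \<sigma>) = dim (Sym T' \<sigma>) + dim (Skew T \<sigma>)" by linarith
  assume v: "v \<in> T'" "v \<in> Symd T \<sigma>"
  then obtain x where x: "x \<in> T" "v = x + \<sigma> x" unfolding Symd_def by blast
  have sDT: "subspace (?D ` T)" by (rule subspace_image_lin[OF D T])
  have "?D ` (?D ` T) = ?D ` T"
    by (rule surj_of_inj_endo[OF D sDT]) (use DD into in blast)+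
  then obtain w where w: "w \<in> T" "?D x = ?D (?D w)" using x(1) by blast
  define c where "c = x - ?D w"
  have cT: "c \<in> T'" unfolding T'_def c_def
    using subspace_diff[OF T x(1) bspec[OF into w(1)]] w(2) lin_diff[OF D, of x "?D w"] by simp
  have "\<sigma> c \<in> T'"
  proof -
    have "?D c = 0" using cT unfolding T'_def by simp
    hence "?D (\<sigma> c) = 0" using \<sigma>D[of c] by simp
    thus ?thesis using cT stable unfolding T'_def by simp
  qed
  hence s: "c + \<sigma> c \<in> T'" using subspace_add[OF sT' cT] by blast
  have "v - (c + \<sigma> c) = ?D (w - \<sigma> w)"
    unfolding x(2) c_def by (simp add: inv_diff inv_mult \<theta> right_diff_distrib left_diff_distrib)
  moreover have "w - \<sigma> w \<in> T" using subspace_diff[OF T w(1)] stable w(1) by blast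
  moreover have "?D (v - (c + \<sigma> c)) = 0"
    using subspace_diff[OF sT' v(1) s] unfolding T'_def by simp
  ultimately have "v - (c + \<sigma> c) = 0" using DD by metis
  thus "v \<in> Symd T' \<sigma>" using cT unfolding Symd_def by auto
qed

lemma Sym_Skew_dims_centraliser:
  assumes S: "algebra_on S u" and stable: "\<forall>x\<in>S. \<sigma> x \<in> S"
    and B: "finite B" "B \<subseteq> S" "\<And>x. x \<in> B \<Longrightarrow> \<sigma> x = x" "\<And>x. x \<in> B \<Longrightarrow> separable_elt u x"
    and comm: "\<And>x y. x \<in> B \<Longrightarrow> y \<in> B \<Longrightarrow> x * y = y * x"
  shows "dim (Sym S \<sigma>) + dim (Skew (centraliser S B) \<sigma>) = dim (Sym (centraliser S B) \<sigma>) + dim (Skew S \<sigma>)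
    \<and> (u \<in> Symd S \<sigma> \<longrightarrow> u \<in> Symd (centraliser S B) \<sigma>)"
  using B comm
proof (induction B rule: finite_induct)
  case empty
  have "centraliser S {} = S" by (auto simp: centraliser_def)
  thus ?case by simp
next
  case (insert \<theta> B)
  note A = algebra_onD[OF S]
  let ?T = "centraliser S B"
  have IH: "dim (Sym S \<sigma>) + dim (Skew ?T \<sigma>) = dim (Sym ?T \<sigma>) + dim (Skew S \<sigma>)"
    "u \<in> Symd S \<sigma> \<Longrightarrow> u \<in> Symd ?T \<sigma>"
    using insert.IH insert.prems by blast+
  have \<theta>: "\<theta> \<in> S" "\<sigma> \<theta> = \<theta>" "separable_elt u \<theta>" using insert.prems by blast+
  have T': "centraliser S (insert \<theta> B) = {x \<in> ?T. \<theta> * x = x * \<theta>}" by (auto simp: centraliser_def)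
  have st: "\<forall>x\<in>?T. \<sigma> x \<in> ?T"
  proof
    fix x assume x: "x \<in> ?T"
    show "\<sigma> x \<in> ?T"
    proof (rule centraliserI)
      show "\<sigma> x \<in> S" using stable centraliserD(1)[OF x] by blast
      fix k assume k: "k \<in> B"
      hence "\<sigma> (k * x) = \<sigma> (x * k)" using centraliserD(2)[OF x] by simp
      thus "k * \<sigma> x = \<sigma> x * k" using insert.prems(2)[of k] k by (simp add: inv_mult)
    qed
  qed
  have into: "\<forall>x\<in>?T. \<theta> * x - x * \<theta> \<in> ?T"
  proof (rule ballI, rule centraliserI)
    fix x assume x: "x \<in> ?T"
    show "\<theta> * x - x * \<theta> \<in> S" using A(2,8) \<theta>(1) centraliserD(1)[OF x] by blast
    fix k assume k: "k \<in> B"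
    have kx: "k * x = x * k" by (rule centraliserD(2)[OF x k])
    have k\<theta>: "k * \<theta> = \<theta> * k" using insert.prems(4) k by blast
    have "k * (\<theta> * x) = \<theta> * x * k" by (metis kx k\<theta> mult.assoc)
    moreover have "k * (x * \<theta>) = x * \<theta> * k" by (metis kx k\<theta> mult.assoc)
    ultimately show "k * (\<theta> * x - x * \<theta>) = (\<theta> * x - x * \<theta>) * k"
      by (simp add: left_diff_distrib right_diff_distrib)
  qed
  have ss: "\<forall>x\<in>?T. \<theta> * (\<theta> * x - x * \<theta>) = (\<theta> * x - x * \<theta>) * \<theta> \<longrightarrow> \<theta> * x = x * \<theta>"
    using separable_commutator[OF S \<theta>(1,3) centraliserD(1)] by blast
  have uT: "u \<in> {x \<in> ?T. \<theta> * x = x * \<theta>}"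
    using A(3,4,5) \<theta>(1) insert.prems(1) by (auto simp: centraliser_def)
  note step = Sym_Skew_dims_kernel[OF subspace_centraliser[OF A(1)] st \<theta>(2) into ss]
  show ?case unfolding T'
    using IH step(1) step(2)[OF uT] by simp
qed

text \<open>
  By the preceding lemma \<open>u = y + \<sigma>(y) = 2y\<close> for some \<open>y \<in> K\<close>, and the symmetric elements of \<open>S\<close>
  outnumber the skew ones by as many dimensions as in \<open>K\<close>, where all elements are symmetric.
\<close>

lemma symmetric_maximal_subfield:
  assumes S: "algebra_on S u" and stable: "\<forall>x\<in>S. \<sigma> x \<in> S"
    and K: "field_on K u" "K \<subseteq> S" "\<And>x. x \<in> K \<Longrightarrow> \<sigma> x = x" "\<And>x. x \<in> K \<Longrightarrow> separable_elt u x"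
    and max: "centraliser S K = K" and u: "u \<in> Symd S \<sigma>"
  shows "(2::'f) \<noteq> 0" "\<not> dim (Symd S \<sigma>) < dim (Skew S \<sigma>)"
proof -
  note A = algebra_onD[OF S]
  note KA = algebra_onD[OF field_onD(1)[OF K(1)]]
  obtain B where B: "B \<subseteq> K" "independent B" "K \<subseteq> span B" "card B = dim K" by (rule basis_exists)
  have finB: "finite B" using finiteI_independent[OF B(2)] .
  have "centraliser S B = centraliser S K"
  proof
    show "centraliser S K \<subseteq> centraliser S B" using B(1) by (auto simp: centraliser_def)
    show "centraliser S B \<subseteq> centraliser S K"
    proof
      fix x assume x: "x \<in> centraliser S B"
      have "subspace {k. k * x = x * k}"
        unfolding subspace_def
        by (simp add: distrib_left distrib_right scale_mult_left[symmetric] scale_mult_right[symmetric])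
      moreover have "B \<subseteq> {k. k * x = x * k}" using centraliserD(2)[OF x] by blast
      ultimately have "span B \<subseteq> {k. k * x = x * k}" by (simp add: span_minimal)
      thus "x \<in> centraliser S K" using B(3) centraliserD(1)[OF x] by (intro centraliserI) blast+
    qed
  qed
  hence CB: "centraliser S B = K" using max by simp
  have "dim (Sym S \<sigma>) + dim (Skew K \<sigma>) = dim (Sym K \<sigma>) + dim (Skew S \<sigma>) \<and> (u \<in> Symd S \<sigma> \<longrightarrow> u \<in> Symd K \<sigma>)"
    using Sym_Skew_dims_centraliser[OF S stable finB, unfolded CB] B(1) K field_onD(3)[OF K(1)] by blast
  hence dims: "dim (Sym S \<sigma>) + dim (Skew K \<sigma>) = dim (Sym K \<sigma>) + dim (Skew S \<sigma>)" and "u \<in> Symd K \<sigma>"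
    using u by blast+
  then obtain y where y: "y \<in> K" "u = y + \<sigma> y" unfolding Symd_def by blast
  hence "u = (2::'f) *s y" using K(3)[OF y(1)] scale_left_distrib[of 1 1 y] by simp
  thus two: "(2::'f) \<noteq> 0" using field_onD(2)[OF K(1)] by auto
  have half: "inverse (2::'f) *s (x + x) = x" for x
  proof -
    have "x + x = (2::'f) *s x" using scale_left_distrib[of 1 1 x] by simp
    thus ?thesis using two by simp
  qed
  have "Skew K \<sigma> = {0}"
  proof -
    have "x = 0" if "x \<in> Skew K \<sigma>" for x
    proof -
      have "x = - x" using that K(3)[of x] by (simp add: Skew_def)
      hence "x + x = 0" by (metis add.left_inverse)
      thus ?thesis using half[of x] by simp
    qed
    thus ?thesis using subspace_0[OF subspace_Skew[OF KA(1)]] by blast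
  qed
  moreover have "Sym K \<sigma> = K" using K(3) by (auto simp: Sym_def)
  moreover have "Sym S \<sigma> \<subseteq> Symd S \<sigma>"
  proof
    fix x assume x: "x \<in> Sym S \<sigma>"
    let ?x = "inverse (2::'f) *s x"
    have "x = ?x + \<sigma> ?x" using x half[of x] by (simp add: Sym_def inv_scale scale_right_distrib[symmetric])
    moreover have "?x \<in> S" using x A(10) by (simp add: Sym_def)
    ultimately show "x \<in> Symd S \<sigma>" unfolding Symd_def by blast
  qed
  hence "dim (Sym S \<sigma>) \<le> dim (Symd S \<sigma>)" by (rule dim_subset)
  ultimately show "\<not> dim (Symd S \<sigma>) < dim (Skew S \<sigma>)"
    using dims by (simp del: dim_eq_0)
qed

end

section \<open>Algebras with involution\<close>

context fd_algebra
begin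

lemma field_on_scalars:
  assumes "v * v = v" "v \<noteq> 0"
  shows "field_on (scalars v) v"
proof -
  have m: "(a *s v) * (b *s v) = (a * b) *s v" for a b
    using assms(1) by (simp add: scale_mult_left[symmetric] scale_mult_right[symmetric])
  have v: "v \<in> scalars v" unfolding scalars_def by (metis (mono_tags, lifting) mem_Collect_eq scale_one)
  have "algebra_on (scalars v) v"
  proof (rule algebra_onI)
    show "subspace (scalars v)" by (rule subspace_scalars)
    show "x * y \<in> scalars v" if "x \<in> scalars v" "y \<in> scalars v" for x y
      using that m unfolding scalars_def by auto
    show "v * x = x" "x * v = x" if "x \<in> scalars v" for x
      using that assms(1) unfolding scalars_def by (auto simp: scale_mult_left[symmetric] scale_mult_right[symmetric])
  qed (rule v)
  moreover have "\<forall>x\<in>scalars v. \<forall>y\<in>scalars v. x * y = y * x"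
    unfolding scalars_def by (auto simp: m mult.commute)
  moreover have "\<exists>y\<in>scalars v. x * y = v" if x: "x \<in> scalars v" "x \<noteq> 0" for x
  proof -
    obtain c where c: "x = c *s v" using x(1) unfolding scalars_def by blast
    hence "c \<noteq> 0" using x(2) by auto
    hence "x * (inverse c *s v) = v" unfolding c m by simp
    thus ?thesis unfolding scalars_def by blast
  qed
  ultimately show ?thesis unfolding field_on_def using assms(2) by blast
qed

lemma min_poly_scalar:
  assumes "v * v = v" "v \<noteq> 0" "x = c *s v"
  shows "is_min_poly v x [:- c, 1:]"
  unfolding is_min_poly_def
proof (intro conjI allI impI; (elim conjE)?)
  show "lead_coeff [:- c, 1:] = 1" by simp
  show "eval_on v [:- c, 1:] x = 0"
    using assms by (simp add: eval_on_poly_at poly_at_pCons right_diff_distrib distrib_left scale_mult_right[symmetric])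
  fix q assume q: "q \<noteq> 0" "eval_on v q x = 0"
  have "degree q \<noteq> 0"
  proof
    assume "degree q = 0"
    then obtain a where a: "q = [:a:]" by (rule degree_eq_zeroE)
    hence "a *s v = 0" using q(2) by (simp add: eval_on_poly_at poly_at_pCons scale_mult_right[symmetric])
    thus False using q(1) a assms(2) by simp
  qed
  thus "degree [:- c, 1:] \<le> degree q" by simp
qed

lemma coprime_linear_pderiv: "coprime [:- c, 1:] (pderiv [:- c, 1 :: 'f:])"
proof -
  have "pderiv [:- c, 1 :: 'f:] = 1" by (simp add: pderiv_pCons one_pCons)
  thus ?thesis by simp
qed

lemma separable_extension_scalars:
  assumes v: "v * v = v" "v \<noteq> 0"
  shows "finite_separable_extension (scalars v) v"
  unfolding finite_separable_extension_def
proof (intro conjI ballI)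
  show "field_on (scalars v) v" by (rule field_on_scalars[OF v])
  show "finite_dim (scalars v)" by (rule finite_dim_subspace[OF subspace_scalars])
  fix x assume "x \<in> scalars v"
  then obtain c where "x = c *s v" unfolding scalars_def by blast
  hence "is_min_poly v x [:- c, 1:]" by (rule min_poly_scalar[OF v])
  moreover have "coprime [:- c, 1:] (pderiv [:- c, 1:])" by (rule coprime_linear_pderiv)
  ultimately show "\<exists>p. is_min_poly v x p \<and> coprime p (pderiv p)" by blast
qed

end

context fd_involution
begin

lemma awiD:
  assumes "algebra_with_involution S u \<sigma>"
  shows "algebra_on S u" "u \<noteq> 0" "\<forall>x\<in>S. \<sigma> x \<in> S" "scalars u = centre S \<inter> Sym S \<sigma>"
    "\<And>I. ideal_on S I \<Longrightarrow> \<sigma> ` I = I \<Longrightarrow> I = {0} \<or> I = S"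
  using assms unfolding algebra_with_involution_def by blast+

lemma awiI:
  assumes "algebra_on S u" "u \<noteq> 0" "\<forall>x\<in>S. \<sigma> x \<in> S" "scalars u = centre S \<inter> Sym S \<sigma>"
    "\<And>I. ideal_on S I \<Longrightarrow> \<sigma> ` I = I \<Longrightarrow> I = {0} \<or> I = S"
  shows "algebra_with_involution S u \<sigma>"
  unfolding algebra_with_involution_def
  using assms finite_dim_subspace[OF algebra_onD(1)[OF assms(1)]] inv_add inv_mult inv_scale inv_inv
  by (intro conjI) blast+

lemma inv_image_eq:
  assumes "\<And>x. x \<in> I \<Longrightarrow> \<sigma> x \<in> I"
  shows "\<sigma> ` I = I"
proof
  show "I \<subseteq> \<sigma> ` I" using assms by (metis image_eqI inv_inv subsetI)
qed (use assms in blast)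

lemma inv_unit:
  assumes "algebra_on S u" "\<forall>x\<in>S. \<sigma> x \<in> S"
  shows "\<sigma> u = u"
proof -
  note A = algebra_onD[OF assms(1)]
  have uu: "\<sigma> u * u = \<sigma> u" using A(3,5) assms(2) by blast
  have "u = \<sigma> (\<sigma> u * u)" unfolding uu by simp
  also have "\<dots> = \<sigma> u * u" by (simp only: inv_mult inv_inv)
  finally show ?thesis using uu by simp
qed

lemma inv_centre:
  assumes "\<forall>x\<in>S. \<sigma> x \<in> S" "z \<in> centre S"
  shows "\<sigma> z \<in> centre S"
proof (rule centreI)
  note z = centreD[OF assms(2)]
  show "\<sigma> z \<in> S" using assms(1) z(1) by blast
  fix x assume "x \<in> S"
  hence "\<sigma> (z * \<sigma> x) = \<sigma> (\<sigma> x * z)" using z(2) assms(1) by simp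
  thus "\<sigma> z * x = x * \<sigma> z" by (simp add: inv_mult)
qed

text \<open>An ideal \<open>I\<close> containing \<open>e\<close> may be replaced by the \<open>\<sigma>\<close>-stable ideal \<open>I \<inter> \<sigma>(I)\<close>.\<close>

lemma symmetric_idempotent_full:
  assumes S: "algebra_with_involution S u \<sigma>" and e: "e \<in> S" "\<sigma> e = e" "e \<noteq> 0"
  shows "full S e"
  unfolding full_def
proof (intro allI impI; elim conjE)
  fix I assume I: "ideal_on S I" "e \<in> I"
  note ID = ideal_onD[OF I(1)]
  note D = awiD[OF S]
  let ?J = "{x \<in> I. \<sigma> x \<in> I}"
  have "ideal_on S ?J"
  proof (rule ideal_onI)
    fix a x assume a: "a \<in> S" and x: "x \<in> ?J"
    have "\<sigma> a \<in> S" using D(3) a by blast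
    thus "a * x \<in> ?J" "x * a \<in> ?J" using ID(4,5) a x by (auto simp: inv_mult)
  qed (use ID(1-3) in \<open>auto simp: inv_diff\<close>)
  moreover have "\<sigma> ` ?J = ?J" by (rule inv_image_eq) simp
  moreover have "e \<in> ?J" using I(2) e(2) by simp
  ultimately have "?J = S" using D(5) e(3) by blast
  thus "I = S" using ID(1) by blast
qed

text \<open>
  A symmetric central element of \<open>eSe\<close> lifts to a central element of \<open>S\<close>, and the lift is symmetric
  because it is unique. Ideals of \<open>eSe\<close> are pulled back to \<open>S\<close>.
\<close>

lemma algebra_with_involution_corner:
  assumes S: "algebra_with_involution S u \<sigma>" and e: "e \<in> S" "e * e = e" "\<sigma> e = e" "e \<noteq> 0"
  shows "algebra_with_involution (corner S e) e \<sigma>"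
proof (rule awiI)
  note D = awiD[OF S]
  note A = algebra_onD[OF D(1)]
  note full = symmetric_idempotent_full[OF S e(1,3,4)]
  note ce = corner_eq_peirce[OF D(1) e(1,2)]
  show alg: "algebra_on (corner S e) e" by (rule algebra_on_corner[OF D(1) e(1,2)])
  show "e \<noteq> 0" by fact
  show "\<forall>x\<in>corner S e. \<sigma> x \<in> corner S e"
    unfolding ce using inv_peirce[OF D(3), of _ e e] e(3) by simp
  show "scalars e = centre (corner S e) \<inter> Sym (corner S e) \<sigma>"
  proof
    show "scalars e \<subseteq> centre (corner S e) \<inter> Sym (corner S e) \<sigma>"
    proof
      fix x assume "x \<in> scalars e"
      then obtain c where x: "x = c *s e" unfolding scalars_def by blast
      have xc: "x \<in> corner S e" unfolding x by (rule algebra_onD(10)[OF alg algebra_onD(3)[OF alg]])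
      moreover have "x \<in> centre (corner S e)"
        by (rule centreI[OF xc])
          (use algebra_onD(4,5)[OF alg] x in \<open>simp add: scale_mult_left[symmetric] scale_mult_right[symmetric]\<close>)
      ultimately show "x \<in> centre (corner S e) \<inter> Sym (corner S e) \<sigma>"
        using e(3) by (simp add: Sym_def x inv_scale)
    qed
    show "centre (corner S e) \<inter> Sym (corner S e) \<sigma> \<subseteq> scalars e"
    proof
      fix c assume "c \<in> centre (corner S e) \<inter> Sym (corner S e) \<sigma>"
      hence c: "c \<in> centre (corner S e)" "\<sigma> c = c" unfolding Sym_def by blast+
      obtain z where z: "z \<in> centre S" "c = e * z" using centre_corner_lift[OF D(1) e(1,2) full c(1)] by blast
      have sz: "\<sigma> z \<in> centre S" by (rule inv_centre[OF D(3) z(1)])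
      have "e * \<sigma> z = \<sigma> z * e" by (rule sym, rule centreD(2)[OF sz e(1)])
      hence "e * \<sigma> z = c" using c(2) e(3) unfolding z(2) by (simp add: inv_mult)
      hence "e * (\<sigma> z - z) = 0" using z(2) by (simp add: right_diff_distrib)
      hence "\<sigma> z - z = 0"
        using full_mult_eq_0[OF D(1) e(1) full] subspace_diff[OF subspace_centre[OF A(1)] sz z(1)] by blast
      hence "z \<in> centre S \<inter> Sym S \<sigma>" using z(1) centreD(1) by (simp add: Sym_def)
      then obtain k where "z = k *s u" using D(4) unfolding scalars_def by blast
      hence "c = k *s e" using z(2) A(5)[OF e(1)] by (simp add: scale_mult_right[symmetric])
      thus "c \<in> scalars e" unfolding scalars_def by blast
    qed
  qed
  fix I assume I: "ideal_on (corner S e) I" "\<sigma> ` I = I"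
  note ID = ideal_onD[OF I(1)]
  show "I = {0} \<or> I = corner S e"
  proof (cases "I = {0}")
    case False
    then obtain x where x: "x \<in> I" "x \<noteq> 0" using ID(2) by blast
    note J = corner_ideal_pullback[OF D(1) e(1,2) I(1)]
    let ?J = "{s \<in> S. \<forall>a\<in>S. \<forall>b\<in>S. e * a * s * b * e \<in> I}"
    have "\<sigma> ` ?J = ?J"
    proof (rule inv_image_eq)
      fix s assume s: "s \<in> ?J"
      have "e * a * \<sigma> s * b * e \<in> I" if "a \<in> S" "b \<in> S" for a b
      proof -
        have "e * \<sigma> b * s * \<sigma> a * e \<in> I" using s that D(3) by blast
        hence "\<sigma> (e * \<sigma> b * s * \<sigma> a * e) \<in> I" using I(2) by blast
        thus ?thesis by (simp add: inv_mult e(3) mult.assoc)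
      qed
      thus "\<sigma> s \<in> ?J" using s D(3) by blast
    qed
    hence "?J = S" using D(5)[OF J(1)] J(2) x by blast
    thus ?thesis using J(3) by blast
  qed blast
qed

lemma first_kind_corner_iff:
  assumes S: "algebra_with_involution S u \<sigma>" and e: "e \<in> S" "e * e = e" "\<sigma> e = e" "e \<noteq> 0"
  shows "first_kind (corner S e) e \<longleftrightarrow> first_kind S u"
proof -
  note D = awiD[OF S]
  note A = algebra_onD[OF D(1)]
  note full = symmetric_idempotent_full[OF S e(1,3,4)]
  have c: "centre (corner S e) = (\<lambda>z. e * z) ` centre S" by (rule centre_corner[OF D(1) e(1,2) full])
  have s: "scalars e = (\<lambda>z. e * z) ` scalars u"
  proof -
    have "e * (c *s u) = c *s e" for c using A(5)[OF e(1)] by (simp add: scale_mult_right[symmetric])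
    moreover have "(\<lambda>z. e * z) ` scalars u = {e * (c *s u) | c. True}" unfolding scalars_def by blast
    ultimately show ?thesis unfolding scalars_def by simp
  qed
  have "inj_on (\<lambda>z. e * z) (centre S)"
    by (rule inj_onI_lin[OF lin_mult_left subspace_centre[OF A(1)]]) (rule full_mult_eq_0[OF D(1) e(1) full])
  thus ?thesis unfolding first_kind_def c s using D(4) by (simp add: inj_on_image_eq_iff)
qed

subsection \<open>The second kind\<close>

text \<open>As \<open>z - \<sigma>(z)\<close> is skew, the ideal that it generates is \<open>\<sigma>\<close>-stable.\<close>

lemma central_skew_invertible:
  assumes S: "algebra_with_involution S u \<sigma>" and z: "z \<in> centre S" "\<sigma> z \<noteq> z"
  shows "\<exists>y\<in>centre S. (z - \<sigma> z) * y = u"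
proof -
  note D = awiD[OF S]
  note A = algebra_onD[OF D(1)]
  let ?d = "z - \<sigma> z"
  have d: "?d \<in> centre S"
    using subspace_diff[OF subspace_centre[OF A(1)] z(1) inv_centre[OF D(3) z(1)]] .
  let ?I = "(\<lambda>x. ?d * x) ` S"
  have "\<sigma> ` ?I = ?I"
  proof (rule inv_image_eq)
    fix x assume "x \<in> ?I"
    then obtain s where s: "s \<in> S" "x = ?d * s" by blast
    have sS: "- \<sigma> s \<in> S" using D(3) A(9) s(1) by blast
    have "\<sigma> x = \<sigma> s * \<sigma> ?d" unfolding s(2) by (rule inv_mult)
    also have "\<sigma> ?d = - ?d" by (simp add: inv_diff)
    also have "\<sigma> s * - ?d = - \<sigma> s * ?d" by (simp only: mult_minus_left mult_minus_right)
    also have "\<dots> = ?d * (- \<sigma> s)" by (rule sym, rule centreD(2)[OF d sS])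
    finally show "\<sigma> x \<in> ?I" using sS by blast
  qed
  moreover have "?d \<in> ?I" using A(3) A(5)[OF centreD(1)[OF d]] by (intro image_eqI[of _ _ u]) simp_all
  moreover have "?d \<noteq> 0" using z(2) by (metis right_minus_eq)
  moreover have "ideal_on S ?I" by (rule ideal_central_multiples[OF D(1) d])
  ultimately have "?I = S" using D(5)[of ?I] by blast
  then obtain y where "y \<in> S" "u = ?d * y" using A(3) by blast
  thus ?thesis using centre_inverse[OF D(1) d] by metis
qed

lemma symmetric_central_scalar:
  assumes S: "algebra_with_involution S u \<sigma>" and x: "x \<in> centre S" "\<sigma> x = x"
  shows "\<exists>c. x = c *s u"
proof -
  note D = awiD[OF S]
  have "x \<in> scalars u" unfolding D(4) using x centreD(1) by (simp add: Sym_def)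
  thus ?thesis unfolding scalars_def by blast
qed

lemma centre_comm:
  assumes "a \<in> centre S" "b \<in> centre S"
  shows "a * b = b * a"
  using centreD(2)[OF assms(1) centreD(1)[OF assms(2)]] .

text \<open>
  A commutative algebra \<open>M\<close> on which \<open>\<sigma>\<close> behaves like the nontrivial automorphism of a quadratic
  etale algebra. Besides the centre this covers the algebra generated by the centre and a
  symmetric subfield.
\<close>

definition quadratic_over_sym :: "'a set \<Rightarrow> 'a \<Rightarrow> bool" where
  "quadratic_over_sym M u \<longleftrightarrow> algebra_on M u \<and> (\<forall>x\<in>M. \<forall>y\<in>M. x * y = y * x) \<and> (\<forall>x\<in>M. \<sigma> x \<in> M)
     \<and> (\<forall>x\<in>M. \<sigma> x \<noteq> x \<longrightarrow> (\<exists>y\<in>M. (x - \<sigma> x) * y = u))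
     \<and> (\<forall>x\<in>M. \<sigma> x = x \<and> x \<noteq> 0 \<longrightarrow> (\<exists>y\<in>M. \<sigma> y = y \<and> x * y = u))"

lemma quadratic_over_symD:
  assumes "quadratic_over_sym M u"
  shows "algebra_on M u" "\<And>x y. x \<in> M \<Longrightarrow> y \<in> M \<Longrightarrow> x * y = y * x" "\<forall>x\<in>M. \<sigma> x \<in> M"
    "\<And>x. x \<in> M \<Longrightarrow> \<sigma> x \<noteq> x \<Longrightarrow> \<exists>y\<in>M. (x - \<sigma> x) * y = u"
    "\<And>x. x \<in> M \<Longrightarrow> \<sigma> x = x \<Longrightarrow> x \<noteq> 0 \<Longrightarrow> \<exists>y\<in>M. \<sigma> y = y \<and> x * y = u"
proof -
  note d = assms[unfolded quadratic_over_sym_def]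
  show "algebra_on M u" by (rule d[THEN conjunct1])
  show "x * y = y * x" if "x \<in> M" "y \<in> M" for x y using d[THEN conjunct2, THEN conjunct1] that by blast
  show "\<forall>x\<in>M. \<sigma> x \<in> M" by (rule d[THEN conjunct2, THEN conjunct2, THEN conjunct1])
  show "\<exists>y\<in>M. (x - \<sigma> x) * y = u" if "x \<in> M" "\<sigma> x \<noteq> x" for x
    using d[THEN conjunct2, THEN conjunct2, THEN conjunct2, THEN conjunct1] that by blast
  show "\<exists>y\<in>M. \<sigma> y = y \<and> x * y = u" if "x \<in> M" "\<sigma> x = x" "x \<noteq> 0" for x
    using d[THEN conjunct2, THEN conjunct2, THEN conjunct2, THEN conjunct2] that by blast
qed

text \<open>Cramer's rule for the equations \<open>w = a + bz\<close> and \<open>\<sigma>(w) = a + b\<sigma>(z)\<close>.\<close>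

lemma quadratic_basis:
  assumes M: "quadratic_over_sym M u" and z: "z \<in> M" "\<sigma> z \<noteq> z" and w: "w \<in> M"
  shows "\<exists>a\<in>M. \<exists>b\<in>M. \<sigma> a = a \<and> \<sigma> b = b \<and> w = a + b * z"
proof -
  note D = quadratic_over_symD[OF M]
  note ZA = algebra_onD[OF D(1)]
  note comm = D(2)
  have sZ: "\<sigma> x \<in> M" if "x \<in> M" for x using D(3) that by blast
  let ?d = "z - \<sigma> z"
  obtain y where y: "y \<in> M" "?d * y = u" using D(4)[OF z] by blast
  have d: "?d \<in> M" using ZA(8) z(1) sZ by blast
  have "\<sigma> (?d * y) = u" using y(2) inv_unit[OF D(1,3)] by simp
  hence "\<sigma> y * (- ?d) = u" by (simp add: inv_mult inv_diff)
  hence "?d * - \<sigma> y = u" using comm[OF d sZ[OF y(1)]] by (simp only: mult_minus_right)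
  hence "?d * - \<sigma> y * y = u * y" by simp
  hence "?d * y * - \<sigma> y = u * y" using comm[OF sZ[OF y(1)] y(1)] by (simp add: mult.assoc)
  hence "u * - \<sigma> y = u * y" by (simp only: y(2))
  hence "- \<sigma> y = y" using ZA(4)[OF y(1)] ZA(4)[OF sZ[OF y(1)]] by (simp only: mult_minus_right)
  hence sy: "\<sigma> y = - y" by (metis minus_minus)
  define b where "b = (w - \<sigma> w) * y"
  have bZ: "b \<in> M" unfolding b_def using ZA(2,8) w sZ y(1) by blast
  have "\<sigma> b = - y * (\<sigma> w - w)" unfolding b_def by (simp add: inv_mult inv_diff sy)
  also have "\<dots> = y * (w - \<sigma> w)" by (simp add: right_diff_distrib)
  also have "\<dots> = b" unfolding b_def by (rule comm) (use ZA(8) w sZ y(1) in blast)+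
  finally have sb: "\<sigma> b = b" .
  have "b * ?d = (w - \<sigma> w) * (y * ?d)" unfolding b_def by (simp only: mult.assoc)
  hence bd: "b * ?d = w - \<sigma> w" using comm[OF y(1) d] y(2) ZA(5,8) w sZ by simp
  define a where "a = w - b * z"
  have aZ: "a \<in> M" unfolding a_def using ZA(2,8) w bZ z(1) by blast
  have "\<sigma> (b * z) = b * \<sigma> z" using comm[OF sZ[OF z(1)] bZ] by (simp add: inv_mult sb)
  hence "a - \<sigma> a = (w - \<sigma> w) - (b * z - b * \<sigma> z)" unfolding a_def by (simp add: inv_diff)
  also have "\<dots> = 0" using bd by (simp add: right_diff_distrib)
  finally have "\<sigma> a = a" by simp
  moreover have "w = a + b * z" unfolding a_def by simp
  ultimately show ?thesis using aZ bZ sb by blast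
qed

text \<open>
  A nonzero \<open>x\<close> that is not invertible has norm \<open>x \<sigma>(x) = 0\<close>, and dividing it by its trace gives an
  idempotent. A zero trace would make \<open>x\<close> a divisor of the invertible element \<open>x - \<sigma>(x) = 2x\<close>.
\<close>

lemma quadratic_not_field:
  assumes M: "quadratic_over_sym M u" "u \<noteq> 0" and nf: "\<not> field_on M u"
  obtains e where "e \<in> M" "e * e = e" "e + \<sigma> e = u" "e * \<sigma> e = 0" "e \<noteq> 0"
proof -
  note D = quadratic_over_symD[OF M(1)]
  note ZA = algebra_onD[OF D(1)]
  have sZ: "\<sigma> x \<in> M" if "x \<in> M" for x using D(3) that by blast
  obtain x where x: "x \<in> M" "x \<noteq> 0" and ni: "\<And>y. y \<in> M \<Longrightarrow> x * y \<noteq> u"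
    using nf D(1,2) M(2) unfolding field_on_def by blast
  have "x * \<sigma> x = 0"
  proof (rule ccontr)
    assume "x * \<sigma> x \<noteq> 0"
    moreover have "\<sigma> (x * \<sigma> x) = x * \<sigma> x" by (simp add: inv_mult)
    ultimately obtain y where y: "y \<in> M" "x * \<sigma> x * y = u" using D(5)[OF ZA(2)[OF x(1) sZ[OF x(1)]]] by blast
    thus False using ni[OF ZA(2)[OF sZ[OF x(1)] y(1)]] by (simp add: mult.assoc)
  qed
  have sx: "\<sigma> x \<noteq> x" using D(5)[OF x(1)] x(2) ni by blast
  define t where "t = x + \<sigma> x"
  have tM: "t \<in> M" unfolding t_def using ZA(7) x(1) sZ by blast
  have "t \<noteq> 0"
  proof
    assume "t = 0"
    hence m: "\<sigma> x = - x" unfolding t_def by (simp add: eq_neg_iff_add_eq_0 add.commute)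
    obtain y where y: "y \<in> M" "(x - \<sigma> x) * y = u" using D(4)[OF x(1) sx] by blast
    hence "x * (y + y) = u" using m by (simp add: distrib_left distrib_right)
    thus False using ni ZA(7)[OF y(1) y(1)] by blast
  qed
  moreover have "\<sigma> t = t" unfolding t_def by (simp add: inv_add add.commute)
  ultimately obtain t' where t': "t' \<in> M" "\<sigma> t' = t'" "t * t' = u" using D(5)[OF tM] by blast
  define e where "e = x * t'"
  have eM: "e \<in> M" unfolding e_def using ZA(2) x(1) t'(1) by blast
  have se: "\<sigma> e = \<sigma> x * t'" unfolding e_def using D(2)[OF sZ[OF x(1)] t'(1)] by (simp add: inv_mult t'(2))
  have es: "e + \<sigma> e = u" unfolding se unfolding e_def using t'(3) by (simp add: t_def distrib_right)
  have "e * \<sigma> e = x * (t' * \<sigma> x) * t'" unfolding se unfolding e_def by (simp only: mult.assoc)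
  also have "t' * \<sigma> x = \<sigma> x * t'" by (rule D(2)[OF t'(1) sZ[OF x(1)]])
  also have "x * (\<sigma> x * t') * t' = x * \<sigma> x * t' * t'" by (simp only: mult.assoc)
  finally have e0: "e * \<sigma> e = 0" using \<open>x * \<sigma> x = 0\<close> by simp
  have "e * (e + \<sigma> e) = e" unfolding es using ZA(5)[OF eM] .
  hence ee: "e * e = e" using e0 by (simp add: distrib_left)
  have "e * t = x"
  proof -
    have "e * t = x * (t * t')" unfolding e_def using D(2)[OF t'(1) tM] by (simp only: mult.assoc)
    thus ?thesis using t'(3) ZA(5)[OF x(1)] by simp
  qed
  hence "e \<noteq> 0" using x(2) by auto
  thus ?thesis using that[OF eM ee es e0] by blast
qed

lemma quadratic_centre:
  assumes S: "algebra_with_involution S u \<sigma>"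
  shows "quadratic_over_sym (centre S) u"
proof -
  note D = awiD[OF S]
  note ZA = algebra_onD[OF algebra_on_centre[OF D(1)]]
  have uu: "u * u = u" using ZA(3,4) by blast
  have "\<exists>y\<in>centre S. \<sigma> y = y \<and> x * y = u" if x: "x \<in> centre S" "\<sigma> x = x" "x \<noteq> 0" for x
  proof -
    obtain c where c: "x = c *s u" using symmetric_central_scalar[OF S x(1,2)] by blast
    hence "c \<noteq> 0" using x(3) by auto
    hence "x * (inverse c *s u) = u"
      unfolding c using uu by (simp add: scale_mult_left[symmetric] scale_mult_right[symmetric])
    moreover have "\<sigma> (inverse c *s u) = inverse c *s u" using inv_unit[OF D(1,3)] by (simp add: inv_scale)
    ultimately show ?thesis using ZA(3,10) by blast
  qed
  moreover have "\<forall>x\<in>centre S. \<sigma> x \<noteq> x \<longrightarrow> (\<exists>y\<in>centre S. (x - \<sigma> x) * y = u)"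
    using central_skew_invertible[OF S] by blast
  moreover have "\<forall>x\<in>centre S. \<forall>y\<in>centre S. x * y = y * x" using centre_comm by blast
  moreover have "\<forall>x\<in>centre S. \<sigma> x \<in> centre S" using inv_centre[OF D(3)] by blast
  ultimately show ?thesis unfolding quadratic_over_sym_def using algebra_on_centre[OF D(1)] by blast
qed

lemma centre_basis:
  assumes S: "algebra_with_involution S u \<sigma>" and z: "z \<in> centre S" "\<sigma> z \<noteq> z" and w: "w \<in> centre S"
  shows "\<exists>\<alpha> \<beta>. w = \<alpha> *s u + \<beta> *s z"
proof -
  note ZA = algebra_onD[OF algebra_on_centre[OF awiD(1)[OF S]]]
  obtain a b where ab: "a \<in> centre S" "b \<in> centre S" "\<sigma> a = a" "\<sigma> b = b" "w = a + b * z"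
    using quadratic_basis[OF quadratic_centre[OF S] z w] by blast
  obtain \<alpha> where "a = \<alpha> *s u" using symmetric_central_scalar[OF S ab(1,3)] by blast
  moreover obtain \<beta> where "b = \<beta> *s u" using symmetric_central_scalar[OF S ab(2,4)] by blast
  hence "b * z = \<beta> *s z" using ZA(4)[OF z(1)] by (simp add: scale_mult_left[symmetric])
  ultimately have "w = \<alpha> *s u + \<beta> *s z" using ab(5) by simp
  thus ?thesis by blast
qed

lemma not_first_kind:
  assumes S: "algebra_with_involution S u \<sigma>" and nf: "\<not> first_kind S u"
  obtains z where "z \<in> centre S" "\<sigma> z \<noteq> z"
proof -
  have "scalars u \<subseteq> centre S" using awiD(4)[OF S] by blast
  then obtain z where "z \<in> centre S" "z \<notin> scalars u" using nf unfolding first_kind_def by blast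
  thus ?thesis using symmetric_central_scalar[OF S] that unfolding scalars_def by blast
qed

lemma dim_centre_second:
  assumes S: "algebra_with_involution S u \<sigma>" and nf: "\<not> first_kind S u"
  shows "dim (centre S) = 2"
proof -
  note D = awiD[OF S]
  note ZA = algebra_onD[OF algebra_on_centre[OF D(1)]]
  obtain z where z: "z \<in> centre S" "\<sigma> z \<noteq> z" by (rule not_first_kind[OF S nf])
  have span: "centre S = span {u, z}"
  proof
    show "centre S \<subseteq> span {u, z}"
    proof
      fix w assume "w \<in> centre S"
      then obtain \<alpha> \<beta> where "w = \<alpha> *s u + \<beta> *s z" using centre_basis[OF S z] by blast
      thus "w \<in> span {u, z}" by (simp add: span_add span_scale span_base)
    qed
    show "span {u, z} \<subseteq> centre S" using ZA(1,3) z(1) by (intro span_minimal) auto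
  qed
  have "z \<notin> span {u}"
  proof
    assume "z \<in> span {u}"
    then obtain c where "z = c *s u" by (auto simp: span_singleton)
    thus False using z(2) inv_unit[OF D(1,3)] by (simp add: inv_scale)
  qed
  moreover have "independent {u}" using D(2) by simp
  ultimately have "independent {z, u}" using independent_insertI by blast
  moreover have "u \<noteq> z" using z(2) inv_unit[OF D(1,3)] by metis
  hence "card {u, z} = 2" by simp
  ultimately show ?thesis using span by (metis dim_span_eq_card_independent insert_commute)
qed

text \<open>The minimal polynomial of a central \<open>x\<close> that is not symmetric is \<open>(X - x)(X - \<sigma>(x))\<close>.\<close>

lemma separable_centre_field:
  assumes S: "algebra_with_involution S u \<sigma>" and F: "field_on (centre S) u"
  shows "finite_separable_extension (centre S) u"
  unfolding finite_separable_extension_def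
proof (intro conjI ballI)
  note D = awiD[OF S]
  note ZA = algebra_onD[OF algebra_on_centre[OF D(1)]]
  note sZ = inv_centre[OF D(3)]
  have uu: "u * u = u" using ZA(3,4) by blast
  show "field_on (centre S) u" by fact
  show "finite_dim (centre S)" by (rule finite_dim_subspace[OF ZA(1)])
  fix x assume x: "x \<in> centre S"
  show "\<exists>p. is_min_poly u x p \<and> coprime p (pderiv p)"
  proof (cases "\<sigma> x = x")
    case True
    then obtain c where "x = c *s u" using symmetric_central_scalar[OF S x] by blast
    hence "is_min_poly u x [:- c, 1:]" by (rule min_poly_scalar[OF uu D(2)])
    moreover have "coprime [:- c, 1:] (pderiv [:- c, 1:])" by (rule coprime_linear_pderiv)
    ultimately show ?thesis by blast
  next
    case False
    have "\<sigma> (x * \<sigma> x) = x * \<sigma> x" by (simp add: inv_mult)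
    then obtain \<nu> where \<nu>: "x * \<sigma> x = \<nu> *s u"
      using symmetric_central_scalar[OF S ZA(2)[OF x sZ[OF x]]] by blast
    have "\<sigma> (x + \<sigma> x) = x + \<sigma> x" by (simp add: inv_add add.commute)
    then obtain \<tau> where \<tau>: "x + \<sigma> x = \<tau> *s u"
      using symmetric_central_scalar[OF S ZA(7)[OF x sZ[OF x]]] by blast
    let ?p = "[:\<nu>, - \<tau>, 1:]"
    have cx: "\<sigma> x * x = x * \<sigma> x" by (rule centre_comm[OF sZ[OF x] x])
    have "u * x = x" using ZA(4)[OF x] .
    have "u * (x * x) = x * x" using ZA(4) ZA(2)[OF x x] by blast
    have "eval_on u ?p x = \<nu> *s u - \<tau> *s u * x + x * x"
      using ZA(4)[OF x] \<open>u * (x * x) = x * x\<close>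
      by (simp add: eval_on_poly_at poly_at_pCons distrib_left right_diff_distrib
          scale_mult_left[symmetric] scale_mult_right[symmetric])
    also have "\<dots> = 0" unfolding \<nu>[symmetric] \<tau>[symmetric] by (simp add: distrib_right cx)
    finally have ev: "eval_on u ?p x = 0" .
    have "2 \<le> degree q" if q: "q \<noteq> 0" "eval_on u q x = 0" for q
    proof (rule ccontr)
      assume "\<not> 2 \<le> degree q"
      hence "degree q \<le> 1" by simp
      hence "poly_at q x = coeff q 0 *s 1 + coeff q 1 *s x" by (simp add: poly_at_bound)
      hence 0: "coeff q 0 *s u + coeff q 1 *s x = 0"
        using q(2) ZA(4)[OF x] by (simp add: eval_on_poly_at distrib_left scale_mult_right[symmetric])
      hence "\<sigma> (coeff q 0 *s u + coeff q 1 *s x) = 0" by simp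
      hence "coeff q 0 *s u + coeff q 1 *s \<sigma> x = 0" using inv_unit[OF D(1,3)] by (simp add: inv_add inv_scale)
      hence "coeff q 1 *s x = coeff q 1 *s \<sigma> x" using 0 by (metis add_left_cancel)
      hence c1: "coeff q 1 = 0" using False by (metis scale_cancel_left)
      hence c0: "coeff q 0 = 0" using 0 D(2) by simp
      have "coeff q n = 0" for n
        using c0 c1 \<open>degree q \<le> 1\<close> by (cases "n = 0"; cases "n = 1") (auto intro: coeff_eq_0)
      thus False using q(1) by (simp add: poly_eq_iff)
    qed
    hence "\<forall>q. q \<noteq> 0 \<and> eval_on u q x = 0 \<longrightarrow> degree ?p \<le> degree q" by (simp add: numeral_2_eq_2)
    moreover have "lead_coeff ?p = 1" by simp
    ultimately have "is_min_poly u x ?p" using ev unfolding is_min_poly_def by blast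
    moreover have "coprime ?p (pderiv ?p)"
    proof (rule coprimeI)
      fix c assume c: "c dvd ?p" "c dvd pderiv ?p"
      \<comment> \<open>the discriminant is \<open>p'\<^sup>2 - 4p\<close>, and it is the square of \<open>x - \<sigma>(x)\<close>\<close>
      have "c dvd pderiv ?p * pderiv ?p - 4 * ?p" using c by (intro dvd_diff dvd_mult)
      also have "pderiv ?p * pderiv ?p - 4 * ?p = [:\<tau> * \<tau> - 4 * \<nu>:]"
        by (simp add: pderiv_pCons numeral_poly algebra_simps)
      finally have dv: "c dvd [:\<tau> * \<tau> - 4 * \<nu>:]" .
      have "(x - \<sigma> x) * (x - \<sigma> x) = (x + \<sigma> x) * (x + \<sigma> x) - (x * \<sigma> x + x * \<sigma> x + x * \<sigma> x + x * \<sigma> x)"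
        by (simp add: distrib_left distrib_right left_diff_distrib right_diff_distrib cx)
      also have "\<dots> = (\<tau> * \<tau> - 4 * \<nu>) *s u"
      proof -
        have "4 * \<nu> = \<nu> + \<nu> + \<nu> + \<nu>" by simp
        thus ?thesis unfolding \<nu> \<tau> using uu
          by (simp only: scale_left_diff_distrib scale_left_distrib)
            (simp add: scale_mult_left[symmetric] scale_mult_right[symmetric])
      qed
      finally have sq: "(x - \<sigma> x) * (x - \<sigma> x) = (\<tau> * \<tau> - 4 * \<nu>) *s u" .
      have "\<tau> * \<tau> - 4 * \<nu> \<noteq> 0"
      proof
        assume "\<tau> * \<tau> - 4 * \<nu> = 0"
        hence z: "(x - \<sigma> x) * (x - \<sigma> x) = 0" using sq by simp
        obtain y where y: "y \<in> centre S" "(x - \<sigma> x) * y = u" using central_skew_invertible[OF S x False] by blast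
        have "x - \<sigma> x = (x - \<sigma> x) * ((x - \<sigma> x) * y)" unfolding y(2) using ZA(5,8) x sZ by simp
        also have "\<dots> = 0" using z by (simp add: mult.assoc[symmetric])
        finally show False using False by simp
      qed
      hence "[:\<tau> * \<tau> - 4 * \<nu>:] dvd 1" by (simp add: is_unit_triv)
      thus "is_unit c" using dv dvd_trans by blast
    qed
    ultimately show ?thesis by blast
  qed
qed

lemma second_kind_if_not_first:
  assumes S: "algebra_with_involution S u \<sigma>" and nf: "\<not> first_kind S u"
  shows "second_kind S u"
  unfolding second_kind_def
proof
  note D = awiD[OF S]
  note Z = algebra_on_centre[OF D(1)]
  note ZA = algebra_onD[OF Z]
  note sZ = inv_centre[OF D(3)]
  show "dim (centre S) = 2" by (rule dim_centre_second[OF S nf])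
  show "etale (centre S) u"
  proof (cases "field_on (centre S) u")
    case True
    let ?\<phi> = "\<lambda>x. \<lambda>i\<in>{..<1::nat}. x"
    have "bij_betw ?\<phi> (centre S) (\<Pi>\<^sub>E i\<in>{..<1}. centre S)"
    proof (rule bij_betwI[where g = "\<lambda>f. f 0"])
      show "?\<phi> (f 0) = f" if "f \<in> (\<Pi>\<^sub>E i\<in>{..<1}. centre S)" for f
        using that by (intro PiE_ext[of _ "{..<1}" "\<lambda>_. centre S"]) auto
    qed auto
    thus ?thesis unfolding etale_def using Z separable_centre_field[OF S True]
      by (intro conjI exI[of _ "1::nat"] exI[of _ "\<lambda>_. centre S"] exI[of _ "\<lambda>_. u"] exI[of _ ?\<phi>]) simp_all
  next
    case False
    obtain e where e: "e \<in> centre S" "e * e = e" "e + \<sigma> e = u" "e * \<sigma> e = 0" "e \<noteq> 0"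
      by (rule quadratic_not_field[OF quadratic_centre[OF S] D(2) False])
    have "\<sigma> e * \<sigma> e = \<sigma> e" using e(2) by (metis inv_mult)
    moreover have "\<sigma> e \<noteq> 0" using e(5) by (metis inv_0 inv_inv)
    moreover have "\<sigma> e * e = 0" using e(4) centre_comm[OF sZ[OF e(1)] e(1)] by simp
    ultimately have se: "\<sigma> e * \<sigma> e = \<sigma> e" "\<sigma> e \<noteq> 0" "\<sigma> e * e = 0" .
    have ne: "\<sigma> e \<noteq> e" using e(2,4,5) by auto
    have eC: "e * (x * y) = (e * x) * (e * y)" if x: "x \<in> centre S" "y \<in> centre S" for x y
    proof -
      have "(e * x) * (e * y) = e * (x * e) * y" by (simp only: mult.assoc)
      also have "\<dots> = e * e * x * y" using centre_comm[OF x(1) e(1)] by (simp only: mult.assoc)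
      finally show ?thesis using e(2) by (simp add: mult.assoc)
    qed
    have sC: "\<sigma> e * (x * y) = (\<sigma> e * x) * (\<sigma> e * y)" if x: "x \<in> centre S" "y \<in> centre S" for x y
    proof -
      have "(\<sigma> e * x) * (\<sigma> e * y) = \<sigma> e * (x * \<sigma> e) * y" by (simp only: mult.assoc)
      also have "\<dots> = \<sigma> e * \<sigma> e * x * y" using centre_comm[OF x(1) sZ[OF e(1)]] by (simp only: mult.assoc)
      finally show ?thesis using se(1) by (simp add: mult.assoc)
    qed
    have scal: "e * w \<in> scalars e" "\<sigma> e * w \<in> scalars (\<sigma> e)" if w: "w \<in> centre S" for w
    proof -
      obtain \<alpha> \<beta> where ab: "w = \<alpha> *s u + \<beta> *s e" using centre_basis[OF S e(1) ne w] by blast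
      have "e * w = (\<alpha> + \<beta>) *s e"
        unfolding ab using ZA(5)[OF e(1)] e(2) by (simp add: distrib_left scale_mult_right[symmetric] scale_left_distrib)
      thus "e * w \<in> scalars e" unfolding scalars_def by blast
      have "\<sigma> e * w = \<alpha> *s \<sigma> e"
        unfolding ab using ZA(5)[OF sZ[OF e(1)]] se(3) by (simp add: distrib_left scale_mult_right[symmetric])
      thus "\<sigma> e * w \<in> scalars (\<sigma> e)" unfolding scalars_def by blast
    qed
    let ?K = "\<lambda>i. if i = (0::nat) then scalars e else scalars (\<sigma> e)"
    let ?v = "\<lambda>i. if i = (0::nat) then e else \<sigma> e"
    let ?\<phi> = "\<lambda>x. \<lambda>i\<in>{..<2::nat}. ?v i * x"
    have "bij_betw ?\<phi> (centre S) (\<Pi>\<^sub>E i\<in>{..<2}. ?K i)"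
    proof (rule bij_betwI[where g = "\<lambda>f. f 0 + f 1"])
      show "?\<phi> \<in> centre S \<rightarrow> (\<Pi>\<^sub>E i\<in>{..<2}. ?K i)" using scal by auto
      have sub: "scalars e \<subseteq> centre S" "scalars (\<sigma> e) \<subseteq> centre S"
        unfolding scalars_def using ZA(10) e(1) sZ by auto
      have K01: "f 0 \<in> scalars e" "f 1 \<in> scalars (\<sigma> e)" if "f \<in> (\<Pi>\<^sub>E i\<in>{..<2::nat}. ?K i)" for f
        using PiE_mem[OF that, of 0] PiE_mem[OF that, of 1] by simp_all
      show "(\<lambda>f. f 0 + f 1) \<in> (\<Pi>\<^sub>E i\<in>{..<2}. ?K i) \<rightarrow> centre S"
        using K01 sub ZA(7) by blast
      show "?\<phi> x 0 + ?\<phi> x 1 = x" if "x \<in> centre S" for x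
        using ZA(4)[OF that] by (simp add: distrib_right[symmetric] e(3))
      show "?\<phi> (f 0 + f 1) = f" if f: "f \<in> (\<Pi>\<^sub>E i\<in>{..<2}. ?K i)" for f
      proof
        fix i :: nat
        obtain a b where ab: "f 0 = a *s e" "f 1 = b *s \<sigma> e" using K01[OF f] unfolding scalars_def by blast
        have "i = 0 \<or> i = 1 \<or> \<not> i < 2" by auto
        thus "?\<phi> (f 0 + f 1) i = f i"
          using ab e(2,4) se PiE_arb[OF f, of i] by (auto simp: distrib_left scale_mult_right[symmetric])
      qed
    qed
    moreover have "\<forall>i<2. finite_separable_extension (?K i) (?v i)"
      using separable_extension_scalars[OF e(2,5)] separable_extension_scalars[OF se(1,2)] by simp
    moreover have "\<forall>i<2. ?\<phi> u i = ?v i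
           \<and> (\<forall>x\<in>centre S. \<forall>y\<in>centre S. ?\<phi> (x + y) i = ?\<phi> x i + ?\<phi> y i)
           \<and> (\<forall>x\<in>centre S. \<forall>y\<in>centre S. ?\<phi> (x * y) i = ?\<phi> x i * ?\<phi> y i)
           \<and> (\<forall>c. \<forall>x\<in>centre S. ?\<phi> (c *s x) i = c *s ?\<phi> x i)"
      using eC sC ZA(5)[OF e(1)] ZA(5)[OF sZ[OF e(1)]] by (simp add: distrib_left scale_mult_right)
    ultimately show ?thesis unfolding etale_def using Z
      by (intro conjI exI[of _ "2::nat"] exI[of _ ?K] exI[of _ ?v] exI[of _ ?\<phi>]) blast+
  qed
qed

end

subsection \<open>Simplicity and degree\<close>

context fd_involution
begin

text \<open>
  If \<open>I\<close> is a proper nonzero ideal, then \<open>S = I \<oplus> \<sigma>(I)\<close>, and the component of \<open>u\<close> in \<open>I\<close> is a central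
  idempotent which is not invertible.
\<close>

lemma simple_if_centre_field:
  assumes S: "algebra_with_involution S u \<sigma>" and F: "field_on (centre S) u"
  shows "simple_alg S u"
  unfolding simple_alg_def
proof (intro conjI allI impI)
  note D = awiD[OF S]
  note A = algebra_onD[OF D(1)]
  show "algebra_on S u" "u \<noteq> 0" by (rule D(1,2))+
  fix I assume I: "ideal_on S I"
  note ID = ideal_onD[OF I]
  let ?J = "{x \<in> I. \<sigma> x \<in> I}"
  have "ideal_on S ?J"
  proof (rule ideal_onI)
    fix a x assume a: "a \<in> S" and x: "x \<in> ?J"
    have "\<sigma> a \<in> S" using D(3) a by blast
    thus "a * x \<in> ?J" "x * a \<in> ?J" using ID(4,5) a x by (auto simp: inv_mult)
  qed (use ID(1-3) in \<open>auto simp: inv_diff\<close>)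
  moreover have "\<sigma> ` ?J = ?J" by (rule inv_image_eq) simp
  ultimately have J: "?J = {0} \<or> ?J = S" using D(5) by blast
  let ?P = "{x + \<sigma> y | x y. x \<in> I \<and> y \<in> I}"
  have P: "ideal_on S ?P"
  proof (rule ideal_onI)
    show "?P \<subseteq> S" using ID(1) D(3) A(7) by blast
    show "0 \<in> ?P" using ID(2) by (intro CollectI exI[of _ 0]) simp
    fix p q assume "p \<in> ?P" "q \<in> ?P"
    then obtain x y x' y' where h: "x \<in> I" "y \<in> I" "p = x + \<sigma> y" "x' \<in> I" "y' \<in> I" "q = x' + \<sigma> y'" by blast
    have "p - q = (x - x') + \<sigma> (y - y')" using h by (simp add: inv_diff)
    thus "p - q \<in> ?P" using h ID(3) by blast
  next
    fix a p assume a: "a \<in> S" and "p \<in> ?P"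
    then obtain x y where h: "x \<in> I" "y \<in> I" "p = x + \<sigma> y" by blast
    have sa: "\<sigma> a \<in> S" using D(3) a by blast
    have "a * p = a * x + \<sigma> (y * \<sigma> a)" "p * a = x * a + \<sigma> (\<sigma> a * y)"
      using h by (simp_all add: inv_mult distrib_left distrib_right)
    thus "a * p \<in> ?P" "p * a \<in> ?P" using h ID(4,5) a sa by blast+
  qed
  have "\<sigma> ` ?P = ?P"
  proof (rule inv_image_eq)
    fix p assume "p \<in> ?P"
    then obtain x y where h: "x \<in> I" "y \<in> I" "p = x + \<sigma> y" by blast
    hence "\<sigma> p = y + \<sigma> x" by (simp add: inv_add add.commute)
    thus "\<sigma> p \<in> ?P" using h by blast
  qed
  hence P': "?P = {0} \<or> ?P = S" using D(5)[OF P] by blast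
  show "I = {0} \<or> I = S"
  proof (rule ccontr)
    assume n: "\<not> (I = {0} \<or> I = S)"
    then obtain x0 where x0: "x0 \<in> I" "x0 \<noteq> 0" using ID(2) by blast
    have J0: "?J = {0}" using J n ID(1) by blast
    have "x0 = x0 + \<sigma> 0" by simp
    hence "x0 \<in> ?P" using x0(1) ID(2) by blast
    hence "?P = S" using P' x0(2) by blast
    hence "u \<in> ?P" using A(3) by simp
    then obtain a b where ab: "a \<in> I" "b \<in> I" "u = a + \<sigma> b" by blast
    have bS: "\<sigma> b \<in> S" using ID(1) ab(2) D(3) by blast
    have z: "x * a = x" "a * x = x" if x: "x \<in> I" for x
    proof -
      have xS: "x \<in> S" "\<sigma> x \<in> S" using ID(1) x D(3) by blast+
      have "x * \<sigma> b \<in> ?J" "\<sigma> b * x \<in> ?J"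
        using ID(4,5) x ab(2) xS bS by (auto simp: inv_mult)
      hence "x * \<sigma> b = 0" "\<sigma> b * x = 0" using J0 by blast+
      moreover have "x * (a + \<sigma> b) = x" "(a + \<sigma> b) * x = x" using ab(3) A(4,5) xS(1) by simp_all
      ultimately show "x * a = x" "a * x = x" by (simp_all add: distrib_left distrib_right)
    qed
    have "a \<in> centre S"
    proof (rule centreI)
      show "a \<in> S" using ID(1) ab(1) by blast
      fix s assume s: "s \<in> S"
      have "a * s = a * s * a" by (rule sym, rule z(1)[OF ID(5)[OF s ab(1)]])
      also have "\<dots> = s * a" using z(2)[OF ID(4)[OF s ab(1)]] by (simp only: mult.assoc)
      finally show "a * s = s * a" .
    qed
    moreover have "a \<noteq> 0" using z(1)[OF x0(1)] x0(2) by auto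
    ultimately obtain y where y: "y \<in> centre S" "a * y = u" using field_onD(4)[OF F] by blast
    hence "u \<in> I" using ID(5)[OF centreD(1)[OF y(1)] ab(1)] by simp
    thus False using ideal_eq_carrier_if_unit[OF D(1) I] n by blast
  qed
qed

lemma ideal_on_subset: "ideal_on S I \<Longrightarrow> I \<subseteq> T \<Longrightarrow> T \<subseteq> S \<Longrightarrow> ideal_on T I"
  unfolding ideal_on_def by (simp add: subset_iff)

text \<open>Such an \<open>e\<close> identifies the centre with two copies of the base field that \<open>\<sigma>\<close> exchanges.\<close>

definition split_idempotent :: "'a set \<Rightarrow> 'a \<Rightarrow> 'a \<Rightarrow> bool" where
  "split_idempotent S u e \<longleftrightarrow> e \<in> centre S \<and> e * e = e \<and> e + \<sigma> e = u \<and> e * \<sigma> e = 0 \<and> e \<noteq> 0"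

lemma split_idempotentD:
  assumes "split_idempotent S u e"
  shows "e \<in> centre S" "e * e = e" "e + \<sigma> e = u" "e * \<sigma> e = 0" "e \<noteq> 0"
  using assms unfolding split_idempotent_def by blast+

lemma split_idempotent_inv:
  assumes S: "algebra_with_involution S u \<sigma>" and e: "split_idempotent S u e"
  shows "split_idempotent S u (\<sigma> e)"
proof -
  note e = split_idempotentD[OF e]
  have "\<sigma> e \<in> centre S" by (rule inv_centre[OF awiD(3)[OF S] e(1)])
  moreover have "\<sigma> e * \<sigma> e = \<sigma> e" using e(2) by (metis inv_mult)
  moreover have "\<sigma> e + \<sigma> (\<sigma> e) = u" using e(3) by (simp add: add.commute)
  moreover have "\<sigma> e * \<sigma> (\<sigma> e) = 0" using e(4) centre_comm[OF calculation(1) e(1)] by simp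
  moreover have "\<sigma> e \<noteq> 0" using e(5) by (metis inv_0 inv_inv)
  ultimately show ?thesis unfolding split_idempotent_def by blast
qed

lemma split_idempotent_exists:
  assumes S: "algebra_with_involution S u \<sigma>" and "\<not> field_on (centre S) u"
  obtains e where "split_idempotent S u e"
  using quadratic_not_field[OF quadratic_centre[OF S] awiD(2)[OF S] assms(2)]
  unfolding split_idempotent_def by metis

lemma corner_central:
  assumes S: "algebra_on S u" and e: "e \<in> centre S" "e * e = e"
  shows "corner S e = (\<lambda>x. e * x) ` S" "corner S e = {x \<in> S. e * x = x}"
proof -
  note A = algebra_onD[OF S]
  have eS: "e \<in> S" using centreD(1)[OF e(1)] .
  have "e * x * e = e * x" if "x \<in> S" for x
  proof -
    have "e * (x * e) = e * (e * x)" using centreD(2)[OF e(1) that] by simp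
    hence "e * x * e = e * (e * x)" by (simp only: mult.assoc)
    thus ?thesis using e(2) by (simp add: mult.assoc[symmetric])
  qed
  hence "(\<lambda>x. e * x * e) ` S = (\<lambda>x. e * x) ` S" by (intro image_cong) simp_all
  thus *: "corner S e = (\<lambda>x. e * x) ` S" unfolding corner_def Setcompr_eq_image .
  show "corner S e = {x \<in> S. e * x = x}" unfolding *
  proof
    show "(\<lambda>x. e * x) ` S \<subseteq> {x \<in> S. e * x = x}"
      using A(2)[OF eS] e(2) by (auto simp: mult.assoc[symmetric])
    show "{x \<in> S. e * x = x} \<subseteq> (\<lambda>x. e * x) ` S" by force
  qed
qed

text \<open>
  For an ideal \<open>I\<close> of \<open>eS\<close>, the ideal \<open>I + \<sigma>(I)\<close> of \<open>S\<close> is \<open>\<sigma>\<close>-stable; it consists of the \<open>s\<close> with \<open>es\<close>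
  and \<open>e\<sigma>(s)\<close> in \<open>I\<close>.
\<close>

lemma split_corner_simple:
  assumes S: "algebra_with_involution S u \<sigma>" and e: "split_idempotent S u e"
  shows "simple_alg (corner S e) e"
  unfolding simple_alg_def
proof (intro conjI allI impI)
  note D = awiD[OF S]
  note A = algebra_onD[OF D(1)]
  note e = split_idempotentD[OF e]
  note eS = centreD(1)[OF e(1)]
  note c = corner_central[OF D(1) e(1,2)]
  show alg: "algebra_on (corner S e) e" by (rule algebra_on_corner[OF D(1) eS e(2)])
  show "e \<noteq> 0" by (rule e(5))
  fix I assume I: "ideal_on (corner S e) I"
  note ID = ideal_onD[OF I]
  have em: "e * (x * y) = (e * x) * (e * y)" if "x \<in> S" "y \<in> S" for x y
  proof -
    have "(e * x) * (e * y) = e * (x * e) * y" by (simp only: mult.assoc)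
    also have "\<dots> = e * e * x * y" using centreD(2)[OF e(1) that(1)] by (simp only: mult.assoc)
    finally show ?thesis using e(2) by (simp add: mult.assoc)
  qed
  let ?J = "{s \<in> S. e * s \<in> I \<and> e * \<sigma> s \<in> I}"
  have J: "ideal_on S ?J"
  proof (rule ideal_onI)
    fix a s assume a: "a \<in> S" and s: "s \<in> ?J"
    have ea: "e * a \<in> corner S e" "e * \<sigma> a \<in> corner S e" using a D(3) c(1) by blast+
    have sS: "s \<in> S" "\<sigma> s \<in> S" "\<sigma> a \<in> S" using s a D(3) by blast+
    show "a * s \<in> ?J" "s * a \<in> ?J"
      using ID(4)[OF ea(1)] ID(5)[OF ea(1)] ID(4)[OF ea(2)] ID(5)[OF ea(2)] s A(2) a
      by (auto simp: inv_mult em[OF a sS(1)] em[OF sS(1) a] em[OF sS(2,3)] em[OF sS(3,2)])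
  qed (use A(6,8) ID(2,3) in \<open>auto simp: inv_diff right_diff_distrib\<close>)
  have "\<sigma> ` ?J = ?J" by (rule inv_image_eq) (use D(3) in simp)
  hence J': "?J = {0} \<or> ?J = S" using D(5)[OF J] by blast
  show "I = {0} \<or> I = corner S e"
  proof (cases "I = {0}")
    case False
    then obtain x where x: "x \<in> I" "x \<noteq> 0" using ID(2) by blast
    have xS: "x \<in> S" "e * x = x" using ID(1) x(1) c(2) by blast+
    have "e * \<sigma> x = e * \<sigma> (e * x)" using xS(2) by simp
    also have "\<dots> = e * (\<sigma> x * \<sigma> e)" by (simp only: inv_mult)
    also have "\<dots> = (\<sigma> x * e) * \<sigma> e" using centreD(2)[OF e(1), of "\<sigma> x"] D(3) xS(1) by (simp add: mult.assoc[symmetric])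
    also have "\<dots> = 0" using e(4) by (simp add: mult.assoc)
    finally have "x \<in> ?J" using x(1) xS ID(2) by simp
    hence "?J = S" using J' x(2) by blast
    hence "e * e \<in> I" using eS by blast
    thus ?thesis using ideal_eq_carrier_if_unit[OF alg I] e(2) by simp
  qed blast
qed

lemma split_corner_centre:
  assumes S: "algebra_with_involution S u \<sigma>" and e: "split_idempotent S u e"
  shows "centre (corner S e) = scalars e"
proof
  note D = awiD[OF S]
  note A = algebra_onD[OF D(1)]
  note e' = split_idempotentD[OF e]
  note eS = centreD(1)[OF e'(1)]
  note c = corner_central[OF D(1) e'(1,2)]
  have alg: "algebra_on (corner S e) e" by (rule algebra_on_corner[OF D(1) eS e'(2)])
  show "scalars e \<subseteq> centre (corner S e)"
  proof
    fix x assume "x \<in> scalars e"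
    then obtain k where x: "x = k *s e" unfolding scalars_def by blast
    have "x \<in> corner S e" unfolding x by (rule algebra_onD(10)[OF alg algebra_onD(3)[OF alg]])
    thus "x \<in> centre (corner S e)"
      by (rule centreI)
        (use algebra_onD(4,5)[OF alg] x in \<open>simp add: scale_mult_left[symmetric] scale_mult_right[symmetric]\<close>)
  qed
  show "centre (corner S e) \<subseteq> scalars e"
  proof
    fix x assume x: "x \<in> centre (corner S e)"
    have xS: "x \<in> S" "e * x = x" using centreD(1)[OF x] c(2) by blast+
    have xe: "x * e = x" using centreD(2)[OF e'(1) xS(1)] xS(2) by simp
    have "x \<in> centre S"
    proof (rule centreI[OF xS(1)])
      fix s assume s: "s \<in> S"
      have "x * s = x * (e * s)" using xe by (simp add: mult.assoc[symmetric])
      also have "\<dots> = e * s * x" by (rule centreD(2)[OF x]) (use c(1) s in blast)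
      also have "\<dots> = s * e * x" using centreD(2)[OF e'(1) s] by simp
      finally show "x * s = s * x" using xS(2) by (simp add: mult.assoc)
    qed
    moreover have "\<sigma> e \<noteq> e" using e'(2,4,5) by auto
    ultimately obtain \<alpha> \<beta> where "x = \<alpha> *s u + \<beta> *s e" using centre_basis[OF S e'(1)] by blast
    hence "e * x = (\<alpha> + \<beta>) *s e"
      using A(5)[OF eS] e'(2) by (simp add: distrib_left scale_mult_right[symmetric] scale_left_distrib)
    thus "x \<in> scalars e" using xS(2) unfolding scalars_def by auto
  qed
qed

lemma split_corner_dim:
  assumes S: "algebra_with_involution S u \<sigma>" and e: "split_idempotent S u e"
  shows "dim S = 2 * dim (corner S e)"
proof -
  note D = awiD[OF S]
  note A = algebra_onD[OF D(1)]
  note e' = split_idempotentD[OF e]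
  note f' = split_idempotentD[OF split_idempotent_inv[OF S e]]
  note c = corner_central[OF D(1) e'(1,2)]
  note d = corner_central[OF D(1) f'(1,2)]
  have sub: "subspace (corner S e)" "subspace (corner S (\<sigma> e))"
    unfolding c(1) d(1) by (rule subspace_image_lin[OF lin_mult_left A(1)])+
  have "bij_betw \<sigma> (corner S e) (corner S (\<sigma> e))"
  proof (rule bij_betwI[where g = \<sigma>])
    show "\<sigma> \<in> corner S e \<rightarrow> corner S (\<sigma> e)" "\<sigma> \<in> corner S (\<sigma> e) \<rightarrow> corner S e"
      using D(3) unfolding corner_def by (auto simp: inv_mult mult.assoc)
  qed simp_all
  hence "dim (corner S (\<sigma> e)) = dim (corner S e)" by (rule dim_bij_eq[OF lin_inv sub(1)])
  moreover have "corner S e \<inter> corner S (\<sigma> e) = {0}"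
  proof -
    have "x = 0" if "x \<in> corner S e" "x \<in> corner S (\<sigma> e)" for x
    proof -
      have "e * x = x" "\<sigma> e * x = x" using that c(2) d(2) by blast+
      hence "x = e * \<sigma> e * x" by (simp add: mult.assoc)
      thus ?thesis using e'(4) by simp
    qed
    thus ?thesis using subspace_0[OF sub(1)] subspace_0[OF sub(2)] by blast
  qed
  moreover have "S = {x + y | x y. x \<in> corner S e \<and> y \<in> corner S (\<sigma> e)}"
  proof
    show "S \<subseteq> {x + y | x y. x \<in> corner S e \<and> y \<in> corner S (\<sigma> e)}"
    proof
      fix s assume s: "s \<in> S"
      have "s = e * s + \<sigma> e * s" using A(4)[OF s] e'(3) by (simp add: distrib_right[symmetric])
      thus "s \<in> {x + y | x y. x \<in> corner S e \<and> y \<in> corner S (\<sigma> e)}"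
        unfolding c(1) d(1) using s by blast
    qed
    show "{x + y | x y. x \<in> corner S e \<and> y \<in> corner S (\<sigma> e)} \<subseteq> S"
      using c(2) d(2) A(7) by blast
  qed
  ultimately show ?thesis using dim_direct_sum[OF sub] by simp
qed

text \<open>A minimal ideal \<open>B\<close> contains the ideals \<open>eB\<close> and \<open>\<sigma>(e)B\<close>, so it is equal to one of them.\<close>

lemma simple_component_split:
  assumes S: "algebra_with_involution S u \<sigma>" and e: "split_idempotent S u e" and B: "simple_component S B"
  shows "B = corner S e \<or> B = corner S (\<sigma> e)"
proof -
  note D = awiD[OF S]
  note A = algebra_onD[OF D(1)]
  have B': "ideal_on S B" "B \<noteq> {0}" and min: "\<And>I. ideal_on S I \<Longrightarrow> I \<subseteq> B \<Longrightarrow> I = {0} \<or> I = B"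
    using B unfolding simple_component_def by blast+
  note BD = ideal_onD[OF B'(1)]
  have eq: "B = corner S f" if f: "split_idempotent S u f" and sub: "\<forall>x\<in>B. f * x = x" for f
  proof -
    note f' = split_idempotentD[OF f]
    note c = corner_central[OF D(1) f'(1,2)]
    have "ideal_on (corner S f) B"
    proof (rule ideal_on_subset[OF B'(1)])
      show "B \<subseteq> corner S f" "corner S f \<subseteq> S" unfolding c(2) using BD(1) sub by blast+
    qed
    thus ?thesis using simple_algD(3)[OF split_corner_simple[OF S f]] B'(2) by blast
  qed
  note e' = split_idempotentD[OF e]
  have "ideal_on S {x \<in> B. e * x = x}"
  proof (rule ideal_onI)
    fix a x assume a: "a \<in> S" and x: "x \<in> {x \<in> B. e * x = x}"
    have "e * (a * x) = a * (e * x)" using centreD(2)[OF e'(1) a] by (simp only: mult.assoc[symmetric])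
    thus "a * x \<in> {x \<in> B. e * x = x}" using x BD(4)[OF a] by simp
    show "x * a \<in> {x \<in> B. e * x = x}" using x BD(5)[OF a] by (simp add: mult.assoc[symmetric])
  qed (use BD(1-3) in \<open>auto simp: right_diff_distrib\<close>)
  hence "{x \<in> B. e * x = x} = {0} \<or> {x \<in> B. e * x = x} = B" using min by blast
  thus ?thesis
  proof
    assume "{x \<in> B. e * x = x} = B"
    thus ?thesis using eq[OF e] by blast
  next
    assume 0: "{x \<in> B. e * x = x} = {0}"
    have "\<sigma> e * x = x" if x: "x \<in> B" for x
    proof -
      have "e * x \<in> {x \<in> B. e * x = x}"
        using BD(4)[OF centreD(1)[OF e'(1)] x] e'(2) by (simp add: mult.assoc[symmetric])
      hence "e * x = 0" using 0 by blast
      moreover have "(e + \<sigma> e) * x = x" using e'(3) A(4) BD(1) x by auto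
      ultimately show ?thesis by (simp add: distrib_right)
    qed
    thus ?thesis using eq[OF split_idempotent_inv[OF S e]] by blast
  qed
qed

lemma simple_component_exists:
  assumes S: "algebra_with_involution S u \<sigma>" and e: "split_idempotent S u e"
  shows "simple_component S (corner S e)"
  unfolding simple_component_def
proof (intro conjI allI impI; (elim conjE)?)
  note D = awiD[OF S]
  note e' = split_idempotentD[OF e]
  note c = corner_central[OF D(1) e'(1,2)]
  show "ideal_on S (corner S e)" unfolding c(1) by (rule ideal_central_multiples[OF D(1) e'(1)])
  show "corner S e \<noteq> {0}" using c(2) centreD(1)[OF e'(1)] e'(2,5) by blast
  fix I assume I: "ideal_on S I" "I \<subseteq> corner S e"
  have "ideal_on (corner S e) I"
    by (rule ideal_on_subset[OF I]) (use c(2) in blast)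
  thus "I = {0} \<or> I = corner S e" using simple_algD(3)[OF split_corner_simple[OF S e]] by blast
qed

lemma deg_first_kind:
  assumes S: "algebra_with_involution S u \<sigma>" and "first_kind S u"
  shows "(deg S u)\<^sup>2 = dim S" "field_on (centre S) u" "dim (centre S) = 1" "deg S u \<ge> 0"
proof -
  note D = awiD[OF S]
  note A = algebra_onD[OF D(1)]
  have Z: "centre S = scalars u" using assms(2) unfolding first_kind_def .
  show F: "field_on (centre S) u" unfolding Z by (rule field_on_scalars[OF A(4)[OF A(3)] D(2)])
  show d1: "dim (centre S) = 1" unfolding Z by (rule dim_scalars[OF D(2)])
  have "dim_over (centre S) S * dim (centre S) = dim S"
    by (rule dim_over_field[OF F A(1)]) (use A(2,4) centreD(1) in blast)+
  hence "dim_over (centre S) S = dim S" using d1 by simp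
  thus "(deg S u)\<^sup>2 = dim S" "deg S u \<ge> 0" unfolding deg_def csa_degree_def using F by simp_all
qed

lemma deg_second_kind:
  assumes S: "algebra_with_involution S u \<sigma>" and nf: "\<not> first_kind S u"
  shows "2 * (deg S u)\<^sup>2 = dim S" "deg S u \<ge> 0"
proof -
  note D = awiD[OF S]
  note A = algebra_onD[OF D(1)]
  have "2 * (deg S u)\<^sup>2 = dim S \<and> deg S u \<ge> 0"
  proof (cases "field_on (centre S) u")
    case True
    have "dim_over (centre S) S * dim (centre S) = dim S"
      by (rule dim_over_field[OF True A(1)]) (use A(2,4) centreD(1) in blast)+
    hence "real (dim S) = 2 * real (dim_over (centre S) S)"
      unfolding dim_centre_second[OF S nf] by (metis mult.commute of_nat_mult of_nat_numeral)
    thus ?thesis unfolding deg_def csa_degree_def using True by simp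
  next
    case False
    obtain e where e: "split_idempotent S u e" by (rule split_idempotent_exists[OF S False])
    have half: "2 * (csa_degree (corner S f))\<^sup>2 = dim S \<and> csa_degree (corner S f) \<ge> 0"
      if f: "split_idempotent S u f" for f
    proof -
      note f' = split_idempotentD[OF f]
      have alg: "algebra_on (corner S f) f" by (rule algebra_on_corner[OF D(1) centreD(1)[OF f'(1)] f'(2)])
      note CA = algebra_onD[OF alg]
      have "dim_over (scalars f) (corner S f) * dim (scalars f) = dim (corner S f)"
      proof (rule dim_over_field[OF field_on_scalars[OF f'(2,5)] CA(1)])
        have "scalars f \<subseteq> corner S f" unfolding scalars_def using CA(3,10) by blast
        thus "k * v \<in> corner S f" if "k \<in> scalars f" "v \<in> corner S f" for k v using that CA(2) by blast
      qed (rule CA(4))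
      hence "real (dim S) = 2 * real (dim_over (scalars f) (corner S f))"
        using split_corner_dim[OF S f] dim_scalars[OF f'(5)] by simp
      thus ?thesis unfolding csa_degree_def split_corner_centre[OF S f] by simp
    qed
    have "simple_component S (SOME B. simple_component S B)"
      by (rule someI[of _ "corner S e"]) (rule simple_component_exists[OF S e])
    hence "(SOME B. simple_component S B) = corner S e \<or> (SOME B. simple_component S B) = corner S (\<sigma> e)"
      by (rule simple_component_split[OF S e])
    thus ?thesis unfolding deg_def using False half[OF e] half[OF split_idempotent_inv[OF S e]] by auto
  qed
  thus "2 * (deg S u)\<^sup>2 = dim S" "deg S u \<ge> 0" by blast+
qed

end

section \<open>Etale subalgebras\<close>

context fd_algebra
begin

lemma eval_on_pCons:
  assumes "e * x = x" "x * e = x"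
  shows "eval_on e (pCons a p) x = a *s e + x * eval_on e p x"
proof -
  have "e * (x * poly_at p x) = x * e * poly_at p x" using assms by (simp add: mult.assoc[symmetric])
  thus ?thesis unfolding eval_on_poly_at poly_at_pCons
    by (simp add: distrib_left scale_mult_right[symmetric] mult.assoc)
qed

lemma eval_on_0 [simp]: "eval_on e 0 x = 0"
  by (simp add: eval_on_poly_at)

text \<open>
  The idempotent \<open>e\<^sub>i\<close> corresponds to the unity \<open>v\<^sub>i\<close> of the \<open>i\<close>-th factor, and \<open>e\<^sub>iL\<close> to that factor, so
  a minimal polynomial in the factor annihilates the corresponding element of \<open>e\<^sub>iL\<close>.
\<close>

lemma etale_decomposition:
  assumes et: "etale L u"
  obtains n :: nat and e :: "nat \<Rightarrow> 'a" where
    "\<And>x y. x \<in> L \<Longrightarrow> y \<in> L \<Longrightarrow> x * y = y * x"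
    "\<And>i. i < n \<Longrightarrow> e i \<in> L" "\<And>i. i < n \<Longrightarrow> e i * e i = e i"
    "\<And>i j. i < n \<Longrightarrow> j < n \<Longrightarrow> i \<noteq> j \<Longrightarrow> e i * e j = 0" "(\<Sum>i<n. e i) = u"
    "\<And>i. i < n \<Longrightarrow> field_on (corner L (e i)) (e i)"
    "\<And>i x. i < n \<Longrightarrow> x \<in> corner L (e i) \<Longrightarrow> separable_elt (e i) x"
proof -
  have alg: "algebra_on L u" using et unfolding etale_def by blast
  note A = algebra_onD[OF alg]
  obtain n :: nat and K v \<phi> where
    ext: "\<forall>i<n. finite_separable_extension (K i) (v i)" and
    bij: "bij_betw \<phi> L (\<Pi>\<^sub>E i\<in>{..<n}. K i)" and
    hom: "\<forall>i<n. \<phi> u i = v i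
           \<and> (\<forall>x\<in>L. \<forall>y\<in>L. \<phi> (x + y) i = \<phi> x i + \<phi> y i)
           \<and> (\<forall>x\<in>L. \<forall>y\<in>L. \<phi> (x * y) i = \<phi> x i * \<phi> y i)
           \<and> (\<forall>c. \<forall>x\<in>L. \<phi> (c *s x) i = c *s \<phi> x i)"
    using et unfolding etale_def by blast
  have F: "field_on (K i) (v i)" if "i < n" for i
    using ext that unfolding finite_separable_extension_def by blast
  note FA = algebra_onD[OF field_onD(1)[OF F]]
  have \<phi>u: "\<phi> u i = v i" if "i < n" for i using hom that by blast
  have \<phi>add: "\<phi> (x + y) i = \<phi> x i + \<phi> y i" if "i < n" "x \<in> L" "y \<in> L" for i x y using hom that by blast
  have \<phi>mult: "\<phi> (x * y) i = \<phi> x i * \<phi> y i" if "i < n" "x \<in> L" "y \<in> L" for i x y using hom that by blast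
  have \<phi>scale: "\<phi> (c *s x) i = c *s \<phi> x i" if "i < n" "x \<in> L" for c i x using hom that by blast
  have \<phi>0: "\<phi> 0 i = 0" if "i < n" for i using \<phi>scale[OF that A(6), of 0] by simp
  have \<phi>K: "\<phi> x i \<in> K i" if "x \<in> L" "i < n" for x i
    using bij that unfolding bij_betw_def by (auto dest!: equalityD1 simp: PiE_def Pi_def)
  have eqI: "x = y" if xy: "x \<in> L" "y \<in> L" "\<And>i. i < n \<Longrightarrow> \<phi> x i = \<phi> y i" for x y
  proof -
    have "\<phi> x \<in> (\<Pi>\<^sub>E i\<in>{..<n}. K i)" "\<phi> y \<in> (\<Pi>\<^sub>E i\<in>{..<n}. K i)"
      using bij xy(1,2) unfolding bij_betw_def by blast+
    hence "\<phi> x = \<phi> y" by (rule PiE_ext) (use xy(3) in simp)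
    thus ?thesis using bij xy(1,2) unfolding bij_betw_def by (meson inj_onD)
  qed
  have lift: "\<exists>x\<in>L. \<forall>j<n. \<phi> x j = (if j = i then k else 0)" if k: "k \<in> K i" for i k
  proof -
    let ?f = "\<lambda>j\<in>{..<n}. if j = i then k else 0"
    have "?f \<in> (\<Pi>\<^sub>E i\<in>{..<n}. K i)" using k FA(6) by auto
    then obtain x where "x \<in> L" "\<phi> x = ?f" using bij unfolding bij_betw_def by (metis imageE)
    thus ?thesis by (intro bexI[of _ x]) simp_all
  qed
  have "\<forall>i. \<exists>x. i < n \<longrightarrow> x \<in> L \<and> (\<forall>j<n. \<phi> x j = (if j = i then v i else 0))"
    using lift FA(3) by blast
  then obtain e where e: "\<And>i. i < n \<Longrightarrow> e i \<in> L"
    and \<phi>e: "\<And>i j. i < n \<Longrightarrow> j < n \<Longrightarrow> \<phi> (e i) j = (if j = i then v i else 0)" by metis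
  have comm: "x * y = y * x" if xy: "x \<in> L" "y \<in> L" for x y
  proof (rule eqI[OF A(2)[OF xy] A(2)[OF xy(2,1)]])
    fix i assume i: "i < n"
    show "\<phi> (x * y) i = \<phi> (y * x) i"
      unfolding \<phi>mult[OF i xy] \<phi>mult[OF i xy(2,1)]
      by (rule field_onD(3)[OF F[OF i] \<phi>K[OF xy(1) i] \<phi>K[OF xy(2) i]])
  qed
  have ee: "e i * e i = e i" if i: "i < n" for i
  proof (rule eqI[OF A(2)[OF e[OF i] e[OF i]] e[OF i]])
    fix j assume j: "j < n"
    show "\<phi> (e i * e i) j = \<phi> (e i) j"
      unfolding \<phi>mult[OF j e[OF i] e[OF i]] \<phi>e[OF i j] using FA(3,4)[OF i] by simp
  qed
  have orth: "e i * e j = 0" if ij: "i < n" "j < n" "i \<noteq> j" for i j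
  proof (rule eqI[OF A(2)[OF e[OF ij(1)] e[OF ij(2)]] A(6)])
    fix l assume l: "l < n"
    show "\<phi> (e i * e j) l = \<phi> 0 l"
      unfolding \<phi>mult[OF l e[OF ij(1)] e[OF ij(2)]] \<phi>e[OF ij(1) l] \<phi>e[OF ij(2) l] \<phi>0[OF l]
      using ij(3) by simp
  qed
  have sumL: "(\<Sum>i<m. e i) \<in> L" if "m \<le> n" for m
    using e that by (intro subspace_sum[OF A(1)]) simp
  have \<phi>sum: "\<phi> (\<Sum>i<m. e i) j = (if j < m then v j else 0)" if "m \<le> n" "j < n" for m j
    using that(1)
  proof (induction m)
    case 0
    thus ?case using \<phi>0 that(2) by simp
  next
    case (Suc m)
    have "\<phi> ((\<Sum>i<m. e i) + e m) j = \<phi> (\<Sum>i<m. e i) j + \<phi> (e m) j"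
      using Suc.prems sumL e that(2) by (intro \<phi>add) simp_all
    thus ?case using Suc \<phi>e[of m j] that(2) by (auto simp: less_Suc_eq)
  qed
  have sum: "(\<Sum>i<n. e i) = u"
    by (rule eqI[OF sumL[OF order_refl] A(3)]) (simp add: \<phi>sum \<phi>u)
  have cD: "x \<in> L" "e i * x = x" "x * e i = x" if "i < n" "x \<in> corner L (e i)" for i x
    using that(2) unfolding corner_eq_peirce[OF alg e[OF that(1)] ee[OF that(1)]] peirce_def by blast+
  have \<phi>c: "\<phi> x j = 0" if x: "i < n" "x \<in> corner L (e i)" and j: "j < n" "j \<noteq> i" for i j x
  proof -
    have "\<phi> (e i * x) j = \<phi> (e i) j * \<phi> x j" by (rule \<phi>mult[OF j(1) e[OF x(1)] cD(1)[OF x]])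
    thus ?thesis using \<phi>e[OF x(1) j(1)] j(2) cD(2)[OF x] by simp
  qed
  have field: "field_on (corner L (e i)) (e i)" if i: "i < n" for i
    unfolding field_on_def
  proof (intro conjI ballI impI)
    show "algebra_on (corner L (e i)) (e i)" by (rule algebra_on_corner[OF alg e[OF i] ee[OF i]])
    show "e i \<noteq> 0"
    proof
      assume "e i = 0"
      hence "v i = 0" using \<phi>e[OF i i] \<phi>0[OF i] by simp
      thus False using field_onD(2)[OF F[OF i]] by simp
    qed
    show "x * y = y * x" if "x \<in> corner L (e i)" "y \<in> corner L (e i)" for x y
      by (rule comm[OF cD(1)[OF i that(1)] cD(1)[OF i that(2)]])
    fix x assume x: "x \<in> corner L (e i)" "x \<noteq> 0"
    have "\<phi> x i \<noteq> 0"
    proof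
      assume 0: "\<phi> x i = 0"
      have "x = 0"
      proof (rule eqI[OF cD(1)[OF i x(1)] A(6)])
        fix j assume "j < n"
        thus "\<phi> x j = \<phi> 0 j" using 0 \<phi>0 \<phi>c[OF i x(1), of j] by (cases "j = i") simp_all
      qed
      thus False using x(2) by simp
    qed
    then obtain k where k: "k \<in> K i" "\<phi> x i * k = v i"
      using field_onD(4)[OF F[OF i] \<phi>K[OF cD(1)[OF i x(1)] i]] by blast
    obtain y where y: "y \<in> L" "\<forall>j<n. \<phi> y j = (if j = i then k else 0)" using lift[OF k(1)] by blast
    have "e i * y = y"
    proof (rule eqI[OF A(2)[OF e[OF i] y(1)] y(1)])
      fix j assume j: "j < n"
      show "\<phi> (e i * y) j = \<phi> y j"
        unfolding \<phi>mult[OF j e[OF i] y(1)] \<phi>e[OF i j] using y(2) j k(1) FA(4)[OF i] by simp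
    qed
    hence "e i * y * e i = y" using comm[OF e[OF i] y(1)] by simp
    hence "y \<in> corner L (e i)" unfolding corner_def using y(1) by force
    moreover have "x * y = e i"
    proof (rule eqI[OF A(2)[OF cD(1)[OF i x(1)] y(1)] e[OF i]])
      fix j assume j: "j < n"
      show "\<phi> (x * y) j = \<phi> (e i) j"
        unfolding \<phi>mult[OF j cD(1)[OF i x(1)] y(1)] \<phi>e[OF i j] using y(2) j k(2) by simp
    qed
    ultimately show "\<exists>y\<in>corner L (e i). x * y = e i" by blast
  qed
  have sep: "separable_elt (e i) x" if i: "i < n" and x: "x \<in> corner L (e i)" for i x
  proof -
    note xL = cD[OF i x]
    note CA = algebra_onD[OF algebra_on_corner[OF alg e[OF i] ee[OF i]]]
    have xK: "\<phi> x i \<in> K i" by (rule \<phi>K[OF xL(1) i])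
    have ev: "eval_on (e i) p x \<in> corner L (e i) \<and> \<phi> (eval_on (e i) p x) i = eval_on (v i) p (\<phi> x i)" for p
    proof (induction p)
      case 0
      show ?case using CA(6) \<phi>0[OF i] by simp
    next
      case (pCons a p)
      let ?E = "eval_on (e i) p x"
      have E: "?E \<in> corner L (e i)" "?E \<in> L" using pCons cD(1)[OF i] by blast+
      have xE: "x * ?E \<in> L" using A(2) xL(1) E(2) by blast
      have eq: "eval_on (e i) (pCons a p) x = a *s e i + x * ?E" by (rule eval_on_pCons[OF xL(2,3)])
      have "a *s e i + x * ?E \<in> corner L (e i)" using CA(2,3,7,10) x E(1) by blast
      moreover have "\<phi> (a *s e i + x * ?E) i = a *s v i + \<phi> x i * eval_on (v i) p (\<phi> x i)"
        using \<phi>add[OF i A(10)[OF e[OF i]] xE] \<phi>scale[OF i e[OF i]] \<phi>mult[OF i xL(1) E(2)]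
          \<phi>e[OF i i] pCons.IH by simp
      moreover have "a *s v i + \<phi> x i * eval_on (v i) p (\<phi> x i) = eval_on (v i) (pCons a p) (\<phi> x i)"
        by (rule sym, rule eval_on_pCons) (use FA(4,5)[OF i xK] in simp_all)
      ultimately show ?case unfolding eq by simp
    qed
    obtain p where p: "is_min_poly (v i) (\<phi> x i) p" "coprime p (pderiv p)"
      using ext i xK unfolding finite_separable_extension_def by blast
    have "eval_on (e i) p x = 0"
    proof (rule eqI[OF cD(1)[OF i] A(6)])
      show c: "eval_on (e i) p x \<in> corner L (e i)" using ev by blast
      fix j assume j: "j < n"
      show "\<phi> (eval_on (e i) p x) j = \<phi> 0 j"
        using ev[of p] p(1) \<phi>0[OF j] \<phi>c[OF i c j] unfolding is_min_poly_def by (cases "j = i") simp_all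
    qed
    moreover have "p \<noteq> 0" using p(1) unfolding is_min_poly_def by auto
    ultimately show ?thesis unfolding separable_elt_def using p(2) by blast
  qed
  show ?thesis by (rule that[OF comm e ee orth sum field sep])
qed

lemma dim_sum_corners:
  fixes e :: "nat \<Rightarrow> 'a"
  assumes alg: "algebra_on L u" and comm: "\<And>x y. x \<in> L \<Longrightarrow> y \<in> L \<Longrightarrow> x * y = y * x"
    and e: "\<And>i. i < n \<Longrightarrow> e i \<in> L" "\<And>i. i < n \<Longrightarrow> e i * e i = e i"
    and orth: "\<And>i j. i < n \<Longrightarrow> j < n \<Longrightarrow> i \<noteq> j \<Longrightarrow> e i * e j = 0" and sum: "(\<Sum>i<n. e i) = u"
  shows "dim L = (\<Sum>i<n. dim (corner L (e i)))"
proof -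
  note A = algebra_onD[OF alg]
  have uu: "u * u = u" using A(3,4) by blast
  have "(\<Sum>i<n. e i) \<in> L \<and> (\<Sum>i<n. e i) * (\<Sum>i<n. e i) = (\<Sum>i<n. e i)
    \<and> (\<forall>h\<in>L. h * h = h \<longrightarrow> dim (peirce L (\<Sum>i<n. e i) h) = (\<Sum>i<n. dim (peirce L (e i) h)))"
  proof (rule sum_orthogonal_idempotents[OF alg])
    show "e i \<in> L" "e i * e i = e i" if "i \<in> {..<n}" for i using e[of i] that by simp_all
    show "e i * e j = 0" if "i \<in> {..<n}" "j \<in> {..<n}" "i \<noteq> j" for i j
      using orth[of i j] that by simp
  qed simp
  hence "dim (peirce L (\<Sum>i<n. e i) u) = (\<Sum>i<n. dim (peirce L (e i) u))" using A(3) uu by blast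
  moreover have "peirce L u u = L" using A(4,5) by (auto simp: peirce_def)
  moreover have "peirce L (e i) u = corner L (e i)" if i: "i < n" for i
    unfolding corner_eq_peirce[OF alg e(1)[OF i] e(2)[OF i]] peirce_def
    using A(5) comm[OF e(1)[OF i]] by auto
  ultimately show ?thesis using sum by simp
qed

end

section \<open>Symmetric subfields in the unitary case\<close>

context fd_involution
begin

text \<open>
  The algebra \<open>K \<oplus> Kz\<close>, for a symmetric subfield \<open>K\<close> and a central \<open>z\<close> which is not symmetric, is
  either a field or a product of two copies of \<open>K\<close>. In both cases it is a product of fields
  containing the centre, of dimension \<open>2 dim K\<close>.
\<close>

lemma centre_extension:
  assumes S: "algebra_with_involution S u \<sigma>" and z: "z \<in> centre S" "\<sigma> z \<noteq> z"
    and K: "field_on K u" "K \<subseteq> S" "\<forall>x\<in>K. \<sigma> x = x"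
  defines "M \<equiv> {a + b * z | a b. a \<in> K \<and> b \<in> K}"
  shows "quadratic_over_sym M u" "dim M = 2 * dim K" "centre S \<subseteq> M" "M \<subseteq> S"
    "\<And>x. x \<in> M \<Longrightarrow> \<sigma> x = x \<Longrightarrow> x \<in> K" "K \<subseteq> M"
proof -
  note D = awiD[OF S]
  note A = algebra_onD[OF D(1)]
  note KA = algebra_onD[OF field_onD(1)[OF K(1)]]
  note ZA = algebra_onD[OF algebra_on_centre[OF D(1)]]
  note Kc = field_onD(3)[OF K(1)]
  have zS: "z \<in> S" "\<sigma> z \<in> S" using centreD(1)[OF z(1)] D(3) by blast+
  have zc: "z * x = x * z" if "x \<in> S" for x by (rule centreD(2)[OF z(1) that])
  have su: "\<sigma> u = u" by (rule inv_unit[OF D(1,3)])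
  have MI: "a + b * z \<in> M" if "a \<in> K" "b \<in> K" for a b using that unfolding M_def by blast
  show KM: "K \<subseteq> M" using MI[OF _ KA(6)] by auto
  have scK: "c *s u \<in> K" for c using KA(3,10) by blast
  show ZM: "centre S \<subseteq> M"
  proof
    fix w assume "w \<in> centre S"
    then obtain \<alpha> \<beta> where "w = \<alpha> *s u + \<beta> *s z" using centre_basis[OF S z] by blast
    hence "w = \<alpha> *s u + (\<beta> *s u) * z" using A(4)[OF zS(1)] by (simp add: scale_mult_left[symmetric])
    thus "w \<in> M" using MI scK by blast
  qed
  show MS: "M \<subseteq> S" unfolding M_def using K(2) zS A(2,7) by blast
  obtain y where y: "y \<in> centre S" "(z - \<sigma> z) * y = u" using central_skew_invertible[OF S z] by blast
  have cancel: "b = 0" if b: "b \<in> K" "b * (z - \<sigma> z) = 0" for b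
  proof -
    have "b = b * ((z - \<sigma> z) * y)" using y(2) A(5) K(2) b(1) by auto
    also have "\<dots> = b * (z - \<sigma> z) * y" by (simp only: mult.assoc)
    finally show ?thesis using b(2) by simp
  qed
  have \<sigma>M: "\<sigma> (a + b * z) = a + b * \<sigma> z" if "a \<in> K" "b \<in> K" for a b
  proof -
    have "\<sigma> z * b = b * \<sigma> z" using centreD(2)[OF inv_centre[OF D(3) z(1)]] K(2) that(2) by blast
    thus ?thesis using K(3) that by (simp add: inv_add inv_mult)
  qed
  have diff: "(a + b * z) - \<sigma> (a + b * z) = b * (z - \<sigma> z)" if "a \<in> K" "b \<in> K" for a b
    using \<sigma>M[OF that] by (simp add: right_diff_distrib)
  show symK: "x \<in> K" if x: "x \<in> M" "\<sigma> x = x" for x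
  proof -
    obtain a b where ab: "a \<in> K" "b \<in> K" "x = a + b * z" using x(1) unfolding M_def by blast
    have "b * (z - \<sigma> z) = 0" using diff[OF ab(1,2)] x(2) ab(3) by simp
    thus ?thesis using cancel[OF ab(2)] ab by simp
  qed
  have sub: "subspace M"
  proof (rule subspaceI2)
    show "0 \<in> M" using KM KA(6) by blast
    fix x y assume "x \<in> M" "y \<in> M"
    then obtain a b c d where h: "a \<in> K" "b \<in> K" "c \<in> K" "d \<in> K" "x = a + b * z" "y = c + d * z"
      unfolding M_def by blast
    have "x + y = (a + c) + (b + d) * z" unfolding h(5,6) by (simp add: distrib_right)
    moreover have "(a + c) + (b + d) * z \<in> M" using h(1-4) by (intro MI KA(7))
    ultimately show "x + y \<in> M" by simp
  next
    fix c x assume "x \<in> M"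
    then obtain a b where h: "a \<in> K" "b \<in> K" "x = a + b * z" unfolding M_def by blast
    have "c *s x = c *s a + (c *s b) * z" using h by (simp add: scale_right_distrib scale_mult_left)
    thus "c *s x \<in> M" using MI KA(10) h by simp
  qed
  have lz: "b * z \<in> M" if "b \<in> K" for b using MI[OF KA(6) that] by simp
  have zzM: "z * z \<in> M" using ZA(2)[OF z(1) z(1)] ZM by blast
  have Kmult: "k * x \<in> M" if k: "k \<in> K" and x: "x \<in> M" for k x
  proof -
    obtain a b where h: "a \<in> K" "b \<in> K" "x = a + b * z" using x unfolding M_def by blast
    have "k * x = k * a + (k * b) * z" using h by (simp add: distrib_left mult.assoc)
    thus ?thesis using MI KA(2) k h by simp
  qed
  have multM: "x * w \<in> M" if xw: "x \<in> M" "w \<in> M" for x w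
  proof -
    obtain a b c d where h: "a \<in> K" "b \<in> K" "c \<in> K" "d \<in> K" "x = a + b * z" "w = c + d * z"
      using xw unfolding M_def by blast
    have "z * c = c * z" "z * d = d * z" using zc K(2) h by blast+
    hence "b * z * c = b * c * z" "b * z * (d * z) = b * d * (z * z)"
      by (simp_all add: mult.assoc) (metis mult.assoc)
    hence "x * w = (a * c + (a * d + b * c) * z) + (b * d) * (z * z)"
      using h by (simp add: distrib_left distrib_right mult.assoc[symmetric] add_ac)
    moreover have "a * c + (a * d + b * c) * z \<in> M" using h KA(2,7) by (intro MI) blast+
    moreover have "(b * d) * (z * z) \<in> M" using h KA(2) by (intro Kmult[OF _ zzM]) blast
    ultimately show ?thesis using subspace_add[OF sub] by simp
  qed
  have commM: "x * w = w * x" if xw: "x \<in> M" "w \<in> M" for x w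
  proof -
    obtain a b where h: "a \<in> K" "b \<in> K" "x = a + b * z" using xw unfolding M_def by blast
    obtain c d where g: "c \<in> K" "d \<in> K" "w = c + d * z" using xw unfolding M_def by blast
    have wS: "w \<in> S" using xw(2) MS by blast
    have kw: "k * w = w * k" if k: "k \<in> K" for k
    proof -
      have "k * (d * z) = d * k * z" using Kc[OF k g(2)] by (simp only: mult.assoc[symmetric])
      also have "\<dots> = d * z * k" using zc[of k] K(2) k by (simp add: mult.assoc subset_iff)
      finally show ?thesis unfolding g(3) using Kc[OF k g(1)] by (simp add: distrib_left distrib_right)
    qed
    have "b * z * w = b * (w * z)" using zc[OF wS] by (simp add: mult.assoc)
    also have "\<dots> = w * (b * z)" using kw[OF h(2)] by (simp add: mult.assoc[symmetric])
    finally show ?thesis unfolding h(3) using kw[OF h(1)] by (simp add: distrib_left distrib_right)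
  qed
  have alg: "algebra_on M u"
    by (rule algebra_onI[OF sub multM]) (use KM KA(3) MS A(4,5) in blast)+
  have stable: "\<forall>x\<in>M. \<sigma> x \<in> M"
  proof
    fix x assume "x \<in> M"
    then obtain a b where h: "a \<in> K" "b \<in> K" "x = a + b * z" unfolding M_def by blast
    have "\<sigma> z \<in> M" using ZM inv_centre[OF D(3) z(1)] by blast
    thus "\<sigma> x \<in> M" unfolding h(3) \<sigma>M[OF h(1,2)]
      using subspace_add[OF sub] KM h(1) Kmult[OF h(2)] by blast
  qed
  have inv1: "\<exists>w\<in>M. (x - \<sigma> x) * w = u" if x: "x \<in> M" "\<sigma> x \<noteq> x" for x
  proof -
    obtain a b where h: "a \<in> K" "b \<in> K" "x = a + b * z" using x(1) unfolding M_def by blast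
    have d: "x - \<sigma> x = b * (z - \<sigma> z)" unfolding h(3) by (rule diff[OF h(1,2)])
    hence "b \<noteq> 0" using x(2) by auto
    then obtain b' where b': "b' \<in> K" "b * b' = u" using field_onD(4)[OF K(1) h(2)] by blast
    have yM: "y \<in> M" using y(1) ZM by blast
    have "(x - \<sigma> x) * (y * b') = b * ((z - \<sigma> z) * y) * b'" unfolding d by (simp only: mult.assoc)
    also have "\<dots> = u" using y(2) b'(2) KA(5)[OF h(2)] by simp
    finally show ?thesis using multM[OF yM] KM b'(1) by blast
  qed
  have inv2: "\<exists>w\<in>M. \<sigma> w = w \<and> x * w = u" if x: "x \<in> M" "\<sigma> x = x" "x \<noteq> 0" for x
    using field_onD(4)[OF K(1) symK[OF x(1,2)] x(3)] K(3) KM by blast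
  show "quadratic_over_sym M u"
    unfolding quadratic_over_sym_def using alg commM stable inv1 inv2 by blast
  let ?T = "\<lambda>b. b * z"
  have "inj_on ?T K"
  proof (rule inj_onI_lin[OF lin_mult_right KA(1)])
    fix b assume b: "b \<in> K" "b * z = 0"
    have "\<sigma> (0 + b * z) = 0" using b(2) by simp
    hence "b * \<sigma> z = 0" using \<sigma>M[OF KA(6) b(1)] by simp
    thus "b = 0" using cancel[OF b(1)] b(2) by (simp add: right_diff_distrib)
  qed
  hence "dim (?T ` K) = dim K" by (rule dim_image_inj[OF lin_mult_right KA(1)])
  moreover have "K \<inter> ?T ` K = {0}"
  proof -
    have "x = 0" if x: "x \<in> K" "x \<in> ?T ` K" for x
    proof -
      obtain b where b: "b \<in> K" "x = b * z" using x(2) by blast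
      have "b * (z - \<sigma> z) = 0" using diff[OF KA(6) b(1)] bspec[OF K(3) x(1)] b(2) by simp
      thus ?thesis using cancel[OF b(1)] b(2) by simp
    qed
    moreover have "0 \<in> ?T ` K" using KA(6) by (intro image_eqI[of _ _ 0]) simp_all
    ultimately show ?thesis using KA(6) by blast
  qed
  moreover have "M = {x + y | x y. x \<in> K \<and> y \<in> ?T ` K}" unfolding M_def by blast
  ultimately show "dim M = 2 * dim K"
    using dim_direct_sum[OF KA(1) subspace_image_lin[OF lin_mult_right KA(1)], of z] by simp
qed

text \<open>
  If \<open>M\<close> is a field, the bound for subfields applies to it. Otherwise it applies to the fields \<open>Ke\<close>
  and \<open>K\<sigma>(e)\<close> in the corners at \<open>e\<close> and \<open>\<sigma>(e)\<close>, and the square roots of the dimensions of these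
  corners add up.
\<close>

lemma unitary_subfield_bound:
  assumes S: "algebra_with_involution S u \<sigma>" "simple_alg S u" and nf: "\<not> first_kind S u"
    and K: "field_on K u" "K \<subseteq> S" "\<forall>x\<in>K. \<sigma> x = x"
  shows "(2 * dim K)\<^sup>2 \<le> 2 * dim S"
proof -
  note D = awiD[OF S(1)]
  note A = algebra_onD[OF D(1)]
  note KA = algebra_onD[OF field_onD(1)[OF K(1)]]
  obtain z where z: "z \<in> centre S" "\<sigma> z \<noteq> z" by (rule not_first_kind[OF S(1) nf])
  define M where "M = {a + b * z | a b. a \<in> K \<and> b \<in> K}"
  note M = centre_extension[OF S(1) z K, folded M_def]
  note MD = quadratic_over_symD[OF M(1)]
  note MA = algebra_onD[OF MD(1)]
  note dZ = dim_centre_second[OF S(1) nf]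
  show ?thesis
  proof (cases "field_on M u")
    case True
    obtain m where m: "m \<ge> 1" "dim (centre S) * dim S = m * (dim M)\<^sup>2"
      by (rule subfield_dim[OF S(2) True M(4,3)])
    have "1 * (dim M)\<^sup>2 \<le> m * (dim M)\<^sup>2" using m(1) by (rule mult_le_mono1)
    thus ?thesis using m(2) dZ M(2) by simp
  next
    case False
    have half: "real (dim K) \<le> sqrt (2 * real (dim (corner S f)))"
      if f: "f \<in> M" "f * f = f" "f + \<sigma> f = u" "f * \<sigma> f = 0" "f \<noteq> 0" for f
    proof -
      have fS: "f \<in> S" using f(1) M(4) by blast
      let ?K = "(\<lambda>a. a * f) ` K"
      have KM: "a \<in> M" if "a \<in> K" for a using M(6) that by blast
      have prod: "(a * f) * (b * f) = (a * b) * f" if "a \<in> K" "b \<in> K" for a b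
      proof -
        have "(a * f) * (b * f) = a * (f * b) * f" by (simp only: mult.assoc)
        also have "f * b = b * f" by (rule MD(2)[OF f(1) KM[OF that(2)]])
        finally show ?thesis using f(2) by (simp add: mult.assoc)
      qed
      have uf: "u * f = f" "f * u = f" using MA(4,5)[OF f(1)] by blast+
      have F: "field_on ?K f"
        unfolding field_on_def
      proof (intro conjI ballI impI)
        show "algebra_on ?K f"
        proof (rule algebra_onI)
          show "subspace ?K" by (rule subspace_image_lin[OF lin_mult_right KA(1)])
          show "x * y \<in> ?K" if "x \<in> ?K" "y \<in> ?K" for x y using that prod KA(2) by auto
          show "f \<in> ?K" using KA(3) uf(1) by (intro image_eqI[of _ _ u]) simp_all
          show "x * f = x" if "x \<in> ?K" for x using that f(2) by (auto simp: mult.assoc)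
          show "f * x = x" if x: "x \<in> ?K" for x
          proof -
            obtain a where a: "a \<in> K" "x = a * f" using x by blast
            have "f * x = f * a * f" unfolding a(2) by (simp only: mult.assoc)
            also have "f * a = a * f" by (rule MD(2)[OF f(1) KM[OF a(1)]])
            finally show ?thesis using f(2) a(2) by (simp add: mult.assoc)
          qed
        qed
        show "f \<noteq> 0" by fact
        show "x * y = y * x" if "x \<in> ?K" "y \<in> ?K" for x y
          using that prod field_onD(3)[OF K(1)] by auto
        fix x assume x: "x \<in> ?K" "x \<noteq> 0"
        obtain a where a: "a \<in> K" "x = a * f" using x(1) by blast
        hence "a \<noteq> 0" using x(2) by auto
        then obtain b where b: "b \<in> K" "a * b = u" using field_onD(4)[OF K(1) a(1)] by blast
        have "x * (b * f) = f" unfolding a(2) prod[OF a(1) b(1)] b(2) by (rule uf(1))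
        thus "\<exists>y\<in>?K. x * y = f" using b(1) by blast
      qed
      have "inj_on (\<lambda>a. a * f) K"
      proof (rule inj_onI_lin[OF lin_mult_right KA(1)], rule ccontr)
        fix a assume a: "a \<in> K" "a * f = 0" "a \<noteq> 0"
        then obtain b where b: "b \<in> K" "b * a = u" using field_onD(4)[OF K(1) a(1)] by blast
        have "f = b * (a * f)" using b(2) uf(1) by (simp add: mult.assoc[symmetric])
        thus False using a(2) f(5) by simp
      qed
      hence dK: "dim ?K = dim K" by (rule dim_image_inj[OF lin_mult_right KA(1)])
      have "?K \<subseteq> S" using A(2) K(2) fS by blast
      moreover have "f * w \<in> ?K" if w: "w \<in> centre S" for w
      proof -
        have "\<sigma> f \<noteq> f" using f(2,4,5) by auto
        then obtain a b where ab: "a \<in> M" "b \<in> M" "\<sigma> a = a" "\<sigma> b = b" "w = a + b * f"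
          using quadratic_basis[OF M(1) f(1)] w M(3) by blast
        have "f * w = f * a + f * b * f" unfolding ab(5) by (simp only: distrib_left mult.assoc)
        also have "\<dots> = (a + b) * f"
          using MD(2)[OF f(1) ab(1)] MD(2)[OF f(1) ab(2)] f(2) by (simp add: distrib_right mult.assoc)
        finally show ?thesis using KA(7)[OF M(5)[OF ab(1,3)] M(5)[OF ab(2,4)]] by blast
      qed
      ultimately obtain m where m: "m \<ge> 1" "dim (centre S) * dim (corner S f) = m * (dim ?K)\<^sup>2"
        using subfield_corner_dim[OF S(2) fS f(2) F] by metis
      have "1 * (dim K)\<^sup>2 \<le> m * (dim K)\<^sup>2" using m(1) by (rule mult_le_mono1)
      hence "(dim K)\<^sup>2 \<le> 2 * dim (corner S f)" using m(2) dZ dK by simp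
      hence "real ((dim K)\<^sup>2) \<le> real (2 * dim (corner S f))" by (simp only: of_nat_le_iff)
      thus ?thesis by (intro real_le_rsqrt) simp
    qed
    obtain e where e: "e \<in> M" "e * e = e" "e + \<sigma> e = u" "e * \<sigma> e = 0" "e \<noteq> 0"
      by (rule quadratic_not_field[OF M(1) D(2) False])
    have seM: "\<sigma> e \<in> M" using MD(3) e(1) by blast
    have see: "\<sigma> e * \<sigma> e = \<sigma> e" using e(2) by (metis inv_mult)
    have se0: "\<sigma> e * e = 0" using e(4) MD(2)[OF seM e(1)] by simp
    have sen: "\<sigma> e \<noteq> 0" using e(5) by (metis inv_0 inv_inv)
    let ?f = "\<lambda>i::bool. if i then e else \<sigma> e"
    have "sqrt (dim S) = (\<Sum>i\<in>UNIV. sqrt (dim (corner S (?f i))))"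
    proof (rule sqrt_dim_corner_sum[OF S(2)])
      show "?f i \<in> S" for i using e(1) seM M(4) by auto
      show "?f i * ?f i = ?f i" for i using e(2) see by simp
      show "?f i * ?f j = 0" if "i \<noteq> j" for i j using that e(4) se0 by auto
      show "sum ?f UNIV = u" using e(3) by (simp add: UNIV_bool add.commute)
    qed simp
    hence "sqrt 2 * sqrt (dim S) = sqrt (2 * real (dim (corner S e))) + sqrt (2 * real (dim (corner S (\<sigma> e))))"
      by (simp add: UNIV_bool real_sqrt_mult distrib_left add.commute)
    moreover have "real (dim K) \<le> sqrt (2 * real (dim (corner S e)))" by (rule half[OF e])
    moreover have "real (dim K) \<le> sqrt (2 * real (dim (corner S (\<sigma> e))))"
      by (rule half[OF seM see _ _ sen]) (use e(3) se0 in \<open>simp_all add: add.commute\<close>)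
    ultimately have "2 * real (dim K) \<le> sqrt (2 * real (dim S))" by (simp add: real_sqrt_mult)
    hence "(2 * real (dim K))\<^sup>2 \<le> 2 * real (dim S)"
      by (metis of_nat_0_le_iff mult_nonneg_nonneg power_mono real_sqrt_pow2 zero_le_numeral)
    hence "real ((2 * dim K)\<^sup>2) \<le> real (2 * dim S)" by simp
    thus ?thesis by (simp only: of_nat_le_iff)
  qed
qed

end

section \<open>Neatness\<close>

context fd_involution
begin

lemma square_of_square_multiple:
  fixes a b m :: nat
  assumes "a\<^sup>2 = m * b\<^sup>2" "b > 0"
  shows "\<exists>t. m = t\<^sup>2"
proof -
  have "b\<^sup>2 dvd a\<^sup>2" using assms(1) by simp
  hence "b dvd a" by simp
  then obtain t where "a = b * t" by (elim dvdE)
  hence "t\<^sup>2 * b\<^sup>2 = m * b\<^sup>2" using assms(1) by (simp add: power_mult_distrib mult.commute)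
  thus ?thesis using assms(2) by auto
qed

lemma Symd_corner:
  assumes S: "algebra_on S u" and stable: "\<forall>x\<in>S. \<sigma> x \<in> S" and e: "e \<in> S" "e * e = e" "\<sigma> e = e"
    and f: "f * f = f" "\<sigma> f = f" "f * e = f" "f \<in> S" and eS: "e \<in> Symd (corner S e) \<sigma>"
  shows "f \<in> Symd (corner S f) \<sigma>"
proof -
  obtain x where x: "x \<in> corner S e" "e = x + \<sigma> x" using eS unfolding Symd_def by blast
  have xS: "x \<in> S" using x(1) corner_eq_peirce[OF S e(1,2)] by (simp add: peirce_def)
  have "f = f * e * f" using f(1,3) by simp
  also have "\<dots> = f * x * f + \<sigma> (f * x * f)"
    by (subst x(2)) (simp add: distrib_left distrib_right inv_mult f(2) mult.assoc)
  finally show ?thesis unfolding Symd_def corner_def using xS by blast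
qed

lemma corner_unit:
  assumes "algebra_on S u"
  shows "corner S u = S"
proof -
  note A = algebra_onD[OF assms]
  have "u * u = u" using A(3,4) by blast
  thus ?thesis using corner_eq_peirce[OF assms A(3)] A(4,5) by (auto simp: peirce_def)
qed

text \<open>The situation given by an etale algebra \<open>L\<close> of symmetric elements with primitive idempotents \<open>e\<^sub>i\<close>.\<close>

context
  fixes S u L and n :: nat and e
  assumes awi: "algebra_with_involution S u \<sigma>" and LS: "L \<subseteq> Sym S \<sigma>" and Lalg: "algebra_on L u"
    and comm: "\<And>x y. x \<in> L \<Longrightarrow> y \<in> L \<Longrightarrow> x * y = y * x"
    and eL: "\<And>i. i < n \<Longrightarrow> e i \<in> L" and ee: "\<And>i. i < n \<Longrightarrow> e i * e i = e i"
    and orth: "\<And>i j. i < n \<Longrightarrow> j < n \<Longrightarrow> i \<noteq> j \<Longrightarrow> e i * e j = 0" and sum: "(\<Sum>i<n. e i) = u"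
    and field: "\<And>i. i < n \<Longrightarrow> field_on (corner L (e i)) (e i)"
    and sep: "\<And>i x. i < n \<Longrightarrow> x \<in> corner L (e i) \<Longrightarrow> separable_elt (e i) x"
begin

lemma sym_in: "x \<in> L \<Longrightarrow> x \<in> S" "x \<in> L \<Longrightarrow> \<sigma> x = x"
  using LS unfolding Sym_def by blast+

lemma corner_field_in:
  assumes "i < n" "x \<in> corner L (e i)"
  shows "x \<in> L" "x \<in> corner S (e i)" "x \<in> S" "\<sigma> x = x"
proof -
  have x: "x \<in> L" "e i * x = x" "x * e i = x"
    using assms(2) unfolding corner_eq_peirce[OF Lalg eL[OF assms(1)] ee[OF assms(1)]] peirce_def by blast+
  thus "x \<in> L" "x \<in> S" "\<sigma> x = x" using sym_in by blast+
  thus "x \<in> corner S (e i)"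
    unfolding corner_eq_peirce[OF awiD(1)[OF awi] sym_in(1)[OF eL[OF assms(1)]] ee[OF assms(1)]] peirce_def
    using x by blast
qed

lemma e_nonzero: "i < n \<Longrightarrow> e i \<noteq> 0"
  using field_onD(2)[OF field] by blast

lemma dim_L: "dim L = (\<Sum>i<n. dim (corner L (e i)))"
  by (rule dim_sum_corners[OF Lalg comm eL ee orth sum])

lemma free_if_ranks:
  assumes "\<And>i. i < n \<Longrightarrow> dim (peirce S (e i) u) = r * dim (corner L (e i))"
  shows "free_left_module L S"
proof (rule free_if_equal_ranks[OF awiD(1)[OF awi] Lalg _ awiD(2)[OF awi]])
  show "L \<subseteq> S" using sym_in by blast
  show "x * y = y * x" if "x \<in> L" "y \<in> L" for x y by (rule comm[OF that])
  show "finite {..<n}" by simp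
  show "sum e {..<n} = u" by (rule sum)
  fix i assume "i \<in> {..<n}"
  hence i: "i < n" by simp
  show "e i \<in> L" "e i * e i = e i" by (rule eL[OF i] ee[OF i])+
  show "field_on (corner L (e i)) (e i)" by (rule field[OF i])
  show "dim (peirce S (e i) u) = r * dim (corner L (e i))" by (rule assms[OF i])
  show "e i * e j = 0" if "j \<in> {..<n}" "i \<noteq> j" for j using orth[of i j] that i by simp
qed

lemma stable_corner:
  assumes "i < n" "x \<in> corner S (e i)"
  shows "\<sigma> x \<in> corner S (e i)"
proof -
  note D = awiD[OF awi]
  have ei: "e i \<in> S" "\<sigma> (e i) = e i" using sym_in eL[OF assms(1)] by blast+
  show ?thesis using inv_peirce[OF D(3), of x "e i" "e i"] assms(2) ei(2)
    unfolding corner_eq_peirce[OF D(1) ei(1) ee[OF assms(1)]] by simp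
qed

lemma maximal_field_type:
  assumes i: "i < n" and max: "centraliser (corner S (e i)) (corner L (e i)) = corner L (e i)"
    and symd: "e i \<in> Symd (corner S (e i)) \<sigma>"
  shows "(2::'f) \<noteq> 0" "\<not> dim (Symd (corner S (e i)) \<sigma>) < dim (Skew (corner S (e i)) \<sigma>)"
proof -
  note ei = sym_in(1)[OF eL[OF i]]
  have alg: "algebra_on (corner S (e i)) (e i)" by (rule algebra_on_corner[OF awiD(1)[OF awi] ei ee[OF i]])
  have st: "\<forall>x\<in>corner S (e i). \<sigma> x \<in> corner S (e i)" using stable_corner[OF i] by blast
  have sub: "corner L (e i) \<subseteq> corner S (e i)" using corner_field_in(2)[OF i] by blast
  show "(2::'f) \<noteq> 0" "\<not> dim (Symd (corner S (e i)) \<sigma>) < dim (Skew (corner S (e i)) \<sigma>)"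
    using symmetric_maximal_subfield[OF alg st field[OF i] sub corner_field_in(4)[OF i] sep[OF i] max symd]
    by blast+
qed

lemma first_kind_corner_field:
  assumes fk: "first_kind S u" and i: "i < n"
  obtains m where "m \<ge> 1" "dim (corner S (e i)) = m * (dim (corner L (e i)))\<^sup>2"
    "m = 1 \<longrightarrow> centraliser (corner S (e i)) (corner L (e i)) = corner L (e i)"
proof -
  note D = awiD[OF awi]
  note sA = simple_if_centre_field[OF awi deg_first_kind(2)[OF awi fk]]
  have ei: "e i \<in> S" using sym_in eL[OF i] by blast
  have sub: "corner L (e i) \<subseteq> S" using corner_field_in(3)[OF i] by blast
  have zin: "e i * z \<in> corner L (e i)" if "z \<in> centre S" for z
  proof -
    obtain c where "z = c *s u" using \<open>z \<in> centre S\<close> fk unfolding first_kind_def scalars_def by blast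
    hence "e i * z = c *s e i" using algebra_onD(5)[OF D(1) ei] by (simp add: scale_mult_right[symmetric])
    thus ?thesis using algebra_onD(3,10)[OF field_onD(1)[OF field[OF i]]] by simp
  qed
  obtain m where "m \<ge> 1" "dim (centre S) * dim (corner S (e i)) = m * (dim (corner L (e i)))\<^sup>2"
    "m = 1 \<longrightarrow> centraliser (corner S (e i)) (corner L (e i)) = corner L (e i)"
    by (rule subfield_corner_dim[OF sA ei ee[OF i] field[OF i] sub zin])
  thus ?thesis using that[of m] deg_first_kind(3)[OF awi fk] by simp
qed

text \<open>This will be used with \<open>t = 1\<close> for orthogonal and \<open>t = 2\<close> for symplectic involutions.\<close>

lemma ranks_first_kind:
  assumes fk: "first_kind S u" and total: "(t * dim L)\<^sup>2 = dim S"
    and bound: "\<forall>i<n. (t * dim (corner L (e i)))\<^sup>2 \<le> dim (corner S (e i))"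
    and i: "i < n"
  shows "dim (corner S (e i)) = (t * dim (corner L (e i)))\<^sup>2"
    "dim (peirce S (e i) u) = (t * t * dim L) * dim (corner L (e i))"
proof -
  note sA = simple_if_centre_field[OF awi deg_first_kind(2)[OF awi fk]]
  note d1 = deg_first_kind(3)[OF awi fk]
  have tot: "(\<Sum>i<n. t * dim (corner L (e i))) = t * dim L" unfolding dim_L by (simp only: sum_distrib_left)
  have "dim (centre S) * dim (corner S (e i)) = (t * dim (corner L (e i)))\<^sup>2 \<and>
    dim (centre S) * dim (peirce S (e i) u) = t * dim (corner L (e i)) * (\<Sum>j<n. t * dim (corner L (e j))) \<and>
    dim (centre S) * dim (peirce S u (e i)) = t * dim (corner L (e i)) * (\<Sum>j<n. t * dim (corner L (e j)))"
  proof (rule bounds_attained[OF sA, where f = e and I = "{..<n}"])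
    show "e i \<in> S" if "i \<in> {..<n}" for i using sym_in eL that by simp
    show "e i * e i = e i" if "i \<in> {..<n}" for i using ee that by simp
    show "e i * e j = 0" if "i \<in> {..<n}" "j \<in> {..<n}" "i \<noteq> j" for i j using orth[of i j] that by simp
    show "sum e {..<n} = u" by (rule sum)
    show "(t * dim (corner L (e i)))\<^sup>2 \<le> dim (centre S) * dim (corner S (e i))" if "i \<in> {..<n}" for i
      using bound that d1 by simp
    show "(\<Sum>i<n. t * dim (corner L (e i)))\<^sup>2 = dim (centre S) * dim S" unfolding tot total d1 by simp
  qed (use i in simp_all)
  thus "dim (corner S (e i)) = (t * dim (corner L (e i)))\<^sup>2"
    "dim (peirce S (e i) u) = (t * t * dim L) * dim (corner L (e i))"
    unfolding tot d1 by (simp_all only: mult_1 mult.assoc mult.left_commute mult.commute)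
qed

text \<open>
  If the corner at \<open>f\<close> were symplectic, the dimension condition would hold in \<open>S\<close> too, so \<open>u\<close> could
  not lie in \<open>Symd\<close> and \<open>2 = 0\<close>. But \<open>e\<^sub>i \<in> Symd\<close> for any \<open>e\<^sub>i\<close> below \<open>f\<close>, and \<open>e\<^sub>iL\<close> is its own
  centraliser, which forces \<open>2 \<noteq> 0\<close>.
\<close>

lemma orthogonal_case:
  assumes orthog: "orthogonal S u \<sigma>" and total: "(dim L)\<^sup>2 = dim S"
  shows "free_left_module L S"
    "\<And>f. f \<in> L \<Longrightarrow> f \<noteq> 0 \<Longrightarrow> f * f = f \<Longrightarrow> orthogonal (corner S f) f \<sigma>"
proof -
  note D = awiD[OF awi]
  note A = algebra_onD[OF D(1)]
  have fk: "first_kind S u" and ns: "\<not> symplectic S u \<sigma>" using orthog unfolding orthogonal_def by blast+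
  note sA = simple_if_centre_field[OF awi deg_first_kind(2)[OF awi fk]]
  have tot: "(1 * dim L)\<^sup>2 = dim S" using total by simp
  have bound: "\<forall>i<n. (1 * dim (corner L (e i)))\<^sup>2 \<le> dim (corner S (e i))"
  proof (intro allI impI)
    fix i assume i: "i < n"
    obtain m where m: "m \<ge> 1" "dim (corner S (e i)) = m * (dim (corner L (e i)))\<^sup>2"
      "m = 1 \<longrightarrow> centraliser (corner S (e i)) (corner L (e i)) = corner L (e i)"
      by (rule first_kind_corner_field[OF fk i])
    have "1 * (dim (corner L (e i)))\<^sup>2 \<le> m * (dim (corner L (e i)))\<^sup>2" using m(1) by (rule mult_le_mono1)
    thus "(1 * dim (corner L (e i)))\<^sup>2 \<le> dim (corner S (e i))" using m(2) by simp
  qed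
  note ranks = ranks_first_kind[OF fk tot bound]
  show "free_left_module L S" by (rule free_if_ranks) (rule ranks(2))
  fix f assume f: "f \<in> L" "f \<noteq> 0" "f * f = f"
  have fS: "f \<in> S" "\<sigma> f = f" using sym_in f(1) by blast+
  have fk': "first_kind (corner S f) f" using first_kind_corner_iff[OF awi fS(1) f(3) fS(2) f(2)] fk by simp
  have "\<not> symplectic (corner S f) f \<sigma>"
  proof
    assume "symplectic (corner S f) f \<sigma>"
    hence dims: "dim (Symd (corner S f) \<sigma>) < dim (Skew (corner S f) \<sigma>)" and symd: "f \<in> Symd (corner S f) \<sigma>"
      unfolding symplectic_def by blast+
    have "dim (Symd S \<sigma>) < dim (Skew S \<sigma>)"
      using Skew_Symd_dims_corner[OF sA D(3) fS(1) f(3,2) fS(2) A(3) A(4)[OF A(3)] D(2) inv_unit[OF D(1,3)] dims]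
      unfolding corner_unit[OF D(1)] .
    hence nu: "u \<notin> Symd S \<sigma>" using ns fk unfolding symplectic_def by blast
    have "\<exists>i<n. e i * f \<noteq> 0"
    proof (rule ccontr)
      assume "\<not> ?thesis"
      hence "(\<Sum>i<n. e i) * f = 0" unfolding sum_distrib_right by simp
      thus False using sum A(4)[OF fS(1)] f(2) by simp
    qed
    then obtain i where i: "i < n" "e i * f \<noteq> 0" by blast
    have ef: "e i * f = f * e i" by (rule comm[OF eL[OF i(1)] f(1)])
    have "e i * (f * e i) = e i * (e i * f)" using ef by simp
    hence "e i * f * e i = e i * e i * f" by (simp only: mult.assoc)
    hence efe: "e i * f * e i = e i * f" using ee[OF i(1)] by simp
    have efK: "e i * f \<in> corner L (e i)" using f(1) efe unfolding corner_def by force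
    have idem: "(e i * f) * (e i * f) = e i * f"
    proof -
      have "(e i * f) * (e i * f) = (e i * f * e i) * f" by (simp only: mult.assoc)
      also have "\<dots> = e i * f * f" by (simp only: efe)
      also have "\<dots> = e i * f" by (simp only: mult.assoc f(3))
      finally show ?thesis .
    qed
    obtain y where y: "y \<in> corner L (e i)" "e i * f * y = e i"
      using field_onD(4)[OF field[OF i(1)] efK i(2)] by blast
    have "e i * f = (e i * f) * e i" by (simp only: efe)
    also have "\<dots> = (e i * f) * (e i * f) * y" using y(2) by (simp only: mult.assoc)
    also have "\<dots> = e i" using idem y(2) by simp
    finally have eif: "e i * f = e i" .
    have symd_i: "e i \<in> Symd (corner S (e i)) \<sigma>"
      by (rule Symd_corner[OF D(1,3) fS(1) f(3) fS(2) ee[OF i(1)] sym_in(2)[OF eL[OF i(1)]] eif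
            sym_in(1)[OF eL[OF i(1)]] symd])
    obtain m where m: "m \<ge> 1" "dim (corner S (e i)) = m * (dim (corner L (e i)))\<^sup>2"
      "m = 1 \<longrightarrow> centraliser (corner S (e i)) (corner L (e i)) = corner L (e i)"
      by (rule first_kind_corner_field[OF fk i(1)])
    have "m * (dim (corner L (e i)))\<^sup>2 = 1 * (dim (corner L (e i)))\<^sup>2" using ranks(1)[OF i(1)] m(2) by simp
    moreover have "(dim (corner L (e i)))\<^sup>2 > 0" using field_dim_pos[OF field[OF i(1)]] by (rule zero_less_power)
    ultimately have "m = 1" by (metis mult_cancel2 less_irrefl)
    hence two: "(2::'f) \<noteq> 0" using maximal_field_type(1)[OF i(1) _ symd_i] m(3) by blast
    have "u = inverse (2::'f) *s u + \<sigma> (inverse (2::'f) *s u)"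
    proof -
      have "u + u = (2::'f) *s u" using scale_left_distrib[of 1 1 u] by simp
      thus ?thesis using two inv_unit[OF D(1,3)] by (simp add: inv_scale scale_right_distrib[symmetric])
    qed
    thus False using nu A(3,10) unfolding Symd_def by blast
  qed
  thus "orthogonal (corner S f) f \<sigma>" using fk' unfolding orthogonal_def by blast
qed

text \<open>
  The corners at the \<open>e\<^sub>i\<close> are symplectic, so \<open>e\<^sub>iL\<close> is not its own centraliser, and \<open>m \<noteq> 1\<close> in
  \<open>dim e\<^sub>iSe\<^sub>i = m (dim e\<^sub>iL)\<^sup>2\<close>. The ratio of \<open>dim e\<^sub>iSe\<^sub>i\<close> to \<open>dim S = (2 dim L)\<^sup>2\<close> is the square of a
  rational number, so \<open>m\<close> is a square, and \<open>m \<ge> 4\<close>.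
\<close>

lemma symplectic_case:
  assumes sympl: "symplectic S u \<sigma>" and total: "(2 * dim L)\<^sup>2 = dim S"
  shows "free_left_module L S"
    "\<And>f. f \<in> L \<Longrightarrow> f \<noteq> 0 \<Longrightarrow> f * f = f \<Longrightarrow> symplectic (corner S f) f \<sigma>"
proof -
  note D = awiD[OF awi]
  note A = algebra_onD[OF D(1)]
  note uu = A(4)[OF A(3)]
  note cu = corner_unit[OF D(1)]
  note su = inv_unit[OF D(1,3)]
  have fk: "first_kind S u" and dims: "dim (Symd S \<sigma>) < dim (Skew S \<sigma>)" and uS: "u \<in> Symd S \<sigma>"
    using sympl unfolding symplectic_def by blast+
  note sA = simple_if_centre_field[OF awi deg_first_kind(2)[OF awi fk]]
  show corner_type: "symplectic (corner S f) f \<sigma>" if f: "f \<in> L" "f \<noteq> 0" "f * f = f" for f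
  proof -
    have fS: "f \<in> S" "\<sigma> f = f" using sym_in f(1) by blast+
    have "first_kind (corner S f) f" using first_kind_corner_iff[OF awi fS(1) f(3) fS(2) f(2)] fk by simp
    moreover have "dim (Symd (corner S f) \<sigma>) < dim (Skew (corner S f) \<sigma>)"
      by (rule Skew_Symd_dims_corner[OF sA D(3) A(3) uu D(2) su fS(1) f(3,2) fS(2)]) (use dims cu in simp)
    moreover have "f \<in> Symd (corner S f) \<sigma>"
      by (rule Symd_corner[OF D(1,3) A(3) uu su f(3) fS(2) A(5)[OF fS(1)] fS(1)]) (use uS cu in simp)
    ultimately show ?thesis unfolding symplectic_def by blast
  qed
  have bound: "\<forall>i<n. (2 * dim (corner L (e i)))\<^sup>2 \<le> dim (corner S (e i))"
  proof (intro allI impI)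
    fix i assume i: "i < n"
    let ?k = "dim (corner L (e i))"
    obtain m where m: "m \<ge> 1" "dim (corner S (e i)) = m * ?k\<^sup>2"
      "m = 1 \<longrightarrow> centraliser (corner S (e i)) (corner L (e i)) = corner L (e i)"
      by (rule first_kind_corner_field[OF fk i])
    have "symplectic (corner S (e i)) (e i) \<sigma>" by (rule corner_type[OF eL[OF i] e_nonzero[OF i] ee[OF i]])
    hence "m \<noteq> 1" using maximal_field_type(2)[OF i] m(3) unfolding symplectic_def by blast
    obtain p q :: nat where pq: "p > 0" "q > 0" "p\<^sup>2 * dim (corner S u) = q\<^sup>2 * dim (corner S (e i))"
      by (rule corner_dims_ratio_square[OF sA sym_in(1)[OF eL[OF i]] ee[OF i] e_nonzero[OF i] A(3) uu D(2)])
    have "(p * (2 * dim L))\<^sup>2 = m * (q * ?k)\<^sup>2"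
      using pq(3) unfolding cu m(2) total[symmetric] by (simp only: power_mult_distrib mult.assoc mult.left_commute)
    moreover have "q * ?k > 0" using pq(2) field_dim_pos[OF field[OF i]] by (rule mult_pos_pos)
    ultimately obtain t where t: "m = t\<^sup>2" using square_of_square_multiple by blast
    have "t \<noteq> 0" using t m(1) by (intro notI) simp
    moreover have "t \<noteq> 1" using t \<open>m \<noteq> 1\<close> by (intro notI) simp
    ultimately have "2 \<le> t" by simp
    hence "2\<^sup>2 \<le> m" unfolding t by (rule power_mono) simp
    hence "2\<^sup>2 * ?k\<^sup>2 \<le> m * ?k\<^sup>2" by (rule mult_le_mono1)
    thus "(2 * ?k)\<^sup>2 \<le> dim (corner S (e i))" unfolding m(2) by (simp only: power_mult_distrib)
  qed
  show "free_left_module L S" by (rule free_if_ranks) (rule ranks_first_kind(2)[OF fk total bound])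
qed

text \<open>
  When the centre is a field, each \<open>e\<^sub>iL\<close> generates with it a product of fields of twice the
  dimension in the simple algebra \<open>e\<^sub>iSe\<^sub>i\<close>.
\<close>

lemma unitary_field_case:
  assumes nf: "\<not> first_kind S u" and F: "field_on (centre S) u" and total: "2 * (dim L)\<^sup>2 = dim S"
  shows "free_left_module L S"
proof (rule free_if_ranks)
  note D = awiD[OF awi]
  note sA = simple_if_centre_field[OF awi F]
  note d2 = dim_centre_second[OF awi nf]
  fix i assume i: "i < n"
  have bound: "(2 * dim (corner L (e i)))\<^sup>2 \<le> 2 * dim (corner S (e i))" if i: "i < n" for i
  proof (rule unitary_subfield_bound[OF _ _ _ field[OF i]])
    have ei: "e i \<in> S" "\<sigma> (e i) = e i" using sym_in eL[OF i] by blast+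
    show "algebra_with_involution (corner S (e i)) (e i) \<sigma>"
      by (rule algebra_with_involution_corner[OF awi ei(1) ee[OF i] ei(2) e_nonzero[OF i]])
    show "simple_alg (corner S (e i)) (e i)" by (rule simple_corner[OF sA ei(1) ee[OF i] e_nonzero[OF i]])
    show "\<not> first_kind (corner S (e i)) (e i)"
      using first_kind_corner_iff[OF awi ei(1) ee[OF i] ei(2) e_nonzero[OF i]] nf by simp
    show "corner L (e i) \<subseteq> corner S (e i)" "\<forall>x\<in>corner L (e i). \<sigma> x = x"
      using corner_field_in(2,4)[OF i] by blast+
  qed
  have tot: "(\<Sum>i<n. 2 * dim (corner L (e i))) = 2 * dim L" unfolding dim_L by (simp only: sum_distrib_left)
  have "dim (centre S) * dim (corner S (e i)) = (2 * dim (corner L (e i)))\<^sup>2 \<and>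
    dim (centre S) * dim (peirce S (e i) u) = 2 * dim (corner L (e i)) * (\<Sum>j<n. 2 * dim (corner L (e j))) \<and>
    dim (centre S) * dim (peirce S u (e i)) = 2 * dim (corner L (e i)) * (\<Sum>j<n. 2 * dim (corner L (e j)))"
  proof (rule bounds_attained[OF sA, where f = e and I = "{..<n}"])
    show "e i \<in> S" if "i \<in> {..<n}" for i using sym_in eL that by simp
    show "e i * e i = e i" if "i \<in> {..<n}" for i using ee that by simp
    show "e i * e j = 0" if "i \<in> {..<n}" "j \<in> {..<n}" "i \<noteq> j" for i j using orth[of i j] that by simp
    show "sum e {..<n} = u" by (rule sum)
    show "(2 * dim (corner L (e i)))\<^sup>2 \<le> dim (centre S) * dim (corner S (e i))" if "i \<in> {..<n}" for i
      using bound[of i] that d2 by simp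
    show "(\<Sum>i<n. 2 * dim (corner L (e i)))\<^sup>2 = dim (centre S) * dim S"
      unfolding tot d2 total[symmetric] by (simp add: power_mult_distrib)
  qed (use i in simp_all)
  thus "dim (peirce S (e i) u) = (2 * dim L) * dim (corner L (e i))" unfolding tot d2 by simp
qed

text \<open>
  When the centre is split by \<open>c\<close>, the algebra \<open>cS\<close> is central simple over the base field and
  \<open>cL\<close> is a maximal product of fields in it. As a left \<open>L\<close>-module \<open>\<sigma>(c)S\<close> is the image under \<open>\<sigma>\<close> of
  \<open>cS\<close> as a right module.
\<close>

lemma unitary_split_case:
  assumes c: "split_idempotent S u c" and total: "2 * (dim L)\<^sup>2 = dim S"
  shows "free_left_module L S"
proof (rule free_if_ranks)
  note D = awiD[OF awi]
  note A = algebra_onD[OF D(1)]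
  note c' = split_idempotentD[OF c]
  note s' = split_idempotentD[OF split_idempotent_inv[OF awi c]]
  note cS = centreD(1)[OF c'(1)]
  note cc = corner_central[OF D(1) c'(1,2)]
  let ?B = "corner S c"
  note B = split_corner_simple[OF awi c]
  note BA = algebra_onD[OF simple_algD(1)[OF B]]
  have cB: "centre ?B = scalars c" by (rule split_corner_centre[OF awi c])
  have dZ: "dim (centre ?B) = 1" unfolding cB by (rule dim_scalars[OF c'(5)])
  have dB: "dim ?B = (dim L)\<^sup>2" using split_corner_dim[OF awi c] total by simp
  have com: "c * x = x * c" if "x \<in> S" for x by (rule centreD(2)[OF c'(1) that])
  have cmult: "(c * x) * (c * y) = c * (x * y)" if "x \<in> S" for x y
  proof -
    have "(c * x) * (c * y) = (c * c) * (x * y)" using com[OF that] by (simp add: mult.assoc) (metis mult.assoc)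
    thus ?thesis using c'(2) by simp
  qed
  let ?f = "\<lambda>i. c * e i" and ?K = "\<lambda>i. (\<lambda>x. c * x) ` corner L (e i)"
  have eS: "e i \<in> S" if "i < n" for i using sym_in eL[OF that] by blast
  have fB: "?f i \<in> ?B" "?f i * ?f i = ?f i" if "i < n" for i
    using cc(1) eS[OF that] cmult[OF eS[OF that]] ee[OF that] by auto
  have forth: "?f i * ?f j = 0" if "i < n" "j < n" "i \<noteq> j" for i j
    using cmult[OF eS[OF that(1)]] orth[OF that] by simp
  have fsum: "(\<Sum>i<n. ?f i) = c" unfolding sum_distrib_left[symmetric] sum using A(5)[OF cS] .
  have cinj: "x = 0" if x: "x \<in> L" "c * x = 0" for x
  proof -
    have "\<sigma> (c * x) = 0" using x(2) by simp
    hence "x * \<sigma> c = 0" using sym_in(2)[OF x(1)] by (simp add: inv_mult)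
    moreover have "x * c = 0" using com[OF sym_in(1)[OF x(1)]] x(2) by simp
    ultimately have "x * (c + \<sigma> c) = 0" by (simp add: distrib_left)
    thus ?thesis using c'(3) A(5)[OF sym_in(1)[OF x(1)]] by simp
  qed
  have Kdim: "dim (?K i) = dim (corner L (e i))" if i: "i < n" for i
  proof (rule dim_image_inj[OF lin_mult_left algebra_onD(1)[OF field_onD(1)[OF field[OF i]]]])
    show "inj_on (\<lambda>x. c * x) (corner L (e i))"
      by (rule inj_onI_lin[OF lin_mult_left algebra_onD(1)[OF field_onD(1)[OF field[OF i]]]])
        (use cinj corner_field_in(1)[OF i] in blast)
  qed
  have KF: "field_on (?K i) (?f i)" if i: "i < n" for i
    unfolding field_on_def
  proof (intro conjI ballI impI)
    note Ki = field[OF i]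
    note KA = algebra_onD[OF field_onD(1)[OF Ki]]
    note KS = corner_field_in(3)[OF i]
    show "algebra_on (?K i) (?f i)"
    proof (rule algebra_onI)
      show "subspace (?K i)" by (rule subspace_image_lin[OF lin_mult_left KA(1)])
      show "x * y \<in> ?K i" if "x \<in> ?K i" "y \<in> ?K i" for x y using that cmult[OF KS] KA(2) by auto
      show "?f i \<in> ?K i" using KA(3) by blast
      show "?f i * x = x" if "x \<in> ?K i" for x using that cmult[OF eS[OF i]] KA(4) by auto
      show "x * ?f i = x" if "x \<in> ?K i" for x using that cmult[OF KS] KA(5) by auto
    qed
    show "?f i \<noteq> 0" using cinj[OF eL[OF i]] e_nonzero[OF i] by blast
    show "x * y = y * x" if xy: "x \<in> ?K i" "y \<in> ?K i" for x y
    proof -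
      obtain a b where ab: "a \<in> corner L (e i)" "b \<in> corner L (e i)" "x = c * a" "y = c * b" using xy by blast
      show ?thesis unfolding ab(3,4) cmult[OF KS[OF ab(1)]] cmult[OF KS[OF ab(2)]]
        using field_onD(3)[OF Ki ab(1,2)] by simp
    qed
    fix x assume x: "x \<in> ?K i" "x \<noteq> 0"
    then obtain a where a: "a \<in> corner L (e i)" "x = c * a" by blast
    hence "a \<noteq> 0" using x(2) by auto
    then obtain b where b: "b \<in> corner L (e i)" "a * b = e i" using field_onD(4)[OF Ki a(1)] by blast
    have "x * (c * b) = ?f i" unfolding a(2) cmult[OF KS[OF a(1)]] b(2) ..
    thus "\<exists>y\<in>?K i. x * y = ?f i" using b(1) by blast
  qed
  have bound: "(dim (corner L (e i)))\<^sup>2 \<le> dim (centre ?B) * dim (corner ?B (?f i))" if i: "i < n" for i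
  proof -
    have "?K i \<subseteq> ?B" using corner_field_in(3)[OF i] cc(1) by blast
    moreover have "?f i * z \<in> ?K i" if z: "z \<in> centre ?B" for z
    proof -
      obtain k where "z = k *s c" using z unfolding cB scalars_def by blast
      hence "?f i * z = k *s ?f i" using BA(5)[OF fB(1)[OF i]] by (simp add: scale_mult_right[symmetric])
      thus ?thesis using algebra_onD(3,10)[OF field_onD(1)[OF KF[OF i]]] by simp
    qed
    ultimately obtain m where m: "m \<ge> 1" "dim (centre ?B) * dim (corner ?B (?f i)) = m * (dim (?K i))\<^sup>2"
      using subfield_corner_dim[OF B fB[OF i] KF[OF i]] by metis
    have "1 * (dim (?K i))\<^sup>2 \<le> m * (dim (?K i))\<^sup>2" using m(1) by (rule mult_le_mono1)
    thus ?thesis using m(2) Kdim[OF i] by simp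
  qed
  fix i assume i: "i < n"
  let ?k = "dim (corner L (e i))"
  have "dim (centre ?B) * dim (corner ?B (?f i)) = ?k\<^sup>2 \<and>
    dim (centre ?B) * dim (peirce ?B (?f i) c) = ?k * (\<Sum>j<n. dim (corner L (e j))) \<and>
    dim (centre ?B) * dim (peirce ?B c (?f i)) = ?k * (\<Sum>j<n. dim (corner L (e j)))"
  proof (rule bounds_attained[OF B, where f = ?f and I = "{..<n}"])
    show "?f i \<in> ?B" "?f i * ?f i = ?f i" if "i \<in> {..<n}" for i using fB that by simp_all
    show "?f i * ?f j = 0" if "i \<in> {..<n}" "j \<in> {..<n}" "i \<noteq> j" for i j using forth[of i j] that by simp
    show "sum ?f {..<n} = c" by (rule fsum)
    show "(dim (corner L (e i)))\<^sup>2 \<le> dim (centre ?B) * dim (corner ?B (?f i))" if "i \<in> {..<n}" for i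
      using bound[of i] that by simp
    show "(\<Sum>i<n. dim (corner L (e i)))\<^sup>2 = dim (centre ?B) * dim ?B"
      unfolding dZ dB dim_L by simp
  qed (use i in simp_all)
  hence dims: "dim (peirce ?B (?f i) c) = ?k * dim L" "dim (peirce ?B c (?f i)) = ?k * dim L"
    unfolding dZ dim_L by simp_all
  let ?P = "peirce ?B (?f i) c" and ?Q = "peirce ?B c (?f i)"
  have sP: "subspace ?P" "subspace ?Q" by (rule subspace_peirce[OF BA(1)])+
  have sQ: "subspace (\<sigma> ` ?Q)" by (rule subspace_image_lin[OF lin_inv sP(2)])
  have "inj_on \<sigma> ?Q" by (rule inj_onI) (metis inv_inv)
  hence dQ: "dim (\<sigma> ` ?Q) = ?k * dim L" using dim_image_inj[OF lin_inv sP(2)] dims(2) by simp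
  have si: "\<sigma> (e i) = e i" by (rule sym_in(2)[OF eL[OF i]])
  have "peirce S (e i) u = {x + y | x y. x \<in> ?P \<and> y \<in> \<sigma> ` ?Q}"
  proof
    show "peirce S (e i) u \<subseteq> {x + y | x y. x \<in> ?P \<and> y \<in> \<sigma> ` ?Q}"
    proof
      fix x assume x: "x \<in> peirce S (e i) u"
      note x' = peirceE[OF x]
      have sx: "\<sigma> x \<in> S" using D(3) x'(1) by blast
      have "c * x \<in> ?B" using cc(1) x'(1) by blast
      hence "c * x \<in> ?P" using cmult[OF eS[OF i], of x] x'(2) BA(5) by (simp add: peirce_def)
      moreover have "c * \<sigma> x \<in> ?Q"
      proof -
        have "c * \<sigma> x \<in> ?B" using cc(1) sx by blast
        moreover have "\<sigma> x * e i = \<sigma> x" using x'(2) si by (metis inv_mult)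
        hence "(c * \<sigma> x) * ?f i = c * \<sigma> x" using cmult[OF sx] by simp
        ultimately show ?thesis using BA(4) by (simp add: peirce_def)
      qed
      hence "\<sigma> (c * \<sigma> x) \<in> \<sigma> ` ?Q" by blast
      hence "x * \<sigma> c \<in> \<sigma> ` ?Q" by (simp add: inv_mult)
      moreover have "x = c * x + x * \<sigma> c"
      proof -
        have "x * (c + \<sigma> c) = x" using c'(3) A(5)[OF x'(1)] by simp
        thus ?thesis using com[OF x'(1)] by (simp add: distrib_left)
      qed
      ultimately show "x \<in> {x + y | x y. x \<in> ?P \<and> y \<in> \<sigma> ` ?Q}" by blast
    qed
    show "{x + y | x y. x \<in> ?P \<and> y \<in> \<sigma> ` ?Q} \<subseteq> peirce S (e i) u"
    proof
      fix w assume "w \<in> {x + y | x y. x \<in> ?P \<and> y \<in> \<sigma> ` ?Q}"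
      then obtain x q where xq: "w = x + \<sigma> q" "x \<in> ?P" "q \<in> ?Q" by blast
      have x: "x \<in> S" "c * x = x" "c * e i * x = x" using xq(2) cc(2) unfolding peirce_def by blast+
      have q: "q \<in> S" "c * q = q" "q * (c * e i) = q" using xq(3) cc(2) unfolding peirce_def by blast+
      have "e i * x = e i * c * x" using x(2) by (simp add: mult.assoc)
      also have "\<dots> = c * e i * x" using com[OF eS[OF i]] by simp
      finally have ex: "e i * x = x" using x(3) by simp
      have "q * e i = q * (c * e i) * e i" using q(3) by simp
      also have "\<dots> = q * (c * (e i * e i))" by (simp only: mult.assoc)
      finally have "q * e i = q" using q(3) ee[OF i] by simp
      hence "e i * \<sigma> q = \<sigma> q" using si by (metis inv_mult)
      hence "e i * w = w" using ex xq(1) by (simp add: distrib_left)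
      moreover have wS: "w \<in> S" unfolding xq(1) using A(7) x(1) q(1) D(3) by blast
      ultimately show "w \<in> peirce S (e i) u" using A(5)[OF wS] by (simp add: peirce_def)
    qed
  qed
  moreover have "?P \<inter> \<sigma> ` ?Q = {0}"
  proof -
    have "x = 0" if x: "x \<in> ?P" "x \<in> \<sigma> ` ?Q" for x
    proof -
      obtain q where q: "q \<in> ?Q" "x = \<sigma> q" using x(2) by blast
      have qc: "q \<in> S" "c * q = q" using q(1) cc(2) unfolding peirce_def by blast+
      have xS: "x \<in> S" "c * x = x" using x(1) cc(2) unfolding peirce_def by blast+
      have "x * \<sigma> c = x" using qc(2) q(2) by (metis inv_mult)
      hence "x = x * c * \<sigma> c" using xS com[OF xS(1)] by simp
      thus ?thesis using c'(4) by (simp add: mult.assoc)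
    qed
    thus ?thesis using subspace_0[OF sP(1)] subspace_0[OF sQ] by blast
  qed
  ultimately have "dim (peirce S (e i) u) = ?k * dim L + ?k * dim L"
    using dim_direct_sum[OF sP(1) sQ] dims(1) dQ by simp
  thus "dim (peirce S (e i) u) = (2 * dim L) * ?k" by simp
qed

lemma unitary_case:
  assumes nf: "\<not> first_kind S u" and total: "2 * (dim L)\<^sup>2 = dim S"
  shows "free_left_module L S"
    "\<And>f. f \<in> L \<Longrightarrow> f \<noteq> 0 \<Longrightarrow> f * f = f \<Longrightarrow> unitary (corner S f) f"
proof -
  show "free_left_module L S"
  proof (cases "field_on (centre S) u")
    case True
    thus ?thesis by (rule unitary_field_case[OF nf _ total])
  next
    case False
    obtain c where "split_idempotent S u c" by (rule split_idempotent_exists[OF awi False])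
    thus ?thesis by (rule unitary_split_case[OF _ total])
  qed
  fix f assume f: "f \<in> L" "f \<noteq> 0" "f * f = f"
  have fS: "f \<in> S" "\<sigma> f = f" using sym_in f(1) by blast+
  have "\<not> first_kind (corner S f) f" using first_kind_corner_iff[OF awi fS(1) f(3) fS(2) f(2)] nf by simp
  thus "unitary (corner S f) f" unfolding unitary_def
    by (rule second_kind_if_not_first[OF algebra_with_involution_corner[OF awi fS(1) f(3) fS(2) f(2)]])
qed

end

lemma neat_if_dim_eq_cap:
  assumes awi: "algebra_with_involution S u \<sigma>" and et: "etale L u" and LS: "L \<subseteq> Sym S \<sigma>"
    and cap: "real (dim L) = cap S u \<sigma>"
  shows "neat S u \<sigma> L"
proof -
  note D = awiD[OF awi]
  have Lalg: "algebra_on L u" using et unfolding etale_def by blast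
  obtain n :: nat and e where e:
    "\<And>x y. x \<in> L \<Longrightarrow> y \<in> L \<Longrightarrow> x * y = y * x"
    "\<And>i. i < n \<Longrightarrow> e i \<in> L" "\<And>i. i < n \<Longrightarrow> e i * e i = e i"
    "\<And>i j. i < n \<Longrightarrow> j < n \<Longrightarrow> i \<noteq> j \<Longrightarrow> e i * e j = 0" "(\<Sum>i<n. e i) = u"
    "\<And>i. i < n \<Longrightarrow> field_on (corner L (e i)) (e i)"
    "\<And>i x. i < n \<Longrightarrow> x \<in> corner L (e i) \<Longrightarrow> separable_elt (e i) x"
    by (rule etale_decomposition[OF et]) blast
  note data = awi LS Lalg e
  have "free_left_module L S \<and> (\<forall>f\<in>L. f \<noteq> 0 \<and> f * f = f \<longrightarrow> same_type S u (corner S f) f \<sigma>)"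
  proof (cases "first_kind S u")
    case True
    note deg = deg_first_kind[OF awi True]
    show ?thesis
    proof (cases "symplectic S u \<sigma>")
      case sympl: True
      have "deg S u = 2 * real (dim L)" using cap sympl unfolding cap_def by simp
      hence "real ((2 * dim L)\<^sup>2) = real (dim S)" using deg(1) by simp
      hence "(2 * dim L)\<^sup>2 = dim S" by (simp only: of_nat_eq_iff)
      note this = symplectic_case[OF data sympl this]
      thus ?thesis using sympl unfolding same_type_def by blast
    next
      case False
      hence orthog: "orthogonal S u \<sigma>" using True unfolding orthogonal_def by blast
      have "deg S u = real (dim L)" using cap False unfolding cap_def by simp
      hence "real ((dim L)\<^sup>2) = real (dim S)" using deg(1) by simp
      hence "(dim L)\<^sup>2 = dim S" by (simp only: of_nat_eq_iff)
      note this = orthogonal_case[OF data orthog this]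
      thus ?thesis using orthog unfolding same_type_def by blast
    qed
  next
    case False
    hence "deg S u = real (dim L)" using cap unfolding cap_def symplectic_def by simp
    hence "real (2 * (dim L)\<^sup>2) = real (dim S)" using deg_second_kind(1)[OF awi False] by simp
    hence "2 * (dim L)\<^sup>2 = dim S" by (simp only: of_nat_eq_iff)
    note this = unitary_case[OF data False this]
    moreover have "unitary S u" unfolding unitary_def by (rule second_kind_if_not_first[OF awi False])
    ultimately show ?thesis unfolding same_type_def by blast
  qed
  moreover have "algebra_with_involution (corner S f) f \<sigma>" if "f \<in> L" "f \<noteq> 0" "f * f = f" for f
    using algebra_with_involution_corner[OF awi] LS that unfolding Sym_def by blast
  moreover have "L \<subseteq> S" using LS unfolding Sym_def by blast
  ultimately show ?thesis unfolding neat_def using et LS by blast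
qed

end

theorem proposition5p6:
  fixes scale :: "'f::field \<Rightarrow> 'a::ring_1 \<Rightarrow> 'a"
    and \<sigma> :: "'a \<Rightarrow> 'a" and L :: "'a set"
  assumes "assoc_algebra scale"
    and "assoc_algebra.algebra_with_involution scale UNIV 1 \<sigma>"
    and "assoc_algebra.etale scale L 1"
    and "L \<subseteq> assoc_algebra.Sym UNIV \<sigma>"
    and "real (vector_space.dim scale L) = assoc_algebra.cap scale UNIV 1 \<sigma>"
  shows "assoc_algebra.neat scale UNIV 1 \<sigma> L"
proof -
  interpret assoc_algebra scale by (rule assms(1))
  note inv = assms(2)[unfolded algebra_with_involution_def]
  have "finite_dim UNIV" using inv by blast
  then obtain Basis where "fd_algebra scale Basis" by (rule fd_algebra_if_finite_dim)
  then interpret fd_algebra scale Basis .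
  interpret fd_involution scale Basis \<sigma>
    by unfold_locales (use inv in \<open>simp_all\<close>)
  show ?thesis by (rule neat_if_dim_eq_cap[OF assms(2-5)])
qed

end
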